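(* Fix $\rho>1$ and constants $\mu,\theta_1,\theta_2\geqslant0$ and $\sigma_1^2,\sigma_2^2\geqslant 0$. Suppose that, for horizon of play $n$, the mean reward of arm $i\in\{1,2\}$ is $\mu_i=\mu+\theta_i/\sqrt n$ and its reward variance is $\sigma_i^2$. Define $\Delta_0:=|\theta_1-\theta_2|$. Let $S_{i,m}:=\sum_{j=1}^{N_i(m)}X_{i,j}$ be the cumulative reward earned from arm $i$ until time $m$, and let $\tilde S_{i,m}:=S_{i,m}-\mu N_i(m)$. Then, under the canonical UCB policy $\pi$ with exploration coefficient $\rho$, the following process-level convergences over $t\in[0,1]$ hold as $n\to\infty$: (I) $$\left(\frac{\tilde S_{1,\lfloor nt\rfloor}}{\sqrt n},\frac{\tilde S_{2,\lfloor nt\rfloor}}{\sqrt n}\right)_{t\in[0,1]}\Rightarrow\left(\frac{\theta_1t}{2}+\frac{\sigma_1}{\sqrt2}B_1(t),\ \frac{\theta_2t}{2}+\frac{\sigma_2}{\sqrt2}B_2(t)\right)_{t\in[0,1]},$$ (II) $$\left(\frac{R^\pi_{\lfloor nt\rfloor}}{\sqrt n}\right)_{t\in[0,1]}\Rightarrow\left(\frac{\Delta_0t}{2}+\sqrt{\frac{\sigma_1^2+\sigma_2^2}{2}}\,\tilde B(t)\right)_{t\in[0,1]},$$ where $B_1,B_2$ are independent standard Brownian motions in $\mathbb{R}$ and $\tilde B(t):=-\sqrt{\frac{\sigma_1^2}{\sigma_1^2+\sigma_2^2}}B_1(t)-\sqrt{\frac{\sigma_2^2}{\sigma_1^2+\sigma_2^2}}B_2(t)$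 (if $\sigma_1=\sigma_2=0$, the term $\sqrt{(\sigma_1^2+\sigma_2^2)/2}\,\tilde B(t)$ is read as $0$).
   Context: Model. There are two arms, indexed by $\{1,2\}$. For each (sufficiently large) horizon $n$ there is an instance in which arm $i$ has a reward distribution $\mathcal{P}_i=\mathcal{P}_i^{(n)}$ supported on $[0,1]$ with mean $\mu_i=\mu_i^{(n)}$. The reward from the $j$-th pull of arm $i$ is $X_{i,j}$; in the $n$-th instance the variables $(X_{i,j})_{j\geqslant1}$ are i.i.d. with law $\mathcal{P}_i^{(n)}$, and the two sequences are independent of each other. $N_i(m)$ denotes the number of pulls of arm $i$ up to and including time $m$ (with $N_i(0)=0$). All quantities in the claim are those of the $n$-th instance. Canonical UCB policy with exploration coefficient $\rho$. At times $t=1,2$ play each arm once. At each time $t\geqslant3$ play an arm $$\pi_t\in\arg\max_{i\in\{1,2\}}\left(\bar X_i(t-1)+\sqrt{\frac{\rho\log(t-1)}{N_i(t-1)}}\right),\qquad \bar X_i(t-1)=\frac{\sum_{j=1}^{N_i(t-1)}X_{i,j}}{N_i(t-1)},$$ where ties in the argmax are broken by an arbitrary non-anticipating rule (based only on past observations and possibly independent randomization). Stochastic regret. With $\pi_s\in\{1,2\}$ the arm played at time $s$, $$R_m^\pi:=\sum_{s=1}^m\left[\max(\mu_1,\mu_2)-X_{\pi_s,N_{\pi_s}(s)}\right].$$ $\Rightarrow$ denotes weak convergence of processes in the space of right-continuous functions with left limits on $[0,1]$ (valued in $\mathbb{R}^2$ for (I) and in $\mathbb{R}$ for (II)), endowed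 with the Skorohod metric. *)

theory Defs
  imports "HOL-Probability.Probability"
begin

text \<open>
  Paths are functions on the whole real line that are \<^const>\<open>undefined\<close> outside the unit interval,
  so that equality of paths means equality on the unit interval.
\<close>

definition cadlag01 :: "(real \<Rightarrow> 'b::metric_space) set" where
  "cadlag01 = {x \<in> extensional {0..1}.
     (\<forall>t\<in>{0..<1}. (x \<longlongrightarrow> x t) (at_right t)) \<and>
     (\<forall>t\<in>{0<..1}. \<exists>l. (x \<longlongrightarrow> l) (at_left t))}"

definition time_changes :: "(real \<Rightarrow> real) set" where
  "time_changes = {\<tau>. strict_mono_on {0..1} \<tau> \<and> continuous_on {0..1} \<tau> \<and> bij_betw \<tau> {0..1} {0..1}}"

definition skorohod_close :: "(real \<Rightarrow> 'b::metric_space) \<Rightarrow> (real \<Rightarrow> 'b) \<Rightarrow> real \<Rightarrow> bool" where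
  "skorohod_close x y e \<longleftrightarrow>
     0 \<le> e \<and> (\<exists>\<tau>\<in>time_changes. \<forall>t\<in>{0..1}. \<bar>\<tau> t - t\<bar> \<le> e \<and> dist (x t) (y (\<tau> t)) \<le> e)"

text \<open>
  For vector-valued paths a single time change is applied to all coordinates.
  The value off \<^const>\<open>cadlag01\<close> is irrelevant; it is set to \<open>0\<close> only because the
  library notion of a metric space wants a distance that is nonnegative and symmetric on the whole type.
\<close>

definition skorohod_dist :: "(real \<Rightarrow> 'b::metric_space) \<Rightarrow> (real \<Rightarrow> 'b) \<Rightarrow> real" where
  "skorohod_dist x y =
     (if x \<in> cadlag01 \<and> y \<in> cadlag01 then Inf {e. skorohod_close x y e} else 0)"

lemma time_changes_id: "(\<lambda>t. t) \<in> time_changes"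
  by (auto simp: time_changes_def strict_mono_on_def bij_betw_def)

lemma time_changes_range: "\<tau> \<in> time_changes \<Longrightarrow> t \<in> {0..1} \<Longrightarrow> \<tau> t \<in> {0..1}"
  unfolding time_changes_def bij_betw_def by blast

lemma time_changes_one:
  assumes "\<tau> \<in> time_changes" shows "\<tau> 1 = 1"
proof -
  have b: "bij_betw \<tau> {0..1} {0..1}" and m: "strict_mono_on {0..1} \<tau>"
    using assms by (auto simp: time_changes_def)
  have "(1::real) \<in> \<tau> ` {0..1}" using b by (simp add: bij_betw_def)
  then obtain s where s: "s \<in> {0..1}" "\<tau> s = 1" by auto
  have "\<not> s < 1"
  proof
    assume "s < 1"
    then have "\<tau> s < \<tau> 1" using m s(1) by (auto simp: strict_mono_on_def)
    then show False using time_changes_range[OF assms, of 1] s(2) by simp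
  qed
  then show ?thesis using s by auto
qed

lemma time_changes_comp:
  assumes "\<tau> \<in> time_changes" "\<tau>' \<in> time_changes" shows "\<tau>' \<circ> \<tau> \<in> time_changes"
proof -
  have b: "bij_betw \<tau> {0..1} {0..1}" "bij_betw \<tau>' {0..1} {0..1}"
    and m: "strict_mono_on {0..1} \<tau>" "strict_mono_on {0..1} \<tau>'"
    and c: "continuous_on {0..1} \<tau>" "continuous_on {0..1} \<tau>'"
    using assms by (auto simp: time_changes_def)
  have "bij_betw (\<tau>' \<circ> \<tau>) {0..1} {0..1}" by (rule bij_betw_trans[OF b])
  moreover have "continuous_on {0..1} (\<tau>' \<circ> \<tau>)"
    using c b(1) by (intro continuous_on_compose) (auto simp: bij_betw_def)
  moreover have "strict_mono_on {0..1} (\<tau>' \<circ> \<tau>)"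
    unfolding strict_mono_on_def
  proof (intro allI impI)
    fix r s :: real assume rs: "r \<in> {0..1} \<and> s \<in> {0..1} \<and> r < s"
    then have "\<tau> r < \<tau> s" using m(1) by (auto simp: strict_mono_on_def)
    then show "(\<tau>' \<circ> \<tau>) r < (\<tau>' \<circ> \<tau>) s"
      using m(2) rs time_changes_range[OF assms(1)] unfolding strict_mono_on_def by (metis comp_apply)
  qed
  ultimately show ?thesis by (simp add: time_changes_def)
qed

lemma time_changes_inv:
  assumes "\<tau> \<in> time_changes" shows "inv_into {0..1} \<tau> \<in> time_changes"
proof -
  let ?i = "inv_into {0..1} \<tau>"
  have b: "bij_betw \<tau> {0..1} {0..1}" and m: "strict_mono_on {0..1} \<tau>"
    and c: "continuous_on {0..1} \<tau>"
    using assms by (auto simp: time_changes_def)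
  have inj: "inj_on \<tau> {0..1}" and im: "\<tau> ` {0..1} = {0..1}" using b by (auto simp: bij_betw_def)
  have "continuous_on (\<tau> ` {0..1}) ?i"
    by (rule continuous_on_inv[OF c]) (auto simp: inv_into_f_f[OF inj])
  then have "continuous_on {0..1} ?i" by (simp only: im)
  moreover have bi: "bij_betw ?i {0..1} {0..1}" by (rule bij_betw_inv_into[OF b])
  moreover have "strict_mono_on {0..1} ?i"
    unfolding strict_mono_on_def
  proof (intro allI impI)
    fix r s :: real assume rs: "r \<in> {0..1} \<and> s \<in> {0..1} \<and> r < s"
    have r: "\<tau> (?i r) = r" "\<tau> (?i s) = s" using rs im by (auto intro!: f_inv_into_f simp del: image_eqI)
    have i: "?i r \<in> {0..1}" "?i s \<in> {0..1}" using bi rs unfolding bij_betw_def by blast+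
    show "?i r < ?i s"
    proof (rule ccontr)
      assume "\<not> ?i r < ?i s"
      then have "?i s < ?i r \<or> ?i s = ?i r" by auto
      then have "\<tau> (?i s) \<le> \<tau> (?i r)" using m i unfolding strict_mono_on_def by (metis order.order_iff_strict)
      then show False using r rs by simp
    qed
  qed
  ultimately show ?thesis by (simp add: time_changes_def)
qed

lemma cadlag01_locally_bounded:
  fixes x :: "real \<Rightarrow> 'b::metric_space"
  assumes x: "x \<in> cadlag01" and t: "t \<in> {0..1}"
  obtains d where "0 < d" "bounded (x ` ({0..1} \<inter> {t-d<..<t+d}))"
proof -
  have "\<exists>d>0. bounded (x ` ({0..1} \<inter> {t<..<t+d}))"
  proof (cases "t < 1")
    case True
    then have "(x \<longlongrightarrow> x t) (at_right t)" using x t by (auto simp: cadlag01_def)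
    then have "eventually (\<lambda>s. dist (x s) (x t) < 1) (at_right t)" by (rule tendstoD) simp
    then obtain b where b: "b > t" "\<And>y. t < y \<Longrightarrow> y < b \<Longrightarrow> dist (x y) (x t) < 1"
      by (auto simp: eventually_at_right_field)
    have "x ` ({0..1} \<inter> {t<..<t+(b-t)}) \<subseteq> cball (x t) 1"
      using b(2) by (auto simp: dist_commute less_imp_le)
    then show ?thesis using b(1) bounded_subset[OF bounded_cball] by (intro exI[of _ "b - t"]) auto
  next
    case False
    then have "{0..1} \<inter> {t<..<t+1} = {}" using t by auto
    then show ?thesis by (intro exI[of _ 1]) (simp only: image_empty bounded_empty zero_less_one simp_thms)
  qed
  then obtain d1 where d1: "d1 > 0" "bounded (x ` ({0..1} \<inter> {t<..<t+d1}))" by blast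
  have "\<exists>d>0. bounded (x ` ({0..1} \<inter> {t-d<..<t}))"
  proof (cases "0 < t")
    case True
    then have "t \<in> {0<..1}" using t by simp
    then obtain l where "(x \<longlongrightarrow> l) (at_left t)" using x unfolding cadlag01_def by blast
    then have "eventually (\<lambda>s. dist (x s) l < 1) (at_left t)" by (rule tendstoD) simp
    then obtain b where b: "b < t" "\<And>y. b < y \<Longrightarrow> y < t \<Longrightarrow> dist (x y) l < 1"
      by (auto simp: eventually_at_left_field)
    have "x ` ({0..1} \<inter> {t-(t-b)<..<t}) \<subseteq> cball l 1"
      using b(2) by (auto simp: dist_commute less_imp_le)
    then show ?thesis using b(1) bounded_subset[OF bounded_cball] by (intro exI[of _ "t - b"]) auto
  next
    case False
    then have "{0..1} \<inter> {t-1<..<t} = {}" using t by auto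
    then show ?thesis by (intro exI[of _ 1]) (simp only: image_empty bounded_empty zero_less_one simp_thms)
  qed
  then obtain d2 where d2: "d2 > 0" "bounded (x ` ({0..1} \<inter> {t-d2<..<t}))" by blast
  have "x ` ({0..1} \<inter> {t - min d1 d2<..<t + min d1 d2}) \<subseteq>
        x ` ({0..1} \<inter> {t<..<t+d1}) \<union> x ` ({0..1} \<inter> {t-d2<..<t}) \<union> {x t}"
  proof (rule image_subsetI)
    fix s assume "s \<in> {0..1} \<inter> {t - min d1 d2<..<t + min d1 d2}"
    then show "x s \<in> x ` ({0..1} \<inter> {t<..<t+d1}) \<union> x ` ({0..1} \<inter> {t-d2<..<t}) \<union> {x t}"
      by (cases s t rule: linorder_cases) auto
  qed
  moreover have "bounded (x ` ({0..1} \<inter> {t<..<t+d1}) \<union> x ` ({0..1} \<inter> {t-d2<..<t}) \<union> {x t})"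
    using d1 d2 by (simp only: bounded_Un) auto
  ultimately have "bounded (x ` ({0..1} \<inter> {t - min d1 d2<..<t + min d1 d2}))"
    by (rule bounded_subset[rotated])
  then show ?thesis using d1(1) d2(1) by (intro that[of "min d1 d2"]) auto
qed

lemma cadlag01_bounded:
  fixes x :: "real \<Rightarrow> 'b::metric_space"
  assumes x: "x \<in> cadlag01" shows "bounded (x ` {0..1})"
proof -
  have "\<forall>t\<in>{0..1}. \<exists>d>0. bounded (x ` ({0..1} \<inter> {t-d<..<t+d}))"
    using cadlag01_locally_bounded[OF x] by metis
  then obtain d where d: "\<And>t. t \<in> {0..1} \<Longrightarrow> d t > 0"
      "\<And>t. t \<in> {0..1} \<Longrightarrow> bounded (x ` ({0..1} \<inter> {t-d t<..<t+d t}))" by metis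
  have "compact {0..1::real}" by simp
  moreover have "\<And>t. t \<in> {0..1} \<Longrightarrow> open {t-d t<..<t+d t}" by simp
  moreover have "{0..1} \<subseteq> (\<Union>t\<in>{0..1}. {t-d t<..<t+d t})"
    using d(1) by (intro subsetI UN_I) auto
  ultimately obtain C where C: "C \<subseteq> {0..1}" "finite C" "{0..1} \<subseteq> (\<Union>t\<in>C. {t-d t<..<t+d t})"
    using compactE_image[of "{0..1::real}" "{0..1}" "\<lambda>t. {t-d t<..<t+d t}"] by metis
  have "x ` {0..1} \<subseteq> (\<Union>t\<in>C. x ` ({0..1} \<inter> {t-d t<..<t+d t}))"
    using C(3) by blast
  moreover have "bounded (\<Union>t\<in>C. x ` ({0..1} \<inter> {t-d t<..<t+d t}))"
    using C d(2) by (intro bounded_UN) auto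
  ultimately show ?thesis by (rule bounded_subset[rotated])
qed

lemma skorohod_close_sym:
  assumes "skorohod_close x y e" shows "skorohod_close y x e"
proof -
  obtain \<tau> where \<tau>: "\<tau> \<in> time_changes"
    "\<And>t. t \<in> {0..1} \<Longrightarrow> \<bar>\<tau> t - t\<bar> \<le> e \<and> dist (x t) (y (\<tau> t)) \<le> e" and e: "0 \<le> e"
    using assms by (auto simp: skorohod_close_def)
  let ?i = "inv_into {0..1} \<tau>"
  have i: "?i \<in> time_changes" by (rule time_changes_inv[OF \<tau>(1)])
  have "\<bar>?i t - t\<bar> \<le> e \<and> dist (y t) (x (?i t)) \<le> e" if t: "t \<in> {0..1}" for t
  proof -
    have "t \<in> \<tau> ` {0..1}" using \<tau>(1) t by (simp add: time_changes_def bij_betw_def)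
    then have "\<tau> (?i t) = t" by (rule f_inv_into_f)
    then show ?thesis using \<tau>(2)[OF time_changes_range[OF i t]] by (simp add: dist_commute abs_minus_commute)
  qed
  then show ?thesis using i e unfolding skorohod_close_def by blast
qed

lemma skorohod_close_trans:
  assumes "skorohod_close x y e" "skorohod_close y z e'" shows "skorohod_close x z (e + e')"
proof -
  obtain \<tau> where \<tau>: "\<tau> \<in> time_changes"
    "\<And>t. t \<in> {0..1} \<Longrightarrow> \<bar>\<tau> t - t\<bar> \<le> e \<and> dist (x t) (y (\<tau> t)) \<le> e" and e: "0 \<le> e"
    using assms(1) by (auto simp: skorohod_close_def)
  obtain \<tau>' where \<tau>': "\<tau>' \<in> time_changes"
    "\<And>t. t \<in> {0..1} \<Longrightarrow> \<bar>\<tau>' t - t\<bar> \<le> e' \<and> dist (y t) (z (\<tau>' t)) \<le> e'" and e': "0 \<le> e'"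
    using assms(2) by (auto simp: skorohod_close_def)
  have "\<bar>(\<tau>' \<circ> \<tau>) t - t\<bar> \<le> e + e' \<and> dist (x t) (z ((\<tau>' \<circ> \<tau>) t)) \<le> e + e'" if t: "t \<in> {0..1}" for t
  proof -
    have 1: "\<bar>\<tau> t - t\<bar> \<le> e" "dist (x t) (y (\<tau> t)) \<le> e" using \<tau>(2)[OF t] by auto
    have 2: "\<bar>\<tau>' (\<tau> t) - \<tau> t\<bar> \<le> e'" "dist (y (\<tau> t)) (z (\<tau>' (\<tau> t))) \<le> e'"
      using \<tau>'(2)[OF time_changes_range[OF \<tau>(1) t]] by auto
    have "dist (x t) (z (\<tau>' (\<tau> t))) \<le> dist (x t) (y (\<tau> t)) + dist (y (\<tau> t)) (z (\<tau>' (\<tau> t)))"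
      by (rule dist_triangle)
    then show ?thesis using 1 2 by (simp add: abs_le_iff)
  qed
  then show ?thesis using time_changes_comp[OF \<tau>(1) \<tau>'(1)] e e' unfolding skorohod_close_def
    by (intro conjI bexI[of _ "\<tau>' \<circ> \<tau>"]) auto
qed

lemma skorohod_close_ex:
  fixes x y :: "real \<Rightarrow> 'b::metric_space"
  assumes "x \<in> cadlag01" "y \<in> cadlag01" shows "\<exists>e. skorohod_close x y e"
proof -
  have "bounded (x ` {0..1} \<union> y ` {0..1})"
    using assms cadlag01_bounded by (simp only: bounded_Un) auto
  then obtain e where e: "\<And>a b. a \<in> x ` {0..1} \<union> y ` {0..1} \<Longrightarrow> b \<in> x ` {0..1} \<union> y ` {0..1} \<Longrightarrow> dist a b \<le> e"
    unfolding bounded_two_points by blast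
  have d: "dist (x t) (y t) \<le> e" if "t \<in> {0..1}" for t using that by (intro e) auto
  have "0 \<le> e" using d[of 0] zero_le_dist[of "x 0" "y 0"] by (meson atLeastAtMost_iff order.trans order_refl zero_le_one)
  then show ?thesis using d time_changes_id unfolding skorohod_close_def
    by (intro exI[of _ e] conjI bexI[of _ "\<lambda>t. t"]) auto
qed

lemma skorohod_dist_le: 
  assumes "x \<in> cadlag01" "y \<in> cadlag01" "skorohod_close x y e" shows "skorohod_dist x y \<le> e"
proof -
  have "bdd_below {e. skorohod_close x y e}" by (rule bdd_belowI[of _ 0]) (simp add: skorohod_close_def)
  then show ?thesis using assms by (auto simp: skorohod_dist_def intro: cInf_lower)
qed

lemma skorohod_dist_lessD:
  assumes "x \<in> cadlag01" "y \<in> cadlag01" "skorohod_dist x y < r"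
  shows "\<exists>e<r. skorohod_close x y e"
  using assms skorohod_close_ex[OF assms(1,2)] cInf_lessD[of "{e. skorohod_close x y e}" r]
  by (auto simp: skorohod_dist_def)

lemma skorohod_dist_zero_right:
  fixes x y :: "real \<Rightarrow> 'b::metric_space"
  assumes x: "x \<in> cadlag01" and y: "y \<in> cadlag01" and 0: "skorohod_dist x y = 0" and t: "t \<in> {0..<1}"
  shows "x t = y t"
proof -
  have "dist (x t) (y t) \<le> 4 * e" if e: "e > 0" for e :: real
  proof -
    have "eventually (\<lambda>s. dist (x s) (x t) < e) (at_right t)"
      using x t e by (intro tendstoD) (auto simp: cadlag01_def)
    moreover have "eventually (\<lambda>s. dist (y s) (y t) < e) (at_right t)"
      using y t e by (intro tendstoD) (auto simp: cadlag01_def)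
    ultimately have "eventually (\<lambda>s. dist (x s) (x t) < e \<and> dist (y s) (y t) < e) (at_right t)"
      by eventually_elim auto
    then obtain b where b: "b > t"
      "\<And>s. t < s \<Longrightarrow> s < b \<Longrightarrow> dist (x s) (x t) < e \<and> dist (y s) (y t) < e"
      by (auto simp: eventually_at_right_field)
    define c where "c = min b 1"
    define s where "s = (t + c) / 2"
    have c: "t < c" "c \<le> b" "c \<le> 1" using b t by (auto simp: c_def)
    have s: "t < s" "s < c" "s \<in> {0..1}" using c t by (auto simp: s_def field_simps)
    have "skorohod_dist x y < min e ((c - t) / 2)" using 0 e c by simp
    then obtain e' where e': "e' < min e ((c - t) / 2)" "skorohod_close x y e'"
      using skorohod_dist_lessD[OF x y] by blast
    then obtain \<tau> where \<tau>: "\<bar>\<tau> s - s\<bar> \<le> e'" "dist (x s) (y (\<tau> s)) \<le> e'"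
      using s(3) unfolding skorohod_close_def by blast
    have "t < \<tau> s \<and> \<tau> s < c"
      using \<tau>(1) e'(1) by (auto simp: s_def abs_le_iff field_simps)
    then have "dist (y (\<tau> s)) (y t) < e" using b(2) c(2) by auto
    moreover have "dist (x s) (x t) < e" using b(2) s c by auto
    moreover have "dist (x t) (y t) \<le> dist (x s) (x t) + dist (x s) (y (\<tau> s)) + dist (y (\<tau> s)) (y t)"
      using dist_triangle[of "x t" "y t" "x s"] dist_triangle[of "x s" "y t" "y (\<tau> s)"]
      by (simp add: dist_commute)
    ultimately show ?thesis using \<tau>(2) e'(1) e by simp
  qed
  from this[of "dist (x t) (y t) / 8"] show ?thesis by (cases "x t = y t") auto
qed

lemma Metric_space_skorohod: "Metric_space (cadlag01 :: (real \<Rightarrow> 'b::metric_space) set) skorohod_dist"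
proof
  have nn: "0 \<le> skorohod_dist x y" for x y :: "real \<Rightarrow> 'b"
    using skorohod_close_ex[of x y]
    by (auto simp: skorohod_dist_def skorohod_close_def intro!: cInf_greatest)
  show "0 \<le> skorohod_dist x y" for x y :: "real \<Rightarrow> 'b" by (rule nn)
  show "skorohod_dist x y = skorohod_dist y x" for x y :: "real \<Rightarrow> 'b"
  proof -
    have "{e. skorohod_close x y e} = {e. skorohod_close y x e}" using skorohod_close_sym by blast
    then show ?thesis by (auto simp: skorohod_dist_def)
  qed
  show "skorohod_dist x y = 0 \<longleftrightarrow> x = y" if xy: "x \<in> cadlag01" "y \<in> cadlag01" for x y :: "real \<Rightarrow> 'b"
  proof
    assume 0: "skorohod_dist x y = 0"
    have "x 1 = y 1"
    proof (rule ccontr)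
      assume "x 1 \<noteq> y 1"
      then have "skorohod_dist x y < dist (x 1) (y 1)" using 0 by simp
      then obtain e where e: "e < dist (x 1) (y 1)" "skorohod_close x y e"
        using skorohod_dist_lessD[OF xy] by blast
      then obtain \<tau> where \<tau>: "\<tau> \<in> time_changes" "\<forall>t\<in>{0..1}. dist (x t) (y (\<tau> t)) \<le> e"
        unfolding skorohod_close_def by blast
      have "dist (x 1) (y (\<tau> 1)) \<le> e" using \<tau>(2) by simp
      then show False using e by (simp add: time_changes_one[OF \<tau>(1)])
    qed
    then have "x t = y t" if "t \<in> {0..1}" for t
      using that skorohod_dist_zero_right[OF xy 0, of t] by (cases "t = 1") auto
    moreover have "x \<in> extensional {0..1}" "y \<in> extensional {0..1}" using xy by (auto simp: cadlag01_def)
    ultimately show "x = y" by (meson extensionalityI)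
  next
    assume "x = y"
    then have "skorohod_close x y 0" using time_changes_id by (auto simp: skorohod_close_def)
    then show "skorohod_dist x y = 0" using skorohod_dist_le[OF xy] nn[of x y] by (meson order.antisym)
  qed
  show "skorohod_dist x z \<le> skorohod_dist x y + skorohod_dist y z"
    if xyz: "x \<in> cadlag01" "y \<in> cadlag01" "z \<in> cadlag01" for x y z :: "real \<Rightarrow> 'b"
  proof (rule field_le_epsilon)
    fix e :: real assume e: "e > 0"
    obtain a where a: "a < skorohod_dist x y + e / 2" "skorohod_close x y a"
      using skorohod_dist_lessD[OF xyz(1,2), of "skorohod_dist x y + e / 2"] e by auto
    obtain b where b: "b < skorohod_dist y z + e / 2" "skorohod_close y z b"
      using skorohod_dist_lessD[OF xyz(2,3), of "skorohod_dist y z + e / 2"] e by auto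
    have "skorohod_dist x z \<le> a + b"
      by (rule skorohod_dist_le[OF xyz(1,3) skorohod_close_trans[OF a(2) b(2)]])
    then show "skorohod_dist x z \<le> skorohod_dist x y + skorohod_dist y z + e" using a b by simp
  qed
qed

definition skorohod_topology :: "(real \<Rightarrow> 'b::metric_space) topology" where
  "skorohod_topology = Metric_space.mtopology cadlag01 skorohod_dist"

lemma topspace_skorohod_topology: "topspace skorohod_topology = cadlag01"
  unfolding skorohod_topology_def by (rule Metric_space.topspace_mtopology[OF Metric_space_skorohod])

definition borel_of :: "'b topology \<Rightarrow> 'b measure" where
  "borel_of T = sigma (topspace T) {V. openin T V}"

text \<open>
  Convergence in law of \<open>Y n\<close>, living on the probability space \<open>M n\<close>, to \<open>Z\<close>, living on \<open>W\<close>.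
  Being a random element of the topological space is required of the limit and of all but finitely
  many \<open>Y n\<close>; under it every integrand below is measurable and bounded.
\<close>

definition converges_weakly ::
  "'b topology \<Rightarrow> (nat \<Rightarrow> 'a measure) \<Rightarrow> (nat \<Rightarrow> 'a \<Rightarrow> 'b) \<Rightarrow> 'w measure \<Rightarrow> ('w \<Rightarrow> 'b) \<Rightarrow> bool" where
  "converges_weakly T M Y W Z \<longleftrightarrow>
     (\<forall>\<^sub>F n in sequentially. prob_space (M n) \<and> Y n \<in> M n \<rightarrow>\<^sub>M borel_of T) \<and>
     prob_space W \<and> Z \<in> W \<rightarrow>\<^sub>M borel_of T \<and>
     (\<forall>f. continuous_map T euclideanreal f \<and> bounded (f ` topspace T) \<longrightarrow>
        (\<lambda>n. \<integral>\<omega>. f (Y n \<omega>) \<partial>M n) \<longlonglongrightarrow> (\<integral>\<omega>. f (Z \<omega>) \<partial>W))"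

locale standard_brownian_motion = prob_space W for W :: "'w measure" +
  fixes B :: "real \<Rightarrow> 'w \<Rightarrow> real"
  assumes measurable_B: "\<And>t. 0 \<le> t \<Longrightarrow> random_variable borel (B t)"
    and B_zero: "\<And>\<omega>. \<omega> \<in> space W \<Longrightarrow> B 0 \<omega> = 0"
    and B_continuous: "\<And>\<omega>. \<omega> \<in> space W \<Longrightarrow> continuous_on {0..} (\<lambda>t. B t \<omega>)"
    and B_normal_increments:
      "\<And>s t. 0 \<le> s \<Longrightarrow> s < t \<Longrightarrow>
         distributed W lborel (\<lambda>\<omega>. B t \<omega> - B s \<omega>) (normal_density 0 (sqrt (t - s)))"
    and B_indep_increments:
      "\<And>(r :: nat \<Rightarrow> real) k. 0 \<le> r 0 \<Longrightarrow> strict_mono_on {..k} r \<Longrightarrow>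
         indep_vars (\<lambda>_. borel) (\<lambda>i \<omega>. B (r (Suc i)) \<omega> - B (r i) \<omega>) {..<k}"

definition independent_brownian_motions ::
  "'w measure \<Rightarrow> (real \<Rightarrow> 'w \<Rightarrow> real) \<Rightarrow> (real \<Rightarrow> 'w \<Rightarrow> real) \<Rightarrow> bool" where
  "independent_brownian_motions W B1 B2 \<longleftrightarrow>
     standard_brownian_motion W B1 \<and> standard_brownian_motion W B2 \<and>
     prob_space.indep_var W
       (PiM {0..} (\<lambda>_. borel)) (\<lambda>\<omega>. \<lambda>t\<in>{0..}. B1 t \<omega>)
       (PiM {0..} (\<lambda>_. borel)) (\<lambda>\<omega>. \<lambda>t\<in>{0..}. B2 t \<omega>)"

text \<open>
  The arms are \<open>1\<close> and \<open>2\<close>, times and pulls are counted from \<open>1\<close>: \<open>X i j\<close> is the reward of the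
  \<open>j\<close>-th pull of arm \<open>i\<close> and \<open>\<pi> t\<close> is the arm played at time \<open>t\<close>. The values of \<open>P\<close>, \<open>X\<close> and \<open>\<pi>\<close>
  at other indices are never used.
\<close>

locale two_armed_bandit = prob_space M for M :: "'a measure" +
  fixes P :: "nat \<Rightarrow> real measure" and X :: "nat \<Rightarrow> nat \<Rightarrow> 'a \<Rightarrow> real"
  assumes P_prob_space: "\<And>i. i \<in> {1, 2} \<Longrightarrow> prob_space (P i)"
    and P_sets: "\<And>i. i \<in> {1, 2} \<Longrightarrow> sets (P i) = sets borel"
    and P_support: "\<And>i. i \<in> {1, 2} \<Longrightarrow> AE x in P i. x \<in> {0..1}"
    and X_distr: "\<And>i j. i \<in> {1, 2} \<Longrightarrow> 1 \<le> j \<Longrightarrow> distr M borel (X i j) = P i"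
    and X_indep: "indep_vars (\<lambda>_. borel) (\<lambda>(i, j). X i j) ({1, 2} \<times> {1..})"

definition arm_mean :: "real measure \<Rightarrow> real" where
  "arm_mean Q = (\<integral>x. x \<partial>Q)"

definition arm_variance :: "real measure \<Rightarrow> real" where
  "arm_variance Q = (\<integral>x. (x - arm_mean Q)\<^sup>2 \<partial>Q)"

definition pulls :: "(nat \<Rightarrow> 'a \<Rightarrow> nat) \<Rightarrow> nat \<Rightarrow> nat \<Rightarrow> 'a \<Rightarrow> nat" where
  "pulls \<pi> i m \<omega> = card {s \<in> {1..m}. \<pi> s \<omega> = i}"

definition observed_reward ::
  "(nat \<Rightarrow> nat \<Rightarrow> 'a \<Rightarrow> real) \<Rightarrow> (nat \<Rightarrow> 'a \<Rightarrow> nat) \<Rightarrow> nat \<Rightarrow> 'a \<Rightarrow> real" where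
  "observed_reward X \<pi> s \<omega> = X (\<pi> s \<omega>) (pulls \<pi> (\<pi> s \<omega>) s \<omega>) \<omega>"

definition cumulative_reward ::
  "(nat \<Rightarrow> nat \<Rightarrow> 'a \<Rightarrow> real) \<Rightarrow> (nat \<Rightarrow> 'a \<Rightarrow> nat) \<Rightarrow> nat \<Rightarrow> nat \<Rightarrow> 'a \<Rightarrow> real" where
  "cumulative_reward X \<pi> i m \<omega> = (\<Sum>j=1..pulls \<pi> i m \<omega>. X i j \<omega>)"

definition centered_reward ::
  "real \<Rightarrow> (nat \<Rightarrow> nat \<Rightarrow> 'a \<Rightarrow> real) \<Rightarrow> (nat \<Rightarrow> 'a \<Rightarrow> nat) \<Rightarrow> nat \<Rightarrow> nat \<Rightarrow> 'a \<Rightarrow> real" where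
  "centered_reward \<mu> X \<pi> i m \<omega> = cumulative_reward X \<pi> i m \<omega> - \<mu> * real (pulls \<pi> i m \<omega>)"

definition stochastic_regret ::
  "(nat \<Rightarrow> real measure) \<Rightarrow> (nat \<Rightarrow> nat \<Rightarrow> 'a \<Rightarrow> real) \<Rightarrow> (nat \<Rightarrow> 'a \<Rightarrow> nat) \<Rightarrow> nat \<Rightarrow> 'a \<Rightarrow> real" where
  "stochastic_regret P X \<pi> m \<omega> =
     (\<Sum>s=1..m. max (arm_mean (P 1)) (arm_mean (P 2)) - observed_reward X \<pi> s \<omega>)"

definition ucb_index ::
  "real \<Rightarrow> (nat \<Rightarrow> nat \<Rightarrow> 'a \<Rightarrow> real) \<Rightarrow> (nat \<Rightarrow> 'a \<Rightarrow> nat) \<Rightarrow> nat \<Rightarrow> nat \<Rightarrow> 'a \<Rightarrow> real" where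
  "ucb_index \<rho> X \<pi> t i \<omega> =
     cumulative_reward X \<pi> i (t - 1) \<omega> / real (pulls \<pi> i (t - 1) \<omega>)
     + sqrt (\<rho> * ln (real (t - 1)) / real (pulls \<pi> i (t - 1) \<omega>))"

text \<open>
  The random seed \<open>U\<close>, with values in an arbitrary measurable space \<open>S\<close>, carries all the external
  randomization. Each decision is a measurable function of this seed and of the arms played and
  rewards observed before. As the index is itself a function of these data, this
  restricts nothing but the tie-breaking (and the order of the first two plays).
\<close>

locale canonical_ucb = two_armed_bandit M P X
  for M :: "'a measure" and P :: "nat \<Rightarrow> real measure" and X :: "nat \<Rightarrow> nat \<Rightarrow> 'a \<Rightarrow> real" +
  fixes \<rho> :: real and S :: "'u measure" and U :: "'a \<Rightarrow> 'u" and \<pi> :: "nat \<Rightarrow> 'a \<Rightarrow> nat"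
  assumes seed_measurable: "random_variable S U"
    and seed_indep:
      "indep_set (sets (vimage_algebra (space M) U S))
         (sets (vimage_algebra (space M) (\<lambda>\<omega>. \<lambda>(i, j)\<in>{1, 2} \<times> {1..}. X i j \<omega>)
            (PiM ({1, 2} \<times> {1..}) (\<lambda>_. borel))))"
    and initial_plays: "\<And>\<omega>. \<omega> \<in> space M \<Longrightarrow> {\<pi> 1 \<omega>, \<pi> 2 \<omega>} = {1, 2}"
    and ucb_plays:
      "\<And>t \<omega>. 3 \<le> t \<Longrightarrow> \<omega> \<in> space M \<Longrightarrow>
         is_arg_max (\<lambda>i. ucb_index \<rho> X \<pi> t i \<omega>) (\<lambda>i. i \<in> {1, 2}) (\<pi> t \<omega>)"
    and non_anticipating:
      "\<And>t. 1 \<le> t \<Longrightarrow>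
         \<exists>g \<in> S \<Otimes>\<^sub>M PiM {1..<t} (\<lambda>_. count_space {1, 2} \<Otimes>\<^sub>M borel) \<rightarrow>\<^sub>M count_space {1, 2}.
           \<forall>\<omega>\<in>space M. \<pi> t \<omega> = g (U \<omega>, \<lambda>s\<in>{1..<t}. (\<pi> s \<omega>, observed_reward X \<pi> s \<omega>))"

end

theory Submission
  imports Defs
begin

text \<open>
  The proof is pathwise in the policy. Write \<open>T\<close> for the centred partial sums of one arm. By a peeling
  argument \<open>max\<^sub>s\<^sub>\<le>\<^sub>n \<bar>T s\<bar> / sqrt s\<close> is of smaller order than \<open>sqrt (ln n)\<close>, whereas an arm that has been
  pulled noticeably more often than the other one pays an index penalty of order \<open>sqrt (ln n / N)\<close>. Since
  the gap of the means is only of order \<open>1 / sqrt n\<close>, both arms are pulled \<open>m / 2 + o(n)\<close> times up to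
  time \<open>m\<close>, uniformly in \<open>m \<le> n\<close>. The modulus of continuity of \<open>T\<close> then allows the random times
  to be replaced by deterministic ones, so that the rewards are close to step paths on a coarse grid built from
  independent block sums, to which the central limit theorem applies. The regret is a Lipschitz image of the
  pair of rewards, up to an error of order \<open>1 / n\<close>.
\<close>

section \<open>Paths\<close>

text \<open>The obstacle is that the pull counts depend on the very rewards being summed, so
  \<open>centered_reward\<close> has a dependent random number of terms and no limit theorem applies
  to it directly. The joint law of counts and rewards is never studied: once the counts are nearly
  deterministic on an event of high probability, each arm simply runs at half speed, whence
  \<open>\<theta> * t / 2\<close> and \<open>\<sigma> / sqrt 2\<close>. The scale
  \<open>sqrt (ln n)\<close> is decisive. Normalised fluctuations stay below
  \<open>\<kappa> * sqrt (ln n)\<close> for every fixed \<open>\<kappa> > 0\<close>, because a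
  negative power of \<open>n\<close> from Hoeffding's inequality beats the logarithmic number of
  dyadic scales; the exploration bonus is a fixed multiple of \<open>sqrt (ln n)\<close> and wins if
  \<open>\<kappa>\<close> is small. In place of tightness plus finite-dimensional convergence,
  bounded Lipschitz test functions are used with an iterated limit: \<open>n\<close> grows for a
  fixed grid of mesh \<open>1 / k\<close>, then \<open>k\<close> grows. The reward laws vary with
  the horizon and the variance may be 0, so the central limit theorem is run through characteristic
  functions with an explicit error.\<close>

lemma skorohod_dist_le_sup:
  assumes "x \<in> cadlag01" "y \<in> cadlag01" "0 \<le> e"
    and "\<And>t. t \<in> {0..1} \<Longrightarrow> dist (x t) (y t) \<le> e"
  shows "skorohod_dist x y \<le> e"
  using assms time_changes_id
  by (intro skorohod_dist_le) (auto simp: skorohod_close_def intro!: bexI[of _ "\<lambda>t. t"])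

text \<open>Common form of the processes of the theorem and of their coarse approximants. The
  bounded abstraction makes the path extensional, as \<open>cadlag01\<close> demands; for
  \<open>n > 0\<close> the index \<open>n\<close> is read at time 1 only.\<close>

definition step_path :: "nat \<Rightarrow> (nat \<Rightarrow> 'b) \<Rightarrow> real \<Rightarrow> 'b" where
  "step_path n v = (\<lambda>t\<in>{0..1}. v (nat \<lfloor>real n * t\<rfloor>))"

lemma step_index_le: "t \<in> {0..1} \<Longrightarrow> nat \<lfloor>real n * t\<rfloor> \<le> n"
proof -
  assume "t \<in> {0..1}"
  then have "real n * t \<le> real n" by (simp add: mult_left_le)
  then show ?thesis by linarith
qed

lemma step_path_cadlag: "step_path n (v :: nat \<Rightarrow> 'b::metric_space) \<in> cadlag01"
proof (cases "n = 0")
  case True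
  have "(step_path n v \<longlongrightarrow> v 0) (at_right t)" if "t \<in> {0..<1}" for t
  proof (rule tendsto_eventually)
    show "eventually (\<lambda>s. step_path n v s = v 0) (at_right t)"
      using that True by (auto simp: eventually_at_right_field step_path_def intro!: exI[of _ 1])
  qed
  moreover have "(step_path n v \<longlongrightarrow> v 0) (at_left t)" if "t \<in> {0<..1}" for t
  proof (rule tendsto_eventually)
    show "eventually (\<lambda>s. step_path n v s = v 0) (at_left t)"
      using that True by (auto simp: eventually_at_left_field step_path_def intro!: exI[of _ 0])
  qed
  ultimately show ?thesis using True by (fastforce simp: cadlag01_def step_path_def)
next
  case False
  then have n: "real n > 0" by simp
  have "(step_path n v \<longlongrightarrow> step_path n v t) (at_right t)" if t: "t \<in> {0..<1}" for t
  proof (rule tendsto_eventually)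
    \<comment> \<open>The first jump time after \<open>t\<close>, capped at 1; the path is constant
      up to it.\<close>
    define b where "b = min 1 ((of_int \<lfloor>real n * t\<rfloor> + 1) / real n)"
    have "t < b" using t n by (auto simp: b_def field_simps) linarith
    moreover have "step_path n v s = step_path n v t" if s: "t < s" "s < b" for s
    proof -
      have "real n * t \<le> real n * s" using s n by simp
      moreover have "real n * s < of_int \<lfloor>real n * t\<rfloor> + 1" using s n by (simp add: b_def field_simps)
      ultimately have "\<lfloor>real n * s\<rfloor> = \<lfloor>real n * t\<rfloor>" by linarith
      then show ?thesis using s t by (simp add: step_path_def b_def)
    qed
    ultimately show "eventually (\<lambda>s. step_path n v s = step_path n v t) (at_right t)"
      by (auto simp: eventually_at_right_field)
  qed
  moreover have "\<exists>l. (step_path n v \<longlongrightarrow> l) (at_left t)" if t: "t \<in> {0<..1}" for t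
  proof (intro exI tendsto_eventually)
    \<comment> \<open>The last grid point strictly before \<open>t\<close>. Ceiling minus 1, not the
      floor, because at a jump time the left limit is the previous value.\<close>
    define b where "b = max 0 ((of_int \<lceil>real n * t\<rceil> - 1) / real n)"
    have "b < t" using t n by (auto simp: b_def field_simps) linarith
    moreover have "step_path n v s = v (nat (\<lceil>real n * t\<rceil> - 1))" if s: "b < s" "s < t" for s
    proof -
      have "real n * s < real n * t" using s n by simp
      moreover have "of_int \<lceil>real n * t\<rceil> - 1 < real n * s" using s n by (simp add: b_def field_simps)
      ultimately have "\<lfloor>real n * s\<rfloor> = \<lceil>real n * t\<rceil> - 1" by linarith
      then show ?thesis using s t by (simp add: step_path_def b_def)
    qed
    ultimately show "eventually (\<lambda>s. step_path n v s = v (nat (\<lceil>real n * t\<rceil> - 1))) (at_left t)"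
      by (auto simp: eventually_at_left_field)
  qed
  ultimately show ?thesis by (auto simp: cadlag01_def step_path_def)
qed

lemma continuous_path_cadlag:
  assumes "continuous_on {0..1} x" shows "restrict x {0..1::real} \<in> cadlag01"
proof -
  have lim: "(restrict x {0..1} \<longlongrightarrow> x t) (at t within {0..1})" if "t \<in> {0..1}" for t
  proof -
    have "(x \<longlongrightarrow> x t) (at t within {0..1})" using assms that by (simp add: continuous_on)
    moreover have "eventually (\<lambda>s. x s = restrict x {0..1} s) (at t within {0..1})"
      by (auto simp: eventually_at_filter)
    ultimately show ?thesis by (rule Lim_transform_eventually)
  qed
  have "(restrict x {0..1} \<longlongrightarrow> restrict x {0..1} t) (at_right t)" if "t \<in> {0..<1}" for t
  proof -
    have "at_right t = at t within {t<..1}" using that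
      by (intro at_within_nhd[of _ "{..<1}"]) auto
    also have "\<dots> \<le> at t within {0..1}" by (rule at_le) (use that in auto)
    finally show ?thesis using lim[of t] that by (auto intro: tendsto_mono)
  qed
  moreover have "(restrict x {0..1} \<longlongrightarrow> restrict x {0..1} t) (at_left t)" if "t \<in> {0<..1}" for t
  proof -
    have "at_left t = at t within {0..<t}" using that
      by (intro at_within_nhd[of _ "{0<..}"]) auto
    also have "\<dots> \<le> at t within {0..1}" by (rule at_le) (use that in auto)
    finally show ?thesis using lim[of t] that by (auto intro: tendsto_mono)
  qed
  ultimately show ?thesis unfolding cadlag01_def by blast
qed

section \<open>Borel sets of a topology and measurability of path-valued maps\<close>

lemma measurable_borel_ofI:
  assumes "\<And>\<omega>. \<omega> \<in> space M \<Longrightarrow> f \<omega> \<in> topspace T"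
    and "\<And>V. openin T V \<Longrightarrow> f -` V \<inter> space M \<in> sets M"
  shows "f \<in> M \<rightarrow>\<^sub>M borel_of T"
  unfolding borel_of_def using assms
  by (intro measurable_measure_of) (auto simp: openin_subset dest: openin_subset)

lemma space_borel_of: "space (borel_of T) = topspace T"
  unfolding borel_of_def by (rule space_measure_of) (auto dest: openin_subset)

lemma openin_sets_borel_of: "openin T V \<Longrightarrow> V \<in> sets (borel_of T)"
  unfolding borel_of_def by (subst sets_measure_of) (auto dest: openin_subset)

lemma continuous_map_measurable:
  assumes "continuous_map T T' f" shows "f \<in> borel_of T \<rightarrow>\<^sub>M borel_of T'"
proof (rule measurable_borel_ofI)
  show "f \<omega> \<in> topspace T'" if "\<omega> \<in> space (borel_of T)" for \<omega>
    using that assms by (auto simp: space_borel_of continuous_map_def)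
  show "f -` V \<inter> space (borel_of T) \<in> sets (borel_of T)" if "openin T' V" for V
  proof -
    have "f -` V \<inter> space (borel_of T) = {x \<in> topspace T. f x \<in> V}" by (auto simp: space_borel_of)
    then show ?thesis using openin_continuous_map_preimage[OF assms that] openin_sets_borel_of by metis
  qed
qed

lemma continuous_map_borel_measurable:
  fixes f :: "'b \<Rightarrow> 'c::topological_space"
  assumes "continuous_map T euclidean f" shows "f \<in> borel_measurable (borel_of T)"
proof (rule borel_measurableI)
  fix V :: "'c set" assume "open V"
  then have "openin T {x \<in> topspace T. f x \<in> V}"
    using openin_continuous_map_preimage[OF assms] by simp
  moreover have "f -` V \<inter> space (borel_of T) = {x \<in> topspace T. f x \<in> V}" by (auto simp: space_borel_of)
  ultimately show "f -` V \<inter> space (borel_of T) \<in> sets (borel_of T)" using openin_sets_borel_of by metis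
qed

text \<open>The path depends continuously on the sequence of its values, for the product topology on
  sequences and the Skorohod topology on paths. So the value sequences whose path falls into an open
  set form an open set, and coordinatewise measurability carries over.\<close>

lemma step_path_measurable:
  fixes v :: "nat \<Rightarrow> 'a \<Rightarrow> 'b::{second_countable_topology, metric_space}"
  assumes "\<And>j. j \<le> n \<Longrightarrow> v j \<in> borel_measurable M"
  shows "(\<lambda>\<omega>. step_path n (\<lambda>j. v j \<omega>)) \<in> M \<rightarrow>\<^sub>M borel_of skorohod_topology"
proof (rule measurable_borel_ofI)
  interpret Metric_space cadlag01 "skorohod_dist :: (real \<Rightarrow> 'b) \<Rightarrow> _" by (rule Metric_space_skorohod)
  show "step_path n (\<lambda>j. v j \<omega>) \<in> topspace skorohod_topology" for \<omega>
    by (simp add: topspace_skorohod_topology step_path_cadlag)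
  fix V :: "(real \<Rightarrow> 'b) set" assume V: "openin skorohod_topology V"
  \<comment> \<open>Nothing is known about \<open>v j\<close> for \<open>j > n\<close>; a constant
    takes its place, which leaves the path unchanged.\<close>
  define w where "w j = (if j \<le> n then v j else (\<lambda>_. undefined))" for j
  have eq: "step_path n (\<lambda>j. v j \<omega>) = step_path n (\<lambda>j. w j \<omega>)" for \<omega>
    by (auto simp: step_path_def w_def fun_eq_iff step_index_le)
  have w: "(\<lambda>\<omega> j. w j \<omega>) \<in> borel_measurable M"
    by (rule measurable_coordinatewise_then_product) (auto simp: w_def assms)
  have "open {u. step_path n u \<in> V}"
  proof (rule open_subopen[THEN iffD2], rule ballI)
    fix u assume "u \<in> {u. step_path n u \<in> V}"
    then have "step_path n u \<in> V" by simp
    then obtain r where r: "r > 0" "mball (step_path n u) r \<subseteq> V"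
      using V unfolding skorohod_topology_def openin_mtopology by blast
    \<comment> \<open>Only the finitely many coordinates up to \<open>n\<close> are constrained, so
      this is open in the product topology.\<close>
    let ?A = "\<Inter>j\<in>{..n}. {u'. dist (u' j) (u j) < r / 2}"
    have "open {u'. dist (u' j) (u j) < r / 2}" for j
      by (intro open_Collect_less continuous_intros continuous_on_product_coordinates)
    then have "open ?A" by (intro open_INT) auto
    moreover have "u \<in> ?A" using r by simp
    moreover have "?A \<subseteq> {u. step_path n u \<in> V}"
    proof
      fix u' assume u': "u' \<in> ?A"
      have "skorohod_dist (step_path n u) (step_path n u') \<le> r / 2"
      proof (rule skorohod_dist_le_sup[OF step_path_cadlag step_path_cadlag])
        show "dist (step_path n u t) (step_path n u' t) \<le> r / 2" if "t \<in> {0..1}" for t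
          using u' that step_index_le[OF that, of n] by (auto simp: step_path_def dist_commute less_imp_le)
      qed (use r in simp)
      then have "step_path n u' \<in> mball (step_path n u) r" using r step_path_cadlag by auto
      then show "u' \<in> {u. step_path n u \<in> V}" using r by auto
    qed
    ultimately show "\<exists>T. open T \<and> u \<in> T \<and> T \<subseteq> {u. step_path n u \<in> V}" by blast
  qed
  then have "(\<lambda>\<omega> j. w j \<omega>) -` {u. step_path n u \<in> V} \<inter> space M \<in> sets M"
    using w by (intro measurable_sets[OF w]) auto
  then show "(\<lambda>\<omega>. step_path n (\<lambda>j. v j \<omega>)) -` V \<inter> space M \<in> sets M"
    by (simp add: vimage_def eq)
qed

section \<open>Weak convergence in metric spaces\<close>

context Metric_space
begin

lemma Lipschitz_imp_continuous_map:
  assumes "\<And>x y. x \<in> M \<Longrightarrow> y \<in> M \<Longrightarrow> \<bar>f x - f y\<bar> \<le> L * d x y"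
  shows "continuous_map mtopology euclideanreal f"
proof -
  have "\<exists>\<delta>>0. \<forall>x'. x' \<in> M \<and> d x x' < \<delta> \<longrightarrow> dist (f x) (f x') < e" if "x \<in> M" "e > 0" for x e
  proof (intro exI[of _ "e / (\<bar>L\<bar> + 1)"] conjI allI impI)
    fix x' assume x': "x' \<in> M \<and> d x x' < e / (\<bar>L\<bar> + 1)"
    have "\<bar>f x - f x'\<bar> \<le> L * d x x'" using assms that x' by blast
    also have "\<dots> \<le> (\<bar>L\<bar> + 1) * d x x'" by (intro mult_right_mono) auto
    also have "\<dots> < e" using x' by (simp add: field_simps)
    finally show "dist (f x) (f x') < e" by (simp add: dist_real_def)
  qed (use that in simp)
  then show ?thesis
    using metric_continuous_map[OF Met_TC.Metric_space_axioms, of f]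
    by (simp add: mtopology_is_euclidean)
qed

text \<open>Membership of the limit in an open set is rewritten as a countable combination of
  conditions on the approximants, which are measurable.\<close>

lemma measurable_limit:
  assumes Zk: "\<And>k. Zk k \<in> W \<rightarrow>\<^sub>M borel_of mtopology"
    and Z: "\<And>\<omega>. \<omega> \<in> space W \<Longrightarrow> Z \<omega> \<in> M"
    and lim: "\<And>\<omega>. \<omega> \<in> space W \<Longrightarrow> (\<lambda>k. d (Zk k \<omega>) (Z \<omega>)) \<longlonglongrightarrow> 0"
  shows "Z \<in> W \<rightarrow>\<^sub>M borel_of mtopology"
proof (rule measurable_borel_ofI)
  show "Z \<omega> \<in> topspace mtopology" if "\<omega> \<in> space W" for \<omega> using Z that by simp
  have ZkM: "Zk k \<omega> \<in> M" if "\<omega> \<in> space W" for k \<omega>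
    using measurable_space[OF Zk that] by (simp add: space_borel_of)
  fix V assume V: "openin mtopology V"
  \<comment> \<open>Balls whose double still fits into \<open>V\<close>: the spare radius pays for
    the distance from \<open>Zk k\<close> to its limit, so that the limit does not leave
    \<open>V\<close>.\<close>
  define I where "I m = \<Union>{mball x (1 / real (Suc m)) |x. x \<in> M \<and> mball x (2 / real (Suc m)) \<subseteq> V}" for m
  have I: "I m \<in> sets (borel_of mtopology)" for m
    by (rule openin_sets_borel_of) (auto simp: I_def intro!: openin_Union)
  have iff: "Z \<omega> \<in> V \<longleftrightarrow> (\<exists>m k0. \<forall>k\<ge>k0. Zk k \<omega> \<in> I m)" if \<omega>: "\<omega> \<in> space W" for \<omega>
  proof
    assume "Z \<omega> \<in> V"
    then obtain r where r: "r > 0" "mball (Z \<omega>) r \<subseteq> V" using V unfolding openin_mtopology by blast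
    obtain m where m: "2 / real (Suc m) < r"
      using reals_Archimedean[of "r / 2"] r(1) by (auto simp: field_simps)
    have "eventually (\<lambda>k. d (Zk k \<omega>) (Z \<omega>) < 1 / real (Suc m)) sequentially"
      using lim[OF \<omega>] by (rule order_tendstoD) simp
    then obtain k0 where k0: "\<And>k. k \<ge> k0 \<Longrightarrow> d (Zk k \<omega>) (Z \<omega>) < 1 / real (Suc m)"
      by (auto simp: eventually_sequentially)
    have "mball (Z \<omega>) (2 / real (Suc m)) \<subseteq> V"
      using r m mball_subset_concentric[of "2 / real (Suc m)" r "Z \<omega>"] by auto
    moreover have "Zk k \<omega> \<in> mball (Z \<omega>) (1 / real (Suc m))" if "k \<ge> k0" for k
      using k0[OF that] Z[OF \<omega>] ZkM[OF \<omega>] by (simp add: commute)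
    ultimately have "\<forall>k\<ge>k0. Zk k \<omega> \<in> I m" using Z[OF \<omega>] unfolding I_def by blast
    then show "\<exists>m k0. \<forall>k\<ge>k0. Zk k \<omega> \<in> I m" by blast
  next
    assume "\<exists>m k0. \<forall>k\<ge>k0. Zk k \<omega> \<in> I m"
    then obtain m k0 where mk: "\<And>k. k \<ge> k0 \<Longrightarrow> Zk k \<omega> \<in> I m" by blast
    have "eventually (\<lambda>k. d (Zk k \<omega>) (Z \<omega>) < 1 / real (Suc m)) sequentially"
      using lim[OF \<omega>] by (rule order_tendstoD) simp
    then obtain k where k: "k \<ge> k0" "d (Zk k \<omega>) (Z \<omega>) < 1 / real (Suc m)"
      by (auto simp: eventually_sequentially) (metis nle_le)
    then obtain x where x: "x \<in> M" "mball x (2 / real (Suc m)) \<subseteq> V" "d x (Zk k \<omega>) < 1 / real (Suc m)"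
      using mk[OF k(1)] unfolding I_def by auto
    have "d x (Z \<omega>) \<le> d x (Zk k \<omega>) + d (Zk k \<omega>) (Z \<omega>)"
      using x Z[OF \<omega>] ZkM[OF \<omega>] by (intro triangle) auto
    also have "\<dots> < 1 / real (Suc m) + 1 / real (Suc m)" using x k by (intro add_strict_mono)
    also have "\<dots> = 2 / real (Suc m)" by simp
    finally have "Z \<omega> \<in> mball x (2 / real (Suc m))" using x Z[OF \<omega>] by simp
    then show "Z \<omega> \<in> V" using x by blast
  qed
  have [measurable]: "Zk k -` I m \<inter> space W \<in> sets W" for k m
    by (rule measurable_sets[OF Zk I])
  have "Z -` V \<inter> space W = (\<Union>m. \<Union>k0. \<Inter>k\<in>{k0..}. Zk k -` I m \<inter> space W)"
    using iff by fastforce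
  also have "\<dots> \<in> sets W" by measurable
  finally show "Z -` V \<inter> space W \<in> sets W" .
qed

text \<open>The envelopes \<open>g k\<close> increase to the continuous function \<open>f\<close>, which makes \<open>\<integral>f(Y n)\<close>
  asymptotically at least \<open>\<integral>f(Z)\<close>; applied to \<open>-f\<close> as well, this gives convergence.\<close>

lemma Lipschitz_envelope:
  fixes f :: "'a \<Rightarrow> real"
  assumes f: "continuous_map mtopology euclideanreal f" and B: "\<And>x. x \<in> M \<Longrightarrow> \<bar>f x\<bar> \<le> B"
  defines "g k x \<equiv> (INF y\<in>M. f y + real k * d x y)"
  shows "x \<in> M \<Longrightarrow> g k x \<le> f x"
    and "x \<in> M \<Longrightarrow> \<bar>g k x\<bar> \<le> B"
    and "x \<in> M \<Longrightarrow> y \<in> M \<Longrightarrow> \<bar>g k x - g k y\<bar> \<le> real k * d x y"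
    and "x \<in> M \<Longrightarrow> (\<lambda>k. g k x) \<longlonglongrightarrow> f x"
proof -
  have lower: "- B \<le> f y + real k * d x y" if "y \<in> M" for k x y
    using B[OF that] by (smt (verit) mult_nonneg_nonneg nonneg of_nat_0_le_iff)
  then have bdd: "bdd_below ((\<lambda>y. f y + real k * d x y) ` M)" for k x
    by (intro bdd_belowI2[of _ "-B"])
  have le: "g k x \<le> f x" if "x \<in> M" for k x
    unfolding g_def using that by (intro cINF_lower2[OF bdd that]) simp
  have ge: "- B \<le> g k x" if "x \<in> M" for k x
    unfolding g_def using that lower by (intro cINF_greatest) auto
  show "x \<in> M \<Longrightarrow> g k x \<le> f x" by (rule le)
  show "x \<in> M \<Longrightarrow> \<bar>g k x\<bar> \<le> B" using le[of x k] ge[of x k] B[of x] by linarith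
  have lip: "g k x \<le> g k y + real k * d x y" if "x \<in> M" "y \<in> M" for k x y
  proof -
    have "g k x - real k * d x y \<le> f z + real k * d y z" if z: "z \<in> M" for z
    proof -
      have "g k x \<le> f z + real k * d x z" unfolding g_def by (rule cINF_lower[OF bdd z])
      moreover have "real k * d x z \<le> real k * (d x y + d y z)"
        using \<open>x \<in> M\<close> \<open>y \<in> M\<close> z by (intro mult_left_mono triangle) auto
      ultimately show ?thesis by (simp add: distrib_left)
    qed
    then have "g k x - real k * d x y \<le> g k y"
      unfolding g_def[of k y] using that by (intro cINF_greatest) auto
    then show ?thesis by simp
  qed
  show "x \<in> M \<Longrightarrow> y \<in> M \<Longrightarrow> \<bar>g k x - g k y\<bar> \<le> real k * d x y"
    using lip[of x y k] lip[of y x k] commute[of x y] by auto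
  show "(\<lambda>k. g k x) \<longlonglongrightarrow> f x" if x: "x \<in> M"
  proof (rule LIMSEQ_I)
    fix e :: real assume e: "e > 0"
    have "\<exists>\<delta>>0. \<forall>y. y \<in> M \<and> d x y < \<delta> \<longrightarrow> dist (f x) (f y) < e / 2"
      using f x half_gt_zero[OF e] metric_continuous_map[OF Met_TC.Metric_space_axioms, of f]
      unfolding mtopology_is_euclidean by blast
    then obtain \<delta> where \<delta>: "\<delta> > 0" "\<And>y. y \<in> M \<Longrightarrow> d x y < \<delta> \<Longrightarrow> \<bar>f x - f y\<bar> < e / 2"
      by (auto simp: dist_real_def)
    obtain k0 :: nat where k0: "2 * B < real k0 * \<delta>" using reals_Archimedean3[OF \<delta>(1)] by blast
    have "norm (g k x - f x) < e" if k: "k \<ge> k0" for k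
    proof -
      have "f x - e / 2 \<le> f y + real k * d x y" if y: "y \<in> M" for y
      proof (cases "d x y < \<delta>")
        case True
        have "0 \<le> real k * d x y" by simp
        then show ?thesis using \<delta>(2)[OF y True] by linarith
      next
        case False
        have "real k0 * \<delta> \<le> real k * d x y" using False k \<delta>(1) by (intro mult_mono) auto
        then show ?thesis using k0 B[OF x] B[OF y] e by linarith
      qed
      then have "f x - e / 2 \<le> g k x" unfolding g_def using x by (intro cINF_greatest) auto
      then show ?thesis using le[OF x, of k] e by simp
    qed
    then show "\<exists>k0. \<forall>k\<ge>k0. norm (g k x - f x) < e" by blast
  qed
qed

lemma integrable_continuous_map:
  fixes f :: "'a \<Rightarrow> real"
  assumes "prob_space N" "Y \<in> N \<rightarrow>\<^sub>M borel_of mtopology"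
    and "continuous_map mtopology euclideanreal f" "\<And>x. x \<in> M \<Longrightarrow> \<bar>f x\<bar> \<le> B"
  shows "integrable N (\<lambda>\<omega>. f (Y \<omega>))"
proof -
  interpret prob_space N by fact
  have "(\<lambda>\<omega>. f (Y \<omega>)) \<in> borel_measurable N"
    by (rule measurable_compose[OF assms(2) continuous_map_borel_measurable[OF assms(3)]])
  moreover have "Y \<omega> \<in> M" if "\<omega> \<in> space N" for \<omega>
    using measurable_space[OF assms(2) that] by (simp add: space_borel_of)
  ultimately show ?thesis using assms(4) by (intro integrable_const_bound[of _ B]) auto
qed

text \<open>A continuous function has in general no modulus of continuity uniform over path space,
  whereas a Lipschitz one lets a path be replaced by a close one at a controlled cost. Only the
  lower bound \<open>lower\<close> has to be proved; the upper bound is the same statement for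
  \<open>- f\<close>.\<close>

lemma converges_weakly_Lipschitz:
  assumes Y: "\<forall>\<^sub>F n in sequentially. prob_space (N n) \<and> Y n \<in> N n \<rightarrow>\<^sub>M borel_of mtopology"
    and W: "prob_space W" and Z: "Z \<in> W \<rightarrow>\<^sub>M borel_of mtopology"
    and conv: "\<And>f B L. (\<And>x. x \<in> M \<Longrightarrow> \<bar>f x\<bar> \<le> B) \<Longrightarrow>
      (\<And>x y. x \<in> M \<Longrightarrow> y \<in> M \<Longrightarrow> \<bar>f x - f y\<bar> \<le> L * d x y) \<Longrightarrow>
      (\<lambda>n. \<integral>\<omega>. f (Y n \<omega>) \<partial>N n) \<longlonglongrightarrow> (\<integral>\<omega>. f (Z \<omega>) \<partial>W)"
  shows "converges_weakly mtopology N Y W Z"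
proof -
  interpret W: prob_space W by fact
  have ZM: "Z \<omega> \<in> M" if "\<omega> \<in> space W" for \<omega>
    using measurable_space[OF Z that] by (simp add: space_borel_of)
  have lower: "eventually (\<lambda>n. (\<integral>\<omega>. f (Z \<omega>) \<partial>W) - e < (\<integral>\<omega>. f (Y n \<omega>) \<partial>N n)) sequentially"
    if f: "continuous_map mtopology euclideanreal f" and B: "\<And>x. x \<in> M \<Longrightarrow> \<bar>f x\<bar> \<le> B" and e: "e > 0"
    for f B e
  proof -
    define g where "g k x = (INF y\<in>M. f y + real k * d x y)" for k :: nat and x
    note g = Lipschitz_envelope[OF f B, folded g_def]
    have gc: "continuous_map mtopology euclideanreal (g k)" for k
      by (rule Lipschitz_imp_continuous_map[OF g(3)])
    have int: "integrable Q (\<lambda>\<omega>. g k (V \<omega>))" if "prob_space Q" "V \<in> Q \<rightarrow>\<^sub>M borel_of mtopology"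
      for k and Q :: "'z measure" and V
      by (rule integrable_continuous_map[OF that gc g(2)])
    have "(\<lambda>k. \<integral>\<omega>. g k (Z \<omega>) \<partial>W) \<longlonglongrightarrow> (\<integral>\<omega>. f (Z \<omega>) \<partial>W)"
    proof (rule integral_dominated_convergence[where w="\<lambda>_. B"])
      show "AE \<omega> in W. (\<lambda>k. g k (Z \<omega>)) \<longlonglongrightarrow> f (Z \<omega>)" using g(4) ZM by auto
      show "AE \<omega> in W. norm (g k (Z \<omega>)) \<le> B" for k using g(2) ZM by auto
      show "(\<lambda>\<omega>. f (Z \<omega>)) \<in> borel_measurable W"
        by (rule measurable_compose[OF Z continuous_map_borel_measurable[OF f]])
      show "(\<lambda>\<omega>. g k (Z \<omega>)) \<in> borel_measurable W" for k
        by (rule measurable_compose[OF Z continuous_map_borel_measurable[OF gc]])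
    qed simp
    then have "eventually (\<lambda>k. (\<integral>\<omega>. f (Z \<omega>) \<partial>W) - e / 2 < (\<integral>\<omega>. g k (Z \<omega>) \<partial>W)) sequentially"
      by (rule order_tendstoD) (use e in simp)
    then obtain k where k: "(\<integral>\<omega>. f (Z \<omega>) \<partial>W) - e / 2 < (\<integral>\<omega>. g k (Z \<omega>) \<partial>W)"
      by (auto simp: eventually_sequentially)
    have "(\<lambda>n. \<integral>\<omega>. g k (Y n \<omega>) \<partial>N n) \<longlonglongrightarrow> (\<integral>\<omega>. g k (Z \<omega>) \<partial>W)" by (rule conv[OF g(2,3)])
    then have "eventually (\<lambda>n. (\<integral>\<omega>. f (Z \<omega>) \<partial>W) - e < (\<integral>\<omega>. g k (Y n \<omega>) \<partial>N n)) sequentially"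
      by (rule order_tendstoD) (use k e in linarith)
    with Y show ?thesis
    proof eventually_elim
      case (elim n)
      then have YM: "Y n \<omega> \<in> M" if "\<omega> \<in> space (N n)" for \<omega>
        using that measurable_space[of "Y n" "N n" "borel_of mtopology" \<omega>] by (simp add: space_borel_of)
      have "(\<integral>\<omega>. g k (Y n \<omega>) \<partial>N n) \<le> (\<integral>\<omega>. f (Y n \<omega>) \<partial>N n)"
        using elim YM g(1)
        by (intro integral_mono int integrable_continuous_map[OF _ _ f B]) auto
      then show ?case using elim by linarith
    qed
  qed
  have "(\<lambda>n. \<integral>\<omega>. f (Y n \<omega>) \<partial>N n) \<longlonglongrightarrow> (\<integral>\<omega>. f (Z \<omega>) \<partial>W)"
    if f: "continuous_map mtopology euclideanreal f" and bd: "bounded (f ` topspace mtopology)" for f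
  proof -
    obtain B where B: "\<And>x. x \<in> M \<Longrightarrow> \<bar>f x\<bar> \<le> B"
      using bd by (auto simp: bounded_iff)
    have f': "continuous_map mtopology euclideanreal (\<lambda>x. - f x)"
      using f by (rule continuous_map_minus)
    show ?thesis
    proof (rule order_tendstoI)
      fix a assume a: "a < (\<integral>\<omega>. f (Z \<omega>) \<partial>W)"
      show "eventually (\<lambda>n. a < (\<integral>\<omega>. f (Y n \<omega>) \<partial>N n)) sequentially"
        using lower[OF f B, of "(\<integral>\<omega>. f (Z \<omega>) \<partial>W) - a"] a by simp
    next
      fix a assume a: "(\<integral>\<omega>. f (Z \<omega>) \<partial>W) < a"
      show "eventually (\<lambda>n. (\<integral>\<omega>. f (Y n \<omega>) \<partial>N n) < a) sequentially"
        using lower[OF f', of B "a - (\<integral>\<omega>. f (Z \<omega>) \<partial>W)"] a B by simp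
    qed
  qed
  then show ?thesis using Y W Z unfolding converges_weakly_def by blast
qed

text \<open>Interchange of limits: for fixed \<open>k\<close> the approximants converge in
  \<open>n\<close>, their limits converge in \<open>k\<close>, and the approximation error is small
  for all large \<open>n\<close>. Off the exceptional event the Lipschitz constant controls the
  change of the test function, on it the bound \<open>B\<close> does.\<close>

lemma converges_weakly_approximation:
  assumes Y: "\<forall>\<^sub>F n in sequentially. prob_space (N n) \<and> Y n \<in> N n \<rightarrow>\<^sub>M borel_of mtopology"
    and W: "prob_space W" and Z: "Z \<in> W \<rightarrow>\<^sub>M borel_of mtopology"
    and Y': "\<And>k. k \<ge> 1 \<Longrightarrow> \<forall>\<^sub>F n in sequentially. Y' k n \<in> N n \<rightarrow>\<^sub>M borel_of mtopology"
    and Z': "\<And>k. k \<ge> 1 \<Longrightarrow> Z' k \<in> W \<rightarrow>\<^sub>M borel_of mtopology"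
    and conv: "\<And>k f B L. k \<ge> 1 \<Longrightarrow> (\<And>x. x \<in> M \<Longrightarrow> \<bar>f x\<bar> \<le> B) \<Longrightarrow>
      (\<And>x y. x \<in> M \<Longrightarrow> y \<in> M \<Longrightarrow> \<bar>f x - f y\<bar> \<le> L * d x y) \<Longrightarrow>
      (\<lambda>n. \<integral>\<omega>. f (Y' k n \<omega>) \<partial>N n) \<longlonglongrightarrow> (\<integral>\<omega>. f (Z' k \<omega>) \<partial>W)"
    and lim: "\<And>\<omega>. \<omega> \<in> space W \<Longrightarrow> (\<lambda>k. d (Z' k \<omega>) (Z \<omega>)) \<longlonglongrightarrow> 0"
    and approx: "\<And>e. e > 0 \<Longrightarrow> \<forall>\<^sub>F k in sequentially. \<forall>\<^sub>F n in sequentially.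
      \<exists>A\<in>sets (N n). measure (N n) A \<le> e \<and> (\<forall>\<omega>\<in>space (N n) - A. d (Y' k n \<omega>) (Y n \<omega>) \<le> e)"
  shows "converges_weakly mtopology N Y W Z"
proof (rule converges_weakly_Lipschitz[OF Y W Z])
  fix f :: "'a \<Rightarrow> real" and B L
  assume B: "\<And>x. x \<in> M \<Longrightarrow> \<bar>f x\<bar> \<le> B" and L: "\<And>x y. x \<in> M \<Longrightarrow> y \<in> M \<Longrightarrow> \<bar>f x - f y\<bar> \<le> L * d x y"
  interpret W: prob_space W by fact
  have f: "continuous_map mtopology euclideanreal f" by (rule Lipschitz_imp_continuous_map[OF L])
  have ZM: "Z \<omega> \<in> M" if "\<omega> \<in> space W" for \<omega>
    using measurable_space[OF Z that] by (simp add: space_borel_of)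
  have Z'M: "Z' k \<omega> \<in> M" if "k \<ge> 1" "\<omega> \<in> space W" for k \<omega>
    using measurable_space[OF Z'[OF that(1)] that(2)] by (simp add: space_borel_of)
  obtain \<omega>0 where "\<omega>0 \<in> space W" using W.not_empty by blast
  then have B0: "0 \<le> B" using B[OF ZM] abs_ge_zero order_trans by blast
  \<comment> \<open>The hypotheses on \<open>Z' k\<close> start at \<open>k = 1\<close>, hence the
    shift.\<close>
  have "(\<lambda>k. \<integral>\<omega>. f (Z' (Suc k) \<omega>) \<partial>W) \<longlonglongrightarrow> (\<integral>\<omega>. f (Z \<omega>) \<partial>W)"
  proof (rule integral_dominated_convergence[where w="\<lambda>_. B"])
    show "AE \<omega> in W. (\<lambda>k. f (Z' (Suc k) \<omega>)) \<longlonglongrightarrow> f (Z \<omega>)"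
    proof (rule AE_I2)
      fix \<omega> assume \<omega>: "\<omega> \<in> space W"
      have "(\<lambda>k. L * d (Z' (Suc k) \<omega>) (Z \<omega>)) \<longlonglongrightarrow> L * 0"
        by (intro tendsto_mult tendsto_const LIMSEQ_Suc[OF lim[OF \<omega>]])
      then have "(\<lambda>k. L * d (Z' (Suc k) \<omega>) (Z \<omega>)) \<longlonglongrightarrow> 0" by simp
      moreover have "norm (f (Z' (Suc k) \<omega>) - f (Z \<omega>)) \<le> L * d (Z' (Suc k) \<omega>) (Z \<omega>)" for k
        using L[OF Z'M[of "Suc k", OF _ \<omega>] ZM[OF \<omega>]] by simp
      ultimately have "(\<lambda>k. f (Z' (Suc k) \<omega>) - f (Z \<omega>)) \<longlonglongrightarrow> 0"
        by (rule Lim_null_comparison[OF always_eventually[OF allI], rotated])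
      then show "(\<lambda>k. f (Z' (Suc k) \<omega>)) \<longlonglongrightarrow> f (Z \<omega>)" by (rule LIM_zero_cancel)
    qed
    show "AE \<omega> in W. norm (f (Z' (Suc k) \<omega>)) \<le> B" for k using B Z'M by auto
    show "(\<lambda>\<omega>. f (Z \<omega>)) \<in> borel_measurable W"
      by (rule measurable_compose[OF Z continuous_map_borel_measurable[OF f]])
    show "(\<lambda>\<omega>. f (Z' (Suc k) \<omega>)) \<in> borel_measurable W" for k
      by (rule measurable_compose[OF Z' continuous_map_borel_measurable[OF f]]) simp
  qed simp
  then have limf: "(\<lambda>k. \<integral>\<omega>. f (Z' k \<omega>) \<partial>W) \<longlonglongrightarrow> (\<integral>\<omega>. f (Z \<omega>) \<partial>W)"
    by (rule LIMSEQ_imp_Suc)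
  show "(\<lambda>n. \<integral>\<omega>. f (Y n \<omega>) \<partial>N n) \<longlonglongrightarrow> (\<integral>\<omega>. f (Z \<omega>) \<partial>W)"
  proof (rule tendstoI)
    fix e :: real assume e: "e > 0"
    \<comment> \<open>Replacing \<open>Y' k n\<close> by \<open>Y n\<close> will cost at most
      \<open>(\<bar>L\<bar> + 2 * B) * \<epsilon>\<close>; the summand 1 keeps the denominator
      positive.\<close>
    define \<epsilon> where "\<epsilon> = e / (3 * (\<bar>L\<bar> + 2 * B + 1))"
    have \<epsilon>: "\<epsilon> > 0" using e B0 by (simp add: \<epsilon>_def)
    have "eventually (\<lambda>k. dist (\<integral>\<omega>. f (Z' k \<omega>) \<partial>W) (\<integral>\<omega>. f (Z \<omega>) \<partial>W) < e / 3) sequentially"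
      using limf e by (intro tendstoD) auto
    with approx[OF \<epsilon>] eventually_ge_at_top[of "1::nat"]
    have "eventually (\<lambda>k. k \<ge> 1 \<and> dist (\<integral>\<omega>. f (Z' k \<omega>) \<partial>W) (\<integral>\<omega>. f (Z \<omega>) \<partial>W) < e / 3 \<and>
      (\<forall>\<^sub>F n in sequentially. \<exists>A\<in>sets (N n). measure (N n) A \<le> \<epsilon> \<and>
         (\<forall>\<omega>\<in>space (N n) - A. d (Y' k n \<omega>) (Y n \<omega>) \<le> \<epsilon>))) sequentially"
      by eventually_elim auto
    then obtain k where k: "k \<ge> 1" "dist (\<integral>\<omega>. f (Z' k \<omega>) \<partial>W) (\<integral>\<omega>. f (Z \<omega>) \<partial>W) < e / 3"
      "\<forall>\<^sub>F n in sequentially. \<exists>A\<in>sets (N n). measure (N n) A \<le> \<epsilon> \<and>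
         (\<forall>\<omega>\<in>space (N n) - A. d (Y' k n \<omega>) (Y n \<omega>) \<le> \<epsilon>)"
      using eventually_happens'[OF sequentially_bot] by blast
    have "eventually (\<lambda>n. dist (\<integral>\<omega>. f (Y' k n \<omega>) \<partial>N n) (\<integral>\<omega>. f (Z' k \<omega>) \<partial>W) < e / 3) sequentially"
      using conv[OF k(1) B L] e by (intro tendstoD) auto
    with k(3) Y Y'[OF k(1)]
    show "eventually (\<lambda>n. dist (\<integral>\<omega>. f (Y n \<omega>) \<partial>N n) (\<integral>\<omega>. f (Z \<omega>) \<partial>W) < e) sequentially"
    proof eventually_elim
      case (elim n)
      interpret N: prob_space "N n" using elim by blast
      have YM: "Y n \<omega> \<in> M" "Y' k n \<omega> \<in> M" if "\<omega> \<in> space (N n)" for \<omega>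
        using that elim measurable_space[of _ "N n" "borel_of mtopology" \<omega>] by (auto simp: space_borel_of)
      have int: "integrable (N n) (\<lambda>\<omega>. f (Y n \<omega>))" "integrable (N n) (\<lambda>\<omega>. f (Y' k n \<omega>))"
        using elim N.prob_space_axioms by (auto intro!: integrable_continuous_map[OF _ _ f B])
      obtain A where A: "A \<in> sets (N n)" "measure (N n) A \<le> \<epsilon>"
        "\<And>\<omega>. \<omega> \<in> space (N n) - A \<Longrightarrow> d (Y' k n \<omega>) (Y n \<omega>) \<le> \<epsilon>" using elim(1) by blast
      have bound: "\<bar>f (Y' k n \<omega>) - f (Y n \<omega>)\<bar> \<le> \<bar>L\<bar> * \<epsilon> + 2 * B * indicator A \<omega>"
        if \<omega>: "\<omega> \<in> space (N n)" for \<omega>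
      proof (cases "\<omega> \<in> A")
        case True
        have "\<bar>f (Y' k n \<omega>) - f (Y n \<omega>)\<bar> \<le> 2 * B" using B[OF YM(1)[OF \<omega>]] B[OF YM(2)[OF \<omega>]] by linarith
        moreover have "0 \<le> \<bar>L\<bar> * \<epsilon>" using \<epsilon> by simp
        ultimately show ?thesis using True by simp
      next
        case False
        have "\<bar>f (Y' k n \<omega>) - f (Y n \<omega>)\<bar> \<le> L * d (Y' k n \<omega>) (Y n \<omega>)" using L YM \<omega> by blast
        also have "\<dots> \<le> \<bar>L\<bar> * \<epsilon>" using A(3)[of \<omega>] False \<omega> by (intro mult_mono) auto
        finally show ?thesis using False by simp
      qed
      have ind: "integrable (N n) (\<lambda>\<omega>. 2 * B * indicator A \<omega> :: real)"
        using A(1) by (intro integrable_mult_right integrable_real_indicator) (auto simp: N.emeasure_eq_measure)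
      have intA: "integrable (N n) (\<lambda>\<omega>. \<bar>L\<bar> * \<epsilon> + 2 * B * indicator A \<omega>)"
        by (rule Bochner_Integration.integrable_add[OF _ ind]) simp
      have "\<bar>(\<integral>\<omega>. f (Y' k n \<omega>) \<partial>N n) - (\<integral>\<omega>. f (Y n \<omega>) \<partial>N n)\<bar> = \<bar>\<integral>\<omega>. f (Y' k n \<omega>) - f (Y n \<omega>) \<partial>N n\<bar>"
        using int by simp
      also have "\<dots> \<le> (\<integral>\<omega>. \<bar>f (Y' k n \<omega>) - f (Y n \<omega>)\<bar> \<partial>N n)" by (rule integral_abs_bound)
      also have "\<dots> \<le> (\<integral>\<omega>. \<bar>L\<bar> * \<epsilon> + 2 * B * indicator A \<omega> \<partial>N n)"
        using int bound intA by (intro integral_mono) auto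
      also have "\<dots> = \<bar>L\<bar> * \<epsilon> + 2 * B * measure (N n) A"
        using Bochner_Integration.integral_add[OF _ ind, of "\<lambda>_. \<bar>L\<bar> * \<epsilon>"] A(1) by (simp add: N.prob_space)
      also have "\<dots> \<le> (\<bar>L\<bar> + 2 * B) * \<epsilon>"
        using A(2) B0 by (simp add: distrib_right mult_left_mono)
      also have "\<dots> \<le> (\<bar>L\<bar> + 2 * B + 1) * \<epsilon>" using \<epsilon> by (intro mult_right_mono) auto
      also have "\<dots> = e / 3" using B0 by (simp add: \<epsilon>_def field_simps)
      finally show ?case using elim(4) k(2) unfolding dist_real_def by linarith
    qed
  qed
qed

end

section \<open>Maximal inequalities\<close>

text \<open>The range is half open, so that consecutive blocks add up and use disjoint pulls. Pull
  numbers start at 1, hence a full sum has \<open>a = 0\<close>.\<close>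

definition centered_sum :: "real \<Rightarrow> (nat \<Rightarrow> real) \<Rightarrow> nat \<Rightarrow> nat \<Rightarrow> real" where
  "centered_sum m x a b = (\<Sum>j\<in>{a<..b}. x j - m)"

lemma centered_sum_split: "a \<le> b \<Longrightarrow> b \<le> c \<Longrightarrow> centered_sum m x a c = centered_sum m x a b + centered_sum m x b c"
  unfolding centered_sum_def
  by (subst sum.union_disjoint[symmetric]) (auto intro!: sum.cong)

lemma centered_sum_self [simp]: "centered_sum m x a a = 0"
  by (simp add: centered_sum_def)

lemma centered_sum_cong: "(\<And>j. a < j \<Longrightarrow> j \<le> b \<Longrightarrow> x j = y j) \<Longrightarrow> centered_sum m x a b = centered_sum m y a b"
  by (simp add: centered_sum_def)

text \<open>One arm with the policy forgotten. The deviation bounds proved here cover all pull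
  numbers up to the horizon at once, so they hold whatever the policy does.\<close>

locale iid_unit_interval = prob_space M for M :: "'a measure" +
  fixes Q :: "real measure" and X :: "nat \<Rightarrow> 'a \<Rightarrow> real"
  assumes X_indep: "indep_vars (\<lambda>_. borel) X {1..}"
    and X_distr: "\<And>j. 1 \<le> j \<Longrightarrow> distr M borel (X j) = Q"
    and Q_unit: "AE x in Q. x \<in> {0..1}"
begin

abbreviation S :: "nat \<Rightarrow> nat \<Rightarrow> 'a \<Rightarrow> real" where
  "S a b \<omega> \<equiv> centered_sum (arm_mean Q) (\<lambda>j. X j \<omega>) a b"

lemma X_measurable [measurable]: "1 \<le> j \<Longrightarrow> X j \<in> borel_measurable M"
  using X_indep by (auto simp: indep_vars_def)

lemma X_unit: "1 \<le> j \<Longrightarrow> AE \<omega> in M. X j \<omega> \<in> {0..1}"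
  using Q_unit X_distr[of j] AE_distrD[OF X_measurable, of j] by auto

lemma X_mean: "1 \<le> j \<Longrightarrow> expectation (X j) = arm_mean Q"
  unfolding arm_mean_def by (subst X_distr[symmetric, of j]) (auto simp: integral_distr)

lemma S_measurable [measurable]: "S a b \<in> borel_measurable M"
  unfolding centered_sum_def by (intro borel_measurable_sum borel_measurable_diff X_measurable) auto

text \<open>Hoeffding's inequality; each reward ranges over an interval of length 1, so the sum of
  the squared lengths is the number \<open>b - a\<close> of terms.\<close>

lemma S_tail:
  assumes "a < b" "e \<ge> 0"
  shows "prob {\<omega> \<in> space M. e \<le> \<bar>S a b \<omega>\<bar>} \<le> 2 * exp (- 2 * e\<^sup>2 / real (b - a))"
proof -
  interpret Hoeffding_ineq M "{a<..b}" X "\<lambda>_. 0" "\<lambda>_. 1" "real (b - a) * arm_mean Q"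
  proof unfold_locales
    show "indep_vars (\<lambda>_. borel) X {a<..b}" by (rule indep_vars_subset[OF X_indep]) auto
    show "AE x in M. X j x \<in> {0..1}" if "j \<in> {a<..b}" for j using that by (intro X_unit) auto
    show "real (b - a) * arm_mean Q \<equiv> \<Sum>i\<in>{a<..b}. expectation (X i)"
      by (rule eq_reflection) (simp add: X_mean)
  qed auto
  show ?thesis
    using Hoeffding_ineq_abs_ge[of e] assms by (simp add: centered_sum_def sum_subtractf)
qed

text \<open>Ottaviani's argument: after the first time that \<open>S\<close> exceeds \<open>2 * e\<close>, the remaining increment
  stays below \<open>e\<close> with probability at least one half.\<close>

lemma S_maximal:
  assumes L: "L \<ge> 1" and e: "e > 0"
  shows "prob {\<omega> \<in> space M. \<exists>l\<le>L. 2 * e \<le> \<bar>S a (a + l) \<omega>\<bar>} \<le> 4 * exp (- 2 * e\<^sup>2 / real L)"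
proof (cases "2 * exp (- 2 * e\<^sup>2 / real L) \<le> 1 / 2")
  \<comment> \<open>Then the claimed bound exceeds 1.\<close>
  case False
  then show ?thesis using prob_le_1[of "{\<omega> \<in> space M. \<exists>l\<le>L. 2 * e \<le> \<bar>S a (a + l) \<omega>\<bar>}"] by linarith
next
  case True
  \<comment> \<open>Splitting by the first exceedance makes the events \<open>A l\<close> disjoint
    and dependent on the rewards up to \<open>a + l\<close> only, while \<open>B l\<close> depends
    on the later ones.\<close>
  define A where "A l = {\<omega> \<in> space M. 2 * e \<le> \<bar>S a (a + l) \<omega>\<bar> \<and> (\<forall>i<l. \<bar>S a (a + i) \<omega>\<bar> < 2 * e)}" for l
  define B where "B l = {\<omega> \<in> space M. \<bar>S (a + l) (a + L) \<omega>\<bar> < e}" for l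
  have A_sets [measurable]: "A l \<in> events" for l unfolding A_def by measurable
  have B_sets [measurable]: "B l \<in> events" for l unfolding B_def by measurable
  have half: "prob (B l) \<ge> 1 / 2" if l: "l \<le> L" for l
  proof -
    have "prob (space M - B l) \<le> 1 / 2"
    proof (cases "l = L")
      case True
      then have "space M - B l = {}" using e by (auto simp: B_def)
      then have "prob (space M - B l) = 0" by (simp only: measure_empty)
      then show ?thesis by linarith
    next
      case F: False
      have "space M - B l = {\<omega> \<in> space M. e \<le> \<bar>S (a + l) (a + L) \<omega>\<bar>}" by (auto simp: B_def)
      then have "prob (space M - B l) \<le> 2 * exp (- 2 * e\<^sup>2 / real (L - l))"
        using S_tail[of "a + l" "a + L" e] F l e by simp
      also have "\<dots> \<le> 2 * exp (- 2 * e\<^sup>2 / real L)"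
        using F l by (simp add: frac_le)
      finally show ?thesis using True by simp
    qed
    then show ?thesis using prob_compl[OF B_sets, of l] by simp
  qed
  have ind: "prob (A l \<inter> B l) = prob (A l) * prob (B l)" if l: "l \<le> L" for l
  proof -
    \<comment> \<open>To use independence, \<open>A l\<close> and \<open>B l\<close> are rewritten
      as preimages under the reward vectors restricted to early and to late pulls.\<close>
    let ?P = "PiM {1..a + l} (\<lambda>_. borel) :: (nat \<Rightarrow> real) measure"
    let ?R = "PiM {a + l<..a + L} (\<lambda>_. borel) :: (nat \<Rightarrow> real) measure"
    let ?c = "centered_sum (arm_mean Q)"
    define A' where "A' = {x \<in> space ?P. 2 * e \<le> \<bar>?c x a (a + l)\<bar> \<and> (\<forall>i<l. \<bar>?c x a (a + i)\<bar> < 2 * e)}"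
    define B' where "B' = {x \<in> space ?R. \<bar>?c x (a + l) (a + L)\<bar> < e}"
    have c1 [measurable]: "(\<lambda>x. ?c x a (a + i)) \<in> borel_measurable ?P" if "i \<le> l" for i
      unfolding centered_sum_def
      by (intro borel_measurable_sum borel_measurable_diff measurable_component_singleton) (use that in auto)
    have c2 [measurable]: "(\<lambda>x. ?c x (a + l) (a + L)) \<in> borel_measurable ?R"
      unfolding centered_sum_def
      by (intro borel_measurable_sum borel_measurable_diff measurable_component_singleton) auto
    have A': "A' \<in> sets ?P"
    proof -
      have "A' = {x \<in> space ?P. 2 * e \<le> \<bar>?c x a (a + l)\<bar>} \<inter> {x \<in> space ?P. \<forall>i\<in>{..<l}. \<bar>?c x a (a + i)\<bar> < 2 * e}"
        by (auto simp: A'_def)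
      also have "\<dots> \<in> sets ?P"
      proof (intro sets.Int sets.sets_Collect_finite_All)
        show "{x \<in> space ?P. 2 * e \<le> \<bar>?c x a (a + l)\<bar>} \<in> sets ?P"
          by (intro borel_measurable_le borel_measurable_const borel_measurable_abs c1 order_refl)
        show "{x \<in> space ?P. \<bar>?c x a (a + i)\<bar> < 2 * e} \<in> sets ?P" if "i \<in> {..<l}" for i
          by (intro borel_measurable_less borel_measurable_const borel_measurable_abs c1) (use that in simp)
      qed simp
      finally show ?thesis .
    qed
    have B': "B' \<in> sets ?R" unfolding B'_def by measurable
    have iv: "indep_var ?P (\<lambda>\<omega>. \<lambda>i\<in>{1..a + l}. X i \<omega>) ?R (\<lambda>\<omega>. \<lambda>i\<in>{a + l<..a + L}. X i \<omega>)"
      by (rule indep_var_restrict[OF X_indep]) auto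
    have 1: "(\<lambda>\<omega>. \<lambda>i\<in>{1..a + l}. X i \<omega>) -` A' \<inter> space M = A l"
    proof -
      have "?c (\<lambda>i\<in>{1..a + l}. X i \<omega>) a (a + i) = S a (a + i) \<omega>" if "i \<le> l" for i \<omega>
        by (rule centered_sum_cong) (use that in auto)
      then show ?thesis by (auto simp: A'_def A_def space_PiM)
    qed
    have 2: "(\<lambda>\<omega>. \<lambda>i\<in>{a + l<..a + L}. X i \<omega>) -` B' \<inter> space M = B l"
    proof -
      have "?c (\<lambda>i\<in>{a + l<..a + L}. X i \<omega>) (a + l) (a + L) = S (a + l) (a + L) \<omega>" for \<omega>
        by (rule centered_sum_cong) auto
      then show ?thesis by (auto simp: B'_def B_def space_PiM)
    qed
    have "prob ((\<lambda>\<omega>. (\<lambda>i\<in>{1..a + l}. X i \<omega>, \<lambda>i\<in>{a + l<..a + L}. X i \<omega>)) -` (A' \<times> B') \<inter> space M)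
        = prob (A l) * prob (B l)"
      using indep_varD[OF iv A' B'] unfolding 1 2 .
    moreover have "(\<lambda>\<omega>. (\<lambda>i\<in>{1..a + l}. X i \<omega>, \<lambda>i\<in>{a + l<..a + L}. X i \<omega>)) -` (A' \<times> B') \<inter> space M = A l \<inter> B l"
      unfolding 1[symmetric] 2[symmetric] by blast
    ultimately show ?thesis by simp
  qed
  have "{\<omega> \<in> space M. \<exists>l\<le>L. 2 * e \<le> \<bar>S a (a + l) \<omega>\<bar>} = (\<Union>l\<in>{..L}. A l)" (is "?E = _")
  proof
    show "?E \<subseteq> (\<Union>l\<in>{..L}. A l)"
    proof
      fix \<omega> assume "\<omega> \<in> ?E"
      then obtain l where l: "l \<le> L" "2 * e \<le> \<bar>S a (a + l) \<omega>\<bar>" and \<omega>: "\<omega> \<in> space M" by blast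
      define l0 where "l0 = (LEAST l. 2 * e \<le> \<bar>S a (a + l) \<omega>\<bar>)"
      have "2 * e \<le> \<bar>S a (a + l0) \<omega>\<bar>" unfolding l0_def by (rule LeastI) (rule l)
      moreover have "l0 \<le> l" unfolding l0_def by (rule Least_le) (rule l)
      moreover have "\<bar>S a (a + i) \<omega>\<bar> < 2 * e" if "i < l0" for i
        using not_less_Least[OF that[unfolded l0_def]] by simp
      ultimately show "\<omega> \<in> (\<Union>l\<in>{..L}. A l)" using l \<omega> by (auto simp: A_def intro!: bexI[of _ l0])
    qed
  qed (auto simp: A_def)
  then have "prob ?E \<le> (\<Sum>l\<le>L. prob (A l))"
    using finite_measure_subadditive_finite[of "{..L}" A] A_sets by fastforce
  also have "\<dots> \<le> (\<Sum>l\<le>L. 2 * prob (A l \<inter> B l))"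
  proof (rule sum_mono)
    fix l assume "l \<in> {..L}"
    then have "prob (A l) * (1 / 2) \<le> prob (A l \<inter> B l)"
      using ind[of l] mult_left_mono[OF half[of l], of "prob (A l)"] by simp
    then show "prob (A l) \<le> 2 * prob (A l \<inter> B l)" by simp
  qed
  also have "\<dots> = 2 * prob (\<Union>l\<in>{..L}. A l \<inter> B l)"
  proof -
    have "disjoint_family_on (\<lambda>l. A l \<inter> B l) {..L}"
      unfolding disjoint_family_on_def
    proof (intro ballI impI)
      fix l l' :: nat assume "l \<noteq> l'"
      then show "(A l \<inter> B l) \<inter> (A l' \<inter> B l') = {}" by (cases l l' rule: linorder_cases) (auto simp: A_def)
    qed
    then have "prob (\<Union>l\<in>{..L}. A l \<inter> B l) = (\<Sum>l\<le>L. prob (A l \<inter> B l))"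
      by (intro finite_measure_finite_Union) auto
    then show ?thesis by (simp add: sum_distrib_left)
  qed
  also have "\<dots> \<le> 2 * prob {\<omega> \<in> space M. e \<le> \<bar>S a (a + L) \<omega>\<bar>}"
  proof -
    \<comment> \<open>An excursion of at least \<open>2 * e\<close> followed by a change of less
      than \<open>e\<close> leaves at least \<open>e\<close>.\<close>
    have "e \<le> \<bar>S a (a + L) \<omega>\<bar>" if "\<omega> \<in> A l \<inter> B l" "l \<le> L" for l \<omega>
      using that centered_sum_split[of a "a + l" "a + L" "arm_mean Q" "\<lambda>j. X j \<omega>"] by (auto simp: A_def B_def)
    then have "prob (\<Union>l\<in>{..L}. A l \<inter> B l) \<le> prob {\<omega> \<in> space M. e \<le> \<bar>S a (a + L) \<omega>\<bar>}"
      by (intro finite_measure_mono) (auto simp: A_def)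
    then show ?thesis by simp
  qed
  also have "\<dots> \<le> 2 * (2 * exp (- 2 * e\<^sup>2 / real L))"
    using S_tail[of a "a + L" e] L e by simp
  finally show ?thesis by simp
qed

text \<open>Cut the range into blocks of length \<open>h\<close>. Both \<open>p\<close> and
  \<open>q\<close> lie within \<open>2 * h\<close> of the left end of the block of \<open>p\<close>,
  so a large increment between them forces a large excursion from that end. There are
  \<open>n div h + 1\<close> blocks, and \<open>S_maximal\<close> over the length
  \<open>2 * h\<close> gives the exponent.\<close>

lemma S_modulus:
  assumes h: "h \<ge> 1" and e: "e > 0"
  shows "prob {\<omega> \<in> space M. \<exists>p\<le>n. \<exists>q\<le>n. p \<le> q \<and> q \<le> p + h \<and> 4 * e \<le> \<bar>S p q \<omega>\<bar>}
    \<le> real (n div h + 1) * (4 * exp (- (e\<^sup>2) / real h))"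
proof -
  let ?F = "\<lambda>c. {\<omega> \<in> space M. \<exists>l\<le>2 * h. 2 * e \<le> \<bar>S (c * h) (c * h + l) \<omega>\<bar>}"
  have F: "?F c \<in> events" for c by measurable
  have "{\<omega> \<in> space M. \<exists>p\<le>n. \<exists>q\<le>n. p \<le> q \<and> q \<le> p + h \<and> 4 * e \<le> \<bar>S p q \<omega>\<bar>} \<subseteq> (\<Union>c\<in>{..n div h}. ?F c)"
  proof
    fix \<omega> assume "\<omega> \<in> {\<omega> \<in> space M. \<exists>p\<le>n. \<exists>q\<le>n. p \<le> q \<and> q \<le> p + h \<and> 4 * e \<le> \<bar>S p q \<omega>\<bar>}"
    then obtain p q where pq: "p \<le> n" "q \<le> n" "p \<le> q" "q \<le> p + h" "4 * e \<le> \<bar>S p q \<omega>\<bar>" and \<omega>: "\<omega> \<in> space M"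
      by blast
    define c where "c = p div h"
    have c: "c * h \<le> p" "p < c * h + h" "c \<le> n div h"
      using h pq(1) dividend_less_times_div[of h p] by (auto simp: c_def div_le_mono mult.commute)
    have "S (c * h) q \<omega> = S (c * h) p \<omega> + S p q \<omega>" using c pq by (intro centered_sum_split)
    then have "2 * e \<le> \<bar>S (c * h) q \<omega>\<bar> \<or> 2 * e \<le> \<bar>S (c * h) p \<omega>\<bar>" using pq(5) by linarith
    then have "\<exists>l\<le>2 * h. 2 * e \<le> \<bar>S (c * h) (c * h + l) \<omega>\<bar>"
    proof
      assume "2 * e \<le> \<bar>S (c * h) q \<omega>\<bar>"
      then show ?thesis using c pq by (intro exI[of _ "q - c * h"]) auto
    next
      assume "2 * e \<le> \<bar>S (c * h) p \<omega>\<bar>"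
      then show ?thesis using c pq by (intro exI[of _ "p - c * h"]) auto
    qed
    then show "\<omega> \<in> (\<Union>c\<in>{..n div h}. ?F c)" using \<omega> c by blast
  qed
  then have "prob {\<omega> \<in> space M. \<exists>p\<le>n. \<exists>q\<le>n. p \<le> q \<and> q \<le> p + h \<and> 4 * e \<le> \<bar>S p q \<omega>\<bar>} \<le> prob (\<Union>c\<in>{..n div h}. ?F c)"
    by (intro finite_measure_mono) (use F in auto)
  also have "\<dots> \<le> (\<Sum>c\<le>n div h. prob (?F c))"
    by (intro finite_measure_subadditive_finite) (use F in auto)
  also have "\<dots> \<le> (\<Sum>c\<le>n div h. 4 * exp (- (e\<^sup>2) / real h))"
  proof (rule sum_mono)
    fix c
    have "prob (?F c) \<le> 4 * exp (- 2 * e\<^sup>2 / real (2 * h))" by (rule S_maximal) (use h e in auto)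
    then show "prob (?F c) \<le> 4 * exp (- (e\<^sup>2) / real h)" by simp
  qed
  finally show ?thesis by simp
qed

text \<open>Peeling: for \<open>s\<close> between \<open>2 ^ k\<close> and \<open>2 ^ Suc k\<close>
  the normalisation \<open>sqrt s\<close> is at least \<open>sqrt (2 ^ k)\<close>, and
  \<open>S_maximal\<close> gives an exponent free of \<open>k\<close>. The union bound therefore
  costs only the number \<open>K\<close> of scales, which can be taken logarithmic in
  \<open>n\<close>.\<close>

lemma S_normalised_maximum:
  assumes e: "e > 0" and n: "n < 2 ^ K"
  shows "prob {\<omega> \<in> space M. \<exists>s\<in>{1..n}. e * sqrt (real s) \<le> \<bar>S 0 s \<omega>\<bar>} \<le> real K * (4 * exp (- (e\<^sup>2) / 4))"
proof -
  let ?F = "\<lambda>k. {\<omega> \<in> space M. \<exists>l\<le>2 ^ Suc k. 2 * (e * sqrt (2 ^ k) / 2) \<le> \<bar>S 0 (0 + l) \<omega>\<bar>}"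
  have F: "?F c \<in> events" for c by measurable
  have "{\<omega> \<in> space M. \<exists>s\<in>{1..n}. e * sqrt (real s) \<le> \<bar>S 0 s \<omega>\<bar>} \<subseteq> (\<Union>k\<in>{..<K}. ?F k)"
  proof
    fix \<omega> assume "\<omega> \<in> {\<omega> \<in> space M. \<exists>s\<in>{1..n}. e * sqrt (real s) \<le> \<bar>S 0 s \<omega>\<bar>}"
    then obtain s where s: "1 \<le> s" "s \<le> n" "e * sqrt (real s) \<le> \<bar>S 0 s \<omega>\<bar>" and \<omega>: "\<omega> \<in> space M" by auto
    obtain k where k: "2 ^ k \<le> s" "s < 2 ^ (k + 1)" using ex_power_ivl1[of 2 s] s by auto
    have "(2::nat) ^ k < 2 ^ K" using k s n by linarith
    then have "k < K" by simp
    have "real (2 ^ k) \<le> real s" using k(1) by (simp only: of_nat_le_iff)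
    then have "e * sqrt (2 ^ k) \<le> e * sqrt (real s)" using e by simp
    then show "\<omega> \<in> (\<Union>k\<in>{..<K}. ?F k)"
      using s k \<omega> \<open>k < K\<close> by (intro UN_I[of k]) (auto intro!: exI[of _ s])
  qed
  then have "prob {\<omega> \<in> space M. \<exists>s\<in>{1..n}. e * sqrt (real s) \<le> \<bar>S 0 s \<omega>\<bar>} \<le> prob (\<Union>k\<in>{..<K}. ?F k)"
    by (intro finite_measure_mono) (use F in auto)
  also have "\<dots> \<le> (\<Sum>k<K. prob (?F k))"
    by (intro finite_measure_subadditive_finite) (use F in auto)
  also have "\<dots> \<le> (\<Sum>k<K. 4 * exp (- (e\<^sup>2) / 4))"
  proof (rule sum_mono)
    fix k
    have "prob (?F k) \<le> 4 * exp (- 2 * (e * sqrt (2 ^ k) / 2)\<^sup>2 / real (2 ^ Suc k))"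
      by (rule S_maximal) (use e in auto)
    also have "- 2 * (e * sqrt (2 ^ k) / 2)\<^sup>2 / real (2 ^ Suc k) = - (e\<^sup>2) / 4"
      by (simp add: power_mult_distrib power_divide field_simps)
    finally show "prob (?F k) \<le> 4 * exp (- (e\<^sup>2) / 4)" .
  qed
  finally show ?thesis by simp
qed

end

section \<open>The UCB policy\<close>

lemma (in prob_space) indep_vars_reindex:
  assumes X: "indep_vars M' X I" and h: "inj_on h J" "h ` J \<subseteq> I"
  shows "indep_vars (\<lambda>j. M' (h j)) (\<lambda>j. X (h j)) J"
proof -
  have "indep_vars (\<lambda>j. PiM {h j} M') (\<lambda>j \<omega>. restrict (\<lambda>i. X i \<omega>) {h j}) J"
    using h by (intro indep_vars_restrict[OF X]) (auto simp: disjoint_family_on_def inj_on_def)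
  then have "indep_vars (\<lambda>j. M' (h j)) (\<lambda>j \<omega>. (\<lambda>f. f (h j)) (restrict (\<lambda>i. X i \<omega>) {h j})) J"
    by (rule indep_vars_compose2) (auto intro: measurable_component_singleton)
  then show ?thesis by simp
qed

text \<open>After multiplication by \<open>sqrt b\<close> the bonus of the rarely pulled arm is
  \<open>sqrt L\<close>, while that of the other arm keeps only the factor
  \<open>sqrt (b / a)\<close>, at most \<open>1 - \<epsilon> / 2\<close>. Each noise term becomes at
  most \<open>K\<close>, since deviations are measured in units of the square root of the number of
  pulls, and the difference of the means is multiplied by at most \<open>sqrt n\<close>.\<close>

lemma index_comparison:
  fixes a b \<epsilon> n L K mi mj Ci Cj :: real
  assumes "0 < a" "0 < b" "b \<le> (1 - \<epsilon>) * a" "0 < \<epsilon>" "b \<le> n" "0 \<le> L"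
    and Ci: "\<bar>Ci\<bar> \<le> K * sqrt a" and Cj: "\<bar>Cj\<bar> \<le> K * sqrt b"
    and ind: "mj + Cj / b + sqrt (L / b) \<le> mi + Ci / a + sqrt (L / a)"
  shows "\<epsilon> / 2 * sqrt L \<le> sqrt n * \<bar>mi - mj\<bar> + 2 * K"
proof -
  have K: "0 \<le> K" using Ci assms(1) by (meson abs_ge_zero order_trans real_sqrt_gt_zero zero_le_mult_iff linorder_not_le)
  have "0 < 1 - \<epsilon>" using assms(1,2,3) by (smt (verit) mult_nonpos_nonneg)
  have "b / a \<le> 1 - \<epsilon>" using assms(1,3) by (simp add: field_simps)
  also have "\<dots> \<le> (1 - \<epsilon> / 2)\<^sup>2" by (simp add: power2_eq_square field_simps)
  finally have "sqrt (b / a) \<le> 1 - \<epsilon> / 2" using \<open>0 < 1 - \<epsilon>\<close> by (intro real_le_lsqrt) auto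
  then have r: "sqrt b / sqrt a \<le> 1 - \<epsilon> / 2" by (simp add: real_sqrt_divide)
  have "0 < \<epsilon> * a" using assms by simp
  then have "b \<le> a" using assms(3) by (simp add: left_diff_distrib)
  then have sab: "sqrt b \<le> sqrt a" by simp
  have sa: "sqrt a > 0" "sqrt b > 0" using assms by auto
  have "sqrt b * (mj + Cj / b + sqrt (L / b)) \<le> sqrt b * (mi + Ci / a + sqrt (L / a))"
    using ind sa by (intro mult_left_mono) auto
  moreover have "sqrt b * (Cj / b) = Cj / sqrt b" using assms(2) by (simp add: field_simps real_div_sqrt)
  moreover have "sqrt b * sqrt (L / b) = sqrt L" using assms(2) by (simp add: real_sqrt_divide)
  moreover have "sqrt b * sqrt (L / a) = sqrt L * (sqrt b / sqrt a)" by (simp add: real_sqrt_divide)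
  ultimately have main: "sqrt b * mj + Cj / sqrt b + sqrt L
      \<le> sqrt b * mi + sqrt b * (Ci / a) + sqrt L * (sqrt b / sqrt a)"
    by (simp only: distrib_left)
  have "sqrt L * (sqrt b / sqrt a) \<le> sqrt L * (1 - \<epsilon> / 2)"
    using r assms(6) by (intro mult_left_mono) auto
  then have gain: "sqrt L * (sqrt b / sqrt a) \<le> sqrt L - \<epsilon> / 2 * sqrt L"
    by (simp add: right_diff_distrib mult.commute)
  have Kj: "\<bar>Cj / sqrt b\<bar> \<le> K" using Cj sa by (simp add: field_simps)
  have Ki: "\<bar>sqrt b * (Ci / a)\<bar> \<le> K"
  proof -
    have "\<bar>sqrt b * (Ci / a)\<bar> = sqrt b * \<bar>Ci\<bar> / a" using assms(1,2) by (simp add: abs_mult)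
    also have "\<dots> \<le> sqrt a * (K * sqrt a) / a"
      using sab Ci sa assms(1) by (intro divide_right_mono mult_mono) auto
    also have "\<dots> = K" using assms(1) by (simp add: field_simps)
    finally show ?thesis .
  qed
  have "sqrt b * (mi - mj) \<le> sqrt b * \<bar>mi - mj\<bar>" using sa by (intro mult_left_mono) auto
  also have "\<dots> \<le> sqrt n * \<bar>mi - mj\<bar>" using assms(5) by (intro mult_right_mono) auto
  finally have gap: "sqrt b * mi - sqrt b * mj \<le> sqrt n * \<bar>mi - mj\<bar>" by (simp add: right_diff_distrib)
  \<comment> \<open>The linear core with the nonlinear terms abstracted to variables:
    \<open>z\<close> is the reduced bonus, \<open>x\<close> and \<open>y\<close> are the noise,
    \<open>q - p\<close> is the weighted gap.\<close>
  have "t \<le> v + 2 * K" if "p + x + s \<le> q + y + z" "z \<le> s - t" "\<bar>x\<bar> \<le> K" "\<bar>y\<bar> \<le> K" "q - p \<le> v"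
    for p q s t v x y z :: real using that by linarith
  from this[OF main gain Kj Ki gap] show ?thesis .
qed

section \<open>Pull counts and the balance between the arms\<close>

lemma pulls_Suc: "pulls \<pi> i (Suc m) \<omega> = pulls \<pi> i m \<omega> + (if \<pi> (Suc m) \<omega> = i then 1 else 0)"
proof -
  have "{s \<in> {1..Suc m}. \<pi> s \<omega> = i} =
    (if \<pi> (Suc m) \<omega> = i then insert (Suc m) {s \<in> {1..m}. \<pi> s \<omega> = i} else {s \<in> {1..m}. \<pi> s \<omega> = i})"
    by (auto simp: le_Suc_eq)
  then show ?thesis by (simp add: pulls_def)
qed

lemma pulls_0 [simp]: "pulls \<pi> i 0 \<omega> = 0"
  by (simp add: pulls_def)

lemma pulls_mono: "m \<le> m' \<Longrightarrow> pulls \<pi> i m \<omega> \<le> pulls \<pi> i m' \<omega>"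
  by (induction rule: dec_induct) (auto simp: pulls_Suc)

lemma pulls_le: "pulls \<pi> i m \<omega> \<le> m"
  by (induction m) (auto simp: pulls_Suc)

text \<open>An excessive count is examined at the latest pull that contributed to it: there the
  policy chose this arm although its count was already only one smaller.\<close>

lemma last_pull:
  "pulls \<pi> i m \<omega> > 0 \<Longrightarrow> \<exists>t\<in>{1..m}. \<pi> t \<omega> = i \<and> pulls \<pi> i m \<omega> = Suc (pulls \<pi> i (t - 1) \<omega>)"
proof (induction m)
  case (Suc m)
  show ?case
  proof (cases "\<pi> (Suc m) \<omega> = i")
    case True
    then show ?thesis by (intro bexI[of _ "Suc m"]) (auto simp: pulls_Suc)
  next
    case False
    then have "pulls \<pi> i (Suc m) \<omega> = pulls \<pi> i m \<omega>" by (simp add: pulls_Suc)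
    then show ?thesis using Suc by auto
  qed
qed simp

lemma cumulative_reward_eq:
  "cumulative_reward X \<pi> i m \<omega> = mean * real (pulls \<pi> i m \<omega>) + centered_sum mean (\<lambda>j. X i j \<omega>) 0 (pulls \<pi> i m \<omega>)"
  unfolding cumulative_reward_def centered_sum_def
  by (simp add: sum_subtractf atLeastSucAtMost_greaterThanAtMost)

context canonical_ucb
begin

lemma policy_range:
  assumes "\<omega> \<in> space M" "1 \<le> t" shows "\<pi> t \<omega> \<in> {1, 2}"
proof (cases "3 \<le> t")
  case True
  then show ?thesis using ucb_plays[OF True assms(1)] by (simp add: is_arg_max_def)
next
  case False
  then have "t = 1 \<or> t = 2" using assms by auto
  then show ?thesis using initial_plays[OF assms(1)] by blast
qed

lemma pulls_sum:
  assumes "\<omega> \<in> space M" shows "pulls \<pi> 1 m \<omega> + pulls \<pi> 2 m \<omega> = m"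
proof (induction m)
  case (Suc m)
  then show ?case using policy_range[OF assms, of "Suc m"] by (auto simp: pulls_Suc)
qed simp

lemma pulls_pos:
  assumes "\<omega> \<in> space M" "2 \<le> m" "i \<in> {1, 2}" shows "1 \<le> pulls \<pi> i m \<omega>"
proof -
  have "i \<in> {\<pi> 1 \<omega>, \<pi> 2 \<omega>}" using initial_plays[OF assms(1)] assms(3) by blast
  then have "1 \<le> pulls \<pi> i 2 \<omega>" by (auto simp: numeral_2_eq_2 pulls_Suc)
  also have "\<dots> \<le> pulls \<pi> i m \<omega>" by (rule pulls_mono) fact
  finally show ?thesis .
qed

lemma iid_rewards:
  assumes "i \<in> {1, 2}" shows "iid_unit_interval M (P i) (X i)"
proof
  have "indep_vars (\<lambda>j. borel) (\<lambda>j. (\<lambda>(i, j). X i j) (i, j)) {1..}"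
    using assms by (intro indep_vars_reindex[OF X_indep]) (auto simp: inj_on_def)
  then show "indep_vars (\<lambda>_. borel) (X i) {1..}" by simp
qed (use assms X_distr P_support in auto)

text \<open>At the last pull of \<open>i\<close>, made at time \<open>t\<close>, the counts
  \<open>a\<close> and \<open>b\<close> differ by at least \<open>\<epsilon> * n\<close>, yet the
  index of \<open>i\<close> was not the smaller one. By \<open>index_comparison\<close> the bonus
  advantage of \<open>j\<close> is then at most noise plus gap, which contradicts
  \<open>large\<close>.\<close>

lemma overplayed_arm:
  assumes \<omega>: "\<omega> \<in> space M" and ij: "i \<in> {1, 2}" "j \<in> {1, 2}" "i \<noteq> j"
    and dev: "\<And>i s. i \<in> {1, 2} \<Longrightarrow> s \<in> {1..n} \<Longrightarrow>
      \<bar>centered_sum (arm_mean (P i)) (\<lambda>j. X i j \<omega>) 0 s\<bar> \<le> K * sqrt (real s)"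
    and \<epsilon>: "0 < \<epsilon>" "2 \<le> \<epsilon> * real n" and \<rho>: "0 \<le> \<rho>"
    and large: "sqrt (real n) * \<bar>arm_mean (P 1) - arm_mean (P 2)\<bar> + 2 * K < \<epsilon> / 2 * sqrt (\<rho> * ln (\<epsilon> * real n))"
    and m: "m \<le> n"
  shows "real (pulls \<pi> i m \<omega>) \<le> real m / 2 + \<epsilon> * real n"
proof (rule ccontr)
  assume "\<not> ?thesis"
  then have big: "real m / 2 + \<epsilon> * real n < real (pulls \<pi> i m \<omega>)" by simp
  then have "0 < pulls \<pi> i m \<omega>" using \<epsilon> by (cases "pulls \<pi> i m \<omega> = 0") auto
  from last_pull[OF this] obtain t where t: "t \<in> {1..m}" "\<pi> t \<omega> = i"
    "pulls \<pi> i m \<omega> = Suc (pulls \<pi> i (t - 1) \<omega>)" by blast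
  define a where "a = pulls \<pi> i (t - 1) \<omega>"
  define b where "b = pulls \<pi> j (t - 1) \<omega>"
  have sum: "pulls \<pi> i l \<omega> + pulls \<pi> j l \<omega> = l" for l
    using pulls_sum[OF \<omega>, of l] ij by auto
  have "b \<le> pulls \<pi> j m \<omega>" unfolding b_def by (rule pulls_mono) (use t in auto)
  then have "real b \<le> real m - real (pulls \<pi> i m \<omega>)" using sum[of m] by linarith
  moreover have a1: "real a = real (pulls \<pi> i m \<omega>) - 1" using t(3) by (simp add: a_def)
  \<comment> \<open>The excess \<open>2 * \<epsilon> * n\<close> between the counts loses 1 because
    \<open>a\<close> is taken before the pull; \<open>2 \<le> \<epsilon> * n\<close> absorbs
    it.\<close>
  ultimately have ab: "real b \<le> real a - \<epsilon> * real n" using big \<epsilon>(2) by linarith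
  have "a + b = t - 1" using sum[of "t - 1"] by (simp add: a_def b_def)
  \<comment> \<open>So much imbalance takes time: \<open>t\<close> is past the initial plays, and
    \<open>ln (t - 1)\<close> is at least the \<open>ln (\<epsilon> * n)\<close> of
    \<open>large\<close>.\<close>
  then have at: "\<epsilon> * real n \<le> real (t - 1)" using ab by linarith
  then have t3: "3 \<le> t" using \<epsilon>(2) by linarith
  have b1: "1 \<le> b" unfolding b_def by (rule pulls_pos[OF \<omega>]) (use t3 ij in auto)
  have a2: "1 \<le> a" unfolding a_def by (rule pulls_pos[OF \<omega>]) (use t3 ij in auto)
  have an: "a \<le> n" "b \<le> n" using \<open>a + b = t - 1\<close> t m by auto
  have "ucb_index \<rho> X \<pi> t j \<omega> \<le> ucb_index \<rho> X \<pi> t i \<omega>"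
    using ucb_plays[OF t3 \<omega>] t(2) ij by (auto simp: is_arg_max_def not_less)
  then have ind: "arm_mean (P j) + centered_sum (arm_mean (P j)) (\<lambda>l. X j l \<omega>) 0 b / real b + sqrt (\<rho> * ln (real (t - 1)) / real b)
      \<le> arm_mean (P i) + centered_sum (arm_mean (P i)) (\<lambda>l. X i l \<omega>) 0 a / real a + sqrt (\<rho> * ln (real (t - 1)) / real a)"
    using a2 b1 unfolding ucb_index_def a_def[symmetric] b_def[symmetric]
      cumulative_reward_eq[of X \<pi> i _ \<omega> "arm_mean (P i)"] cumulative_reward_eq[of X \<pi> j _ \<omega> "arm_mean (P j)"]
    by (simp add: add_divide_distrib)
  have "\<epsilon> * real a \<le> \<epsilon> * real n" using an \<epsilon> by simp
  then have ba: "real b \<le> (1 - \<epsilon>) * real a" using ab by (simp add: algebra_simps)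
  have "\<epsilon> / 2 * sqrt (\<rho> * ln (real (t - 1))) \<le> sqrt (real n) * \<bar>arm_mean (P i) - arm_mean (P j)\<bar> + 2 * K"
  proof (rule index_comparison[OF _ _ ba \<epsilon>(1) _ _ _ _ ind])
    show "0 \<le> \<rho> * ln (real (t - 1))" using \<rho> t3 by simp
  qed (use a2 b1 an dev ij in auto)
  also have "\<bar>arm_mean (P i) - arm_mean (P j)\<bar> = \<bar>arm_mean (P 1) - arm_mean (P 2)\<bar>"
    using ij by auto
  also note large
  finally have "sqrt (\<rho> * ln (real (t - 1))) < sqrt (\<rho> * ln (\<epsilon> * real n))" using \<epsilon> by simp
  then have "ln (real (t - 1)) < ln (\<epsilon> * real n)" using \<rho> by (auto simp: mult_less_cancel_left)
  then show False using at \<epsilon> by (smt (verit) ln_le_cancel_iff)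
qed

text \<open>The counts add up to \<open>m\<close>, so the upper bound for one arm is the lower bound
  for the other.\<close>

lemma balanced_pulls:
  assumes \<omega>: "\<omega> \<in> space M" and i: "i \<in> {1, 2}"
    and dev: "\<And>i s. i \<in> {1, 2} \<Longrightarrow> s \<in> {1..n} \<Longrightarrow>
      \<bar>centered_sum (arm_mean (P i)) (\<lambda>j. X i j \<omega>) 0 s\<bar> \<le> K * sqrt (real s)"
    and \<epsilon>: "0 < \<epsilon>" "2 \<le> \<epsilon> * real n" and \<rho>: "0 \<le> \<rho>"
    and large: "sqrt (real n) * \<bar>arm_mean (P 1) - arm_mean (P 2)\<bar> + 2 * K < \<epsilon> / 2 * sqrt (\<rho> * ln (\<epsilon> * real n))"
    and m: "m \<le> n"
  shows "\<bar>real (pulls \<pi> i m \<omega>) - real m / 2\<bar> \<le> \<epsilon> * real n"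
proof -
  have "real (pulls \<pi> 1 m \<omega>) \<le> real m / 2 + \<epsilon> * real n"
    by (rule overplayed_arm[OF \<omega> _ _ _ dev \<epsilon> \<rho> large m, where j=2]) auto
  moreover have "real (pulls \<pi> 2 m \<omega>) \<le> real m / 2 + \<epsilon> * real n"
    by (rule overplayed_arm[OF \<omega> _ _ _ dev \<epsilon> \<rho> large m, where j=1]) auto
  moreover have "real (pulls \<pi> 1 m \<omega>) + real (pulls \<pi> 2 m \<omega>) = real m"
    using pulls_sum[OF \<omega>, of m] by linarith
  ultimately show ?thesis using i unfolding abs_le_iff by (elim insertE emptyE; simp)
qed

section \<open>Measurability of the policy and of the processes\<close>

lemma X_measurable: "i \<in> {1, 2} \<Longrightarrow> 1 \<le> j \<Longrightarrow> X i j \<in> borel_measurable M"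
  using X_indep by (auto simp: indep_vars_def)

text \<open>Assumes measurability of the plays up to \<open>m\<close> only, so that it can be used
  inside the induction of \<open>policy_measurable\<close>.\<close>

lemma pulls_measurable_aux:
  assumes "\<And>s. s \<in> {1..m} \<Longrightarrow> \<pi> s \<in> M \<rightarrow>\<^sub>M count_space {1, 2}"
  shows "(\<lambda>\<omega>. pulls \<pi> i m \<omega>) \<in> M \<rightarrow>\<^sub>M count_space UNIV"
  using assms
proof (induction m)
  case (Suc m)
  have "Measurable.pred M (\<lambda>\<omega>. \<pi> (Suc m) \<omega> = i)"
    using measurable_compose[OF Suc.prems[of "Suc m"], of "\<lambda>x. x = i" "count_space UNIV"] by simp
  moreover have "(\<lambda>\<omega>. pulls \<pi> i m \<omega>) \<in> M \<rightarrow>\<^sub>M count_space UNIV"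
    using Suc by simp
  ultimately show ?case unfolding pulls_Suc by measurable
next
  case 0
  have "pulls \<pi> i 0 = (\<lambda>_. 0)" by (simp add: fun_eq_iff)
  then show ?case by simp
qed

text \<open>Strong induction along \<open>non_anticipating\<close>: the play at \<open>t\<close> is
  a measurable function of the seed and of the history, and the history is measurable by the
  induction hypothesis. It contains rewards at random pull numbers; arms and pull numbers are
  countable, so they are substituted one after the other.\<close>

lemma policy_measurable:
  assumes "1 \<le> t" shows "\<pi> t \<in> M \<rightarrow>\<^sub>M count_space {1, 2}"
  using assms
proof (induction t rule: less_induct)
  case (less t)
  have \<pi>: "\<pi> s \<in> M \<rightarrow>\<^sub>M count_space {1, 2}" if "s \<in> {1..<t}" for s using less that by auto
  have obs: "observed_reward X \<pi> s \<in> borel_measurable M" if s: "s \<in> {1..<t}" for s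
  proof -
    have pm: "(\<lambda>\<omega>. pulls \<pi> i s \<omega>) \<in> M \<rightarrow>\<^sub>M count_space UNIV" for i
      by (rule pulls_measurable_aux) (use \<pi> s in auto)
    have "(\<lambda>\<omega>. pulls \<pi> (\<pi> s \<omega>) s \<omega>) \<in> M \<rightarrow>\<^sub>M count_space UNIV"
      by (rule measurable_compose_countable'[OF pm \<pi>[OF s]]) auto
    \<comment> \<open>The current play counts itself, so the pull number is never 0;
      \<open>X i j\<close> is known to be measurable for \<open>1 \<le> j\<close> only.\<close>
    moreover have "1 \<le> pulls \<pi> (\<pi> s \<omega>) s \<omega>" for \<omega>
      using s by (cases s) (auto simp: pulls_Suc)
    ultimately have pos: "(\<lambda>\<omega>. pulls \<pi> (\<pi> s \<omega>) s \<omega>) \<in> M \<rightarrow>\<^sub>M count_space {1..}"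
      by (subst (asm) measurable_count_space_eq2_countable)
         (auto simp: measurable_count_space_eq2_countable)
    have "(\<lambda>\<omega>. X i (pulls \<pi> (\<pi> s \<omega>) s \<omega>) \<omega>) \<in> borel_measurable M" if "i \<in> {1, 2}" for i
      by (rule measurable_compose_countable'[OF X_measurable[OF that] pos]) auto
    from measurable_compose_countable'[OF this \<pi>[OF s]]
    show ?thesis unfolding observed_reward_def by auto
  qed
  obtain g where g: "g \<in> S \<Otimes>\<^sub>M PiM {1..<t} (\<lambda>_. count_space {1, 2} \<Otimes>\<^sub>M borel) \<rightarrow>\<^sub>M count_space {1, 2}"
    "\<And>\<omega>. \<omega> \<in> space M \<Longrightarrow> \<pi> t \<omega> = g (U \<omega>, \<lambda>s\<in>{1..<t}. (\<pi> s \<omega>, observed_reward X \<pi> s \<omega>))"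
    using non_anticipating[OF less.prems] by blast
  have "(\<lambda>\<omega>. (U \<omega>, \<lambda>s\<in>{1..<t}. (\<pi> s \<omega>, observed_reward X \<pi> s \<omega>)))
      \<in> M \<rightarrow>\<^sub>M S \<Otimes>\<^sub>M PiM {1..<t} (\<lambda>_. count_space {1, 2} \<Otimes>\<^sub>M borel)"
    by (intro measurable_Pair seed_measurable measurable_restrict \<pi> obs)
  from measurable_compose[OF this g(1)] show ?case
    by (rule measurable_cong[THEN iffD1, rotated]) (simp add: g(2))
qed

lemma pulls_measurable: "(\<lambda>\<omega>. pulls \<pi> i m \<omega>) \<in> M \<rightarrow>\<^sub>M count_space UNIV"
  by (rule pulls_measurable_aux, rule policy_measurable) simp

lemma centered_reward_measurable:
  assumes "i \<in> {1, 2}" shows "centered_reward m X \<pi> i t \<in> borel_measurable M"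
proof -
  have "(\<lambda>\<omega>. \<Sum>j=1..l. X i j \<omega>) \<in> borel_measurable M" for l
    by (intro borel_measurable_sum X_measurable) (use assms in auto)
  from measurable_compose_countable[OF this pulls_measurable]
  have "(\<lambda>\<omega>. \<Sum>j=1..pulls \<pi> i t \<omega>. X i j \<omega>) \<in> borel_measurable M" .
  moreover have "(\<lambda>\<omega>. real (pulls \<pi> i t \<omega>)) \<in> borel_measurable M"
    by (rule measurable_compose[OF pulls_measurable]) simp
  ultimately show ?thesis
    unfolding centered_reward_def cumulative_reward_def by measurable
qed

text \<open>The observed rewards are regrouped by arm. The centring \<open>\<mu>\<close> is
  arbitrary here because the counts add up to \<open>m\<close>; \<open>regret_measurable\<close>
  takes it to be 0.\<close>

lemma regret_eq:
  assumes \<omega>: "\<omega> \<in> space M"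
  shows "stochastic_regret P X \<pi> m \<omega> =
    real m * (max (arm_mean (P 1)) (arm_mean (P 2)) - \<mu>)
      - centered_reward \<mu> X \<pi> 1 m \<omega> - centered_reward \<mu> X \<pi> 2 m \<omega>"
proof -
  have "(\<Sum>s=1..m. observed_reward X \<pi> s \<omega>) = cumulative_reward X \<pi> 1 m \<omega> + cumulative_reward X \<pi> 2 m \<omega>"
  proof (induction m)
    case (Suc m)
    then show ?case using policy_range[OF \<omega>, of "Suc m"]
      by (auto simp: observed_reward_def cumulative_reward_def pulls_Suc)
  qed (simp add: cumulative_reward_def)
  moreover have "real (pulls \<pi> 1 m \<omega>) + real (pulls \<pi> 2 m \<omega>) = real m"
    using pulls_sum[OF \<omega>, of m] by linarith
  then have "\<mu> * real (pulls \<pi> 1 m \<omega>) + \<mu> * real (pulls \<pi> 2 m \<omega>) = \<mu> * real m"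
    by (metis distrib_left)
  ultimately show ?thesis
    by (simp add: stochastic_regret_def sum_subtractf centered_reward_def algebra_simps)
qed

lemma regret_measurable: "stochastic_regret P X \<pi> m \<in> borel_measurable M"
proof -
  have "(\<lambda>\<omega>. real m * (max (arm_mean (P 1)) (arm_mean (P 2)) - 0)
      - centered_reward 0 X \<pi> 1 m \<omega> - centered_reward 0 X \<pi> 2 m \<omega>) \<in> borel_measurable M"
    by (intro borel_measurable_diff borel_measurable_const centered_reward_measurable) auto
  then show ?thesis by (rule measurable_cong[THEN iffD1, rotated]) (simp add: regret_eq[of _ m 0])
qed

end

section \<open>The central limit theorem for triangular arrays\<close>

context iid_unit_interval
begin

lemma integrable_X: "1 \<le> j \<Longrightarrow> integrable M (X j)"
proof (rule integrable_const_bound[of _ 1])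
  assume j: "1 \<le> j"
  show "AE \<omega> in M. norm (X j \<omega>) \<le> 1" using X_unit[OF j] by eventually_elim auto
  show "X j \<in> borel_measurable M" using j by measurable
qed

lemma mean_unit: "0 \<le> arm_mean Q" "arm_mean Q \<le> 1"
  using integral_ge_const[OF integrable_X[of 1], of 0] integral_le_const[OF integrable_X[of 1], of 1]
    X_unit[of 1] X_mean[of 1] by (auto elim!: eventually_mono)

lemma centered_le_1: "1 \<le> j \<Longrightarrow> AE \<omega> in M. \<bar>X j \<omega> - arm_mean Q\<bar> \<le> 1"
proof -
  assume "1 \<le> j"
  then show "AE \<omega> in M. \<bar>X j \<omega> - arm_mean Q\<bar> \<le> 1"
    using X_unit[of j] by (rule_tac eventually_mono) (use mean_unit in auto)
qed

text \<open>Second-order expansion. The remainder involves the law only through the bound 1 on the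
  centred reward, hence it is uniform over the laws of all horizons.\<close>

lemma char_centered:
  assumes j: "1 \<le> j"
  shows "cmod (char (distr M borel (\<lambda>\<omega>. X j \<omega> - arm_mean Q)) t - complex_of_real (1 - t\<^sup>2 * arm_variance Q / 2)) \<le> \<bar>t\<bar> ^ 3 / 6"
proof -
  let ?Y = "\<lambda>\<omega>. X j \<omega> - arm_mean Q"
  have le1: "AE \<omega> in M. \<bar>?Y \<omega>\<bar> \<le> 1" using centered_le_1[OF j] .
  have m [measurable]: "?Y \<in> borel_measurable M" using j by measurable
  have int: "integrable M ?Y" "integrable M (\<lambda>\<omega>. (?Y \<omega>)\<^sup>2)"
    using le1 by (auto intro!: integrable_const_bound[of _ 1] elim!: eventually_mono simp: abs_square_le_1)
  have 0: "expectation ?Y = 0" using integrable_X[OF j] by (simp add: X_mean[OF j] prob_space)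
  have var: "variance ?Y = arm_variance Q"
  proof -
    have "arm_variance Q = (\<integral>x. (x - arm_mean Q)\<^sup>2 \<partial>distr M borel (X j))"
      by (simp add: arm_variance_def X_distr[OF j])
    also have "\<dots> = (\<integral>\<omega>. (X j \<omega> - arm_mean Q)\<^sup>2 \<partial>M)"
      using j by (intro integral_distr) auto
    finally show ?thesis by (simp only: 0 diff_zero)
  qed
  have "cmod (char (distr M borel ?Y) t - (1 - t\<^sup>2 * arm_variance Q / 2)) \<le>
    (t\<^sup>2 / 6) * expectation (\<lambda>x. min (6 * (?Y x)\<^sup>2) (\<bar>t\<bar> * \<bar>?Y x\<bar> ^ 3))"
    by (rule char_approx3'[OF m int 0 var refl])
  also have "expectation (\<lambda>x. min (6 * (?Y x)\<^sup>2) (\<bar>t\<bar> * \<bar>?Y x\<bar> ^ 3)) \<le> \<bar>t\<bar>"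
  proof (rule integral_le_const)
    have b: "AE x in M. \<bar>t\<bar> * \<bar>?Y x\<bar> ^ 3 \<le> \<bar>t\<bar>"
      using le1 by eventually_elim (auto intro!: mult_left_le power_le_one)
    then show "AE x in M. min (6 * (?Y x)\<^sup>2) (\<bar>t\<bar> * \<bar>?Y x\<bar> ^ 3) \<le> \<bar>t\<bar>"
      by eventually_elim auto
    show "integrable M (\<lambda>x. min (6 * (?Y x)\<^sup>2) (\<bar>t\<bar> * \<bar>?Y x\<bar> ^ 3))"
      using b by (intro integrable_const_bound[of _ "\<bar>t\<bar>"]) (auto elim!: eventually_mono simp: min_def abs_le_iff)
  qed
  finally have "cmod (char (distr M borel ?Y) t - (1 - t\<^sup>2 * arm_variance Q / 2)) \<le> (t\<^sup>2 / 6) * \<bar>t\<bar>"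
    by (simp add: mult_left_mono)
  also have "(t\<^sup>2 / 6) * \<bar>t\<bar> = \<bar>t\<bar> ^ 3 / 6" by (simp add: power3_eq_cube power2_eq_square)
  finally show ?thesis by simp
qed

text \<open>Powers of two numbers in the closed unit disc differ by at most the exponent times the
  difference of the bases; \<open>small\<close> puts the second base there. With
  \<open>b - a\<close> of order \<open>n\<close> the error is of order
  \<open>1 / sqrt n\<close>.\<close>

lemma S_char:
  assumes n: "1 \<le> n" and small: "u\<^sup>2 * arm_variance Q \<le> 2 * real n"
  shows "cmod (char (distr M borel (\<lambda>\<omega>. S a b \<omega> / sqrt (real n))) u
      - complex_of_real ((1 - u\<^sup>2 * arm_variance Q / 2 / real n) ^ (b - a)))
    \<le> real (b - a) * (\<bar>u\<bar> ^ 3 / (6 * real n * sqrt (real n)))"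
proof -
  define s where "s = u / sqrt (real n)"
  define \<phi> where "\<phi> = char (distr M borel (\<lambda>\<omega>. X 1 \<omega> - arm_mean Q)) s"
  have s2: "s\<^sup>2 = u\<^sup>2 / real n" by (simp add: s_def power_divide)
  have s3: "\<bar>s\<bar> ^ 3 = \<bar>u\<bar> ^ 3 / (real n * sqrt (real n))"
    by (simp add: s_def power_divide power3_eq_cube)
  have v: "0 \<le> arm_variance Q" by (simp add: arm_variance_def)
  have "char (distr M borel (\<lambda>\<omega>. S a b \<omega> / sqrt (real n))) u = char (distr M borel (S a b)) s"
    by (simp add: char_def integral_distr s_def)
  also have "\<dots> = (\<Prod>j\<in>{a<..b}. char (distr M borel (\<lambda>\<omega>. X j \<omega> - arm_mean Q)) s)"
    unfolding centered_sum_def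
  proof (rule char_distr_sum)
    have "indep_vars (\<lambda>_. borel) X {a<..b}" by (rule indep_vars_subset[OF X_indep]) auto
    then show "indep_vars (\<lambda>_. borel) (\<lambda>j \<omega>. X j \<omega> - arm_mean Q) {a<..b}"
      by (rule indep_vars_compose2) simp
  qed
  also have "\<dots> = (\<Prod>j\<in>{a<..b}. \<phi>)"
  proof (rule prod.cong)
    fix j assume j: "j \<in> {a<..b}"
    have "distr M borel (\<lambda>\<omega>. X j \<omega> - arm_mean Q) = distr (distr M borel (X j)) borel (\<lambda>x. x - arm_mean Q)"
      using j by (subst distr_distr) (auto simp: comp_def)
    also have "distr M borel (X j) = distr M borel (X 1)" using j X_distr[of j] X_distr[of 1] by simp
    also have "distr (distr M borel (X 1)) borel (\<lambda>x. x - arm_mean Q) = distr M borel (\<lambda>\<omega>. X 1 \<omega> - arm_mean Q)"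
      by (subst distr_distr) (auto simp: comp_def)
    finally show "char (distr M borel (\<lambda>\<omega>. X j \<omega> - arm_mean Q)) s = \<phi>" by (simp add: \<phi>_def)
  qed simp
  finally have eq: "char (distr M borel (\<lambda>\<omega>. S a b \<omega> / sqrt (real n))) u = \<phi> ^ (b - a)" by simp
  interpret D: real_distribution "distr M borel (\<lambda>\<omega>. X 1 \<omega> - arm_mean Q)"
    by (rule real_distribution_distr) simp
  define w where "w = complex_of_real (1 - u\<^sup>2 * arm_variance Q / 2 / real n)"
  have "u\<^sup>2 * arm_variance Q / 2 / real n \<le> 1" using small n by (simp add: field_simps)
  moreover have "0 \<le> u\<^sup>2 * arm_variance Q / 2 / real n" using v by simp
  ultimately have w: "norm w \<le> 1" unfolding w_def norm_of_real by linarith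
  have "cmod (\<phi> ^ (b - a) - w ^ (b - a)) \<le> real (b - a) * cmod (\<phi> - w)"
    by (rule norm_power_diff[OF _ w]) (unfold \<phi>_def, rule D.cmod_char_le_1)
  also have "cmod (\<phi> - w) \<le> \<bar>s\<bar> ^ 3 / 6"
    using char_centered[of 1 s] by (simp add: \<phi>_def w_def s2 mult.commute)
  finally show ?thesis
    unfolding eq by (simp add: w_def s3 mult_left_mono mult.assoc mult.left_commute)
qed

end

text \<open>The power is written as \<open>exp\<close> of the product of \<open>L n / n\<close>,
  which tends to \<open>c\<close>, and \<open>n * ln (1 - x / n)\<close>, which tends to
  \<open>- x\<close>.\<close>

lemma power_tendsto_exp:
  fixes L :: "nat \<Rightarrow> nat"
  assumes L: "(\<lambda>n. real (L n) / real n) \<longlonglongrightarrow> c"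
  shows "(\<lambda>n. (1 - x / real n) ^ L n) \<longlonglongrightarrow> exp (- (c * x))"
proof -
  have "(\<lambda>n. 1 - x / real n) \<longlonglongrightarrow> 1 - 0"
    by (intro tendsto_diff tendsto_const lim_const_over_n)
  then have pos: "eventually (\<lambda>n. 1 - x / real n > 0) sequentially"
    by (rule order_tendstoD) simp
  have "(\<lambda>n. (1 + (- x) / real n) ^ n) \<longlonglongrightarrow> exp (- x)"
    by (rule tendsto_exp_limit_sequentially)
  then have "(\<lambda>n. ln ((1 + (- x) / real n) ^ n)) \<longlonglongrightarrow> ln (exp (- x))"
    by (rule tendsto_ln) simp
  then have "(\<lambda>n. ln ((1 - x / real n) ^ n)) \<longlonglongrightarrow> - x" by simp
  moreover have "eventually (\<lambda>n. ln ((1 - x / real n) ^ n) = real n * ln (1 - x / real n)) sequentially"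
    using pos by eventually_elim (rule ln_realpow)
  ultimately have "(\<lambda>n. real n * ln (1 - x / real n)) \<longlonglongrightarrow> - x"
    by (rule Lim_transform_eventually)
  from tendsto_exp[OF tendsto_mult[OF L this]]
  have "(\<lambda>n. exp (real (L n) / real n * (real n * ln (1 - x / real n)))) \<longlonglongrightarrow> exp (- (c * x))" by simp
  moreover have "eventually (\<lambda>n. exp (real (L n) / real n * (real n * ln (1 - x / real n))) = (1 - x / real n) ^ L n) sequentially"
    using pos eventually_gt_at_top[of 0]
  proof eventually_elim
    case (elim n)
    then have "exp (real (L n) / real n * (real n * ln (1 - x / real n))) = exp (real (L n) * ln (1 - x / real n))" by simp
    also have "\<dots> = (1 - x / real n) ^ L n" using elim by (simp add: exp_of_nat_mult)
    finally show ?case .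
  qed
  ultimately show ?thesis by (rule Lim_transform_eventually)
qed

text \<open>The limit is the characteristic function of the centred normal law with variance
  \<open>c * v\<close>. The law of the rewards may change with \<open>n\<close>, and
  \<open>v = 0\<close> is covered, since nothing is divided by the standard deviation.\<close>

lemma triangular_char_tendsto:
  fixes a b :: "nat \<Rightarrow> nat"
  assumes iid: "\<forall>\<^sub>F n in sequentially. iid_unit_interval (M n) (Q n) (X n) \<and> arm_variance (Q n) = v"
    and L: "(\<lambda>n. real (b n - a n) / real n) \<longlonglongrightarrow> c"
  shows "(\<lambda>n. char (distr (M n) borel (\<lambda>\<omega>. centered_sum (arm_mean (Q n)) (\<lambda>j. X n j \<omega>) (a n) (b n) / sqrt (real n))) u)
    \<longlonglongrightarrow> complex_of_real (exp (- (c * (u\<^sup>2 * v / 2))))"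
proof -
  have "(\<lambda>n. complex_of_real ((1 - (u\<^sup>2 * v / 2) / real n) ^ (b n - a n)))
      \<longlonglongrightarrow> complex_of_real (exp (- (c * (u\<^sup>2 * v / 2))))"
    by (intro tendsto_of_real power_tendsto_exp L)
  moreover have "(\<lambda>n. char (distr (M n) borel (\<lambda>\<omega>. centered_sum (arm_mean (Q n)) (\<lambda>j. X n j \<omega>) (a n) (b n) / sqrt (real n))) u
      - complex_of_real ((1 - (u\<^sup>2 * v / 2) / real n) ^ (b n - a n))) \<longlonglongrightarrow> 0"
  proof (rule Lim_null_comparison)
    have "eventually (\<lambda>n. u\<^sup>2 * v / 2 \<le> real n) sequentially"
      using filterlim_real_sequentially unfolding filterlim_at_top by blast
    with iid eventually_ge_at_top[of 1]
    show "\<forall>\<^sub>F n in sequentially. norm (char (distr (M n) borel (\<lambda>\<omega>. centered_sum (arm_mean (Q n)) (\<lambda>j. X n j \<omega>) (a n) (b n) / sqrt (real n))) u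
      - complex_of_real ((1 - (u\<^sup>2 * v / 2) / real n) ^ (b n - a n)))
       \<le> real (b n - a n) / real n * (\<bar>u\<bar> ^ 3 / 6 * inverse (sqrt (real n)))"
    proof eventually_elim
      case (elim n)
      then interpret iid_unit_interval "M n" "Q n" "X n" by simp
      show ?case using S_char[of n u "a n" "b n"] elim by (simp add: field_simps)
    qed
    have "(\<lambda>n. inverse (sqrt (real n))) \<longlonglongrightarrow> 0"
      by (intro tendsto_inverse_0_at_top filterlim_compose[OF sqrt_at_top filterlim_real_sequentially])
    then have "(\<lambda>n. real (b n - a n) / real n * (\<bar>u\<bar> ^ 3 / 6 * inverse (sqrt (real n)))) \<longlonglongrightarrow> c * (\<bar>u\<bar> ^ 3 / 6 * 0)"
      by (intro tendsto_mult L tendsto_const)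
    then show "(\<lambda>n. real (b n - a n) / real n * (\<bar>u\<bar> ^ 3 / 6 * inverse (sqrt (real n)))) \<longlonglongrightarrow> 0" by simp
  qed
  ultimately show ?thesis using tendsto_add by fastforce
qed

text \<open>Stated by characteristic functions because \<open>c\<close> may be 0, when the scaled
  increment has no density.\<close>

lemma (in standard_brownian_motion) increment_char:
  assumes "0 \<le> s" "s < t"
  shows "char (distr W borel (\<lambda>\<omega>. c * (B t \<omega> - B s \<omega>))) u = complex_of_real (exp (- ((t - s) * (u\<^sup>2 * c\<^sup>2 / 2))))"
proof -
  let ?Y = "\<lambda>\<omega>. (B t \<omega> - B s \<omega> - 0) / sqrt (t - s)"
  have [measurable]: "B t \<in> borel_measurable W" "B s \<in> borel_measurable W"
    using assms by (auto intro: measurable_B)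
  have st: "sqrt (t - s) > 0" using assms by simp
  have "distributed W lborel ?Y std_normal_density"
    using B_normal_increments[OF assms] unfolding normal_standard_normal_convert[OF st] .
  then have "distr W lborel ?Y = std_normal_distribution"
    by (rule distributed_distr_eq_density)
  moreover have "distr W lborel ?Y = distr W borel ?Y" by (rule distr_cong) auto
  ultimately have std: "distr W borel ?Y = std_normal_distribution" by simp
  have "char (distr W borel (\<lambda>\<omega>. c * (B t \<omega> - B s \<omega>))) u = char (distr W borel ?Y) (sqrt (t - s) * c * u)"
    using st assms by (simp add: char_def integral_distr mult.left_commute mult.commute)
  also have "\<dots> = complex_of_real (exp (- ((sqrt (t - s) * c * u)\<^sup>2) / 2))"
    unfolding std char_std_normal_distribution by simp
  also have "- ((sqrt (t - s) * c * u)\<^sup>2) / 2 = - ((t - s) * (u\<^sup>2 * c\<^sup>2 / 2))"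
    using assms by (simp add: power_mult_distrib)
  finally show ?thesis .
qed

section \<open>Convergence of independent vectors\<close>

text \<open>Skorohod's representation in each coordinate turns weak convergence of the marginals into
  pointwise convergence on a product space.\<close>

lemma PiM_weak_convergence:
  fixes \<nu> :: "nat \<Rightarrow> 'i \<Rightarrow> real measure" and f :: "('i \<Rightarrow> real) \<Rightarrow> real"
  assumes I: "finite I"
    and \<nu>: "\<And>n i. real_distribution (\<nu> n i)" and \<nu>': "\<And>i. real_distribution (\<nu>' i)"
    and weak: "\<And>i. i \<in> I \<Longrightarrow> weak_conv_m (\<lambda>n. \<nu> n i) (\<nu>' i)"
    and f: "f \<in> borel_measurable (PiM I (\<lambda>_. borel))" and B: "\<And>x. \<bar>f x\<bar> \<le> B"
    and cont: "\<And>xs x. (\<And>i. i \<in> I \<Longrightarrow> (\<lambda>n. xs n i) \<longlonglongrightarrow> x i) \<Longrightarrow> (\<lambda>n. f (xs n)) \<longlonglongrightarrow> f x"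
  shows "(\<lambda>n. \<integral>x. f x \<partial>PiM I (\<nu> n)) \<longlonglongrightarrow> (\<integral>x. f x \<partial>PiM I \<nu>')"
proof -
  have "\<exists>\<Omega> :: real measure. \<exists>Ys Y. i \<in> I \<longrightarrow> prob_space \<Omega> \<and> (\<forall>n. Ys n \<in> borel_measurable \<Omega>) \<and>
      (\<forall>n. distr \<Omega> borel (Ys n) = \<nu> n i) \<and> Y \<in> borel_measurable \<Omega> \<and> distr \<Omega> borel Y = \<nu>' i \<and>
      (\<forall>x\<in>space \<Omega>. (\<lambda>n. Ys n x) \<longlonglongrightarrow> Y x)" for i
  proof (cases "i \<in> I")
    case True
    from Skorohod[OF \<nu> \<nu>' weak[OF True]] show ?thesis by (simp add: measurable_lborel1)
  qed simp
  then obtain \<Omega> :: "'i \<Rightarrow> real measure" and Ys Y where rep0: "\<And>i. i \<in> I \<Longrightarrow> prob_space (\<Omega> i) \<and> (\<forall>n. Ys i n \<in> borel_measurable (\<Omega> i)) \<and>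
      (\<forall>n. distr (\<Omega> i) borel (Ys i n) = \<nu> n i) \<and> Y i \<in> borel_measurable (\<Omega> i) \<and> distr (\<Omega> i) borel (Y i) = \<nu>' i \<and>
      (\<forall>x\<in>space (\<Omega> i). (\<lambda>n. Ys i n x) \<longlonglongrightarrow> Y i x)" by metis
  \<comment> \<open>Skorohod's representation is chosen for \<open>i \<in> I\<close>; a point mass
    fills the other indices, as the product locale wants a probability space at every index.\<close>
  define \<Omega>' where "\<Omega>' i = (if i \<in> I then \<Omega> i else return borel 0)" for i
  interpret \<Omega>': product_prob_space \<Omega>' I
    by (rule product_prob_spaceI) (auto simp: \<Omega>'_def rep0 intro: prob_space_return)
  interpret P: prob_space "PiM I \<Omega>'" by (rule prob_space_PiM) (auto simp: \<Omega>'.M.prob_space_axioms)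
  \<comment> \<open>Coordinatewise maps carry the product measure to the product of the image laws,
    so the representing variables have the prescribed joint laws.\<close>
  have law: "distr (PiM I \<Omega>') (PiM I (\<lambda>_. borel)) (\<lambda>\<omega>. \<lambda>i\<in>I. g i (\<omega> i)) = PiM I \<kappa>"
    if g: "\<And>i. i \<in> I \<Longrightarrow> g i \<in> borel_measurable (\<Omega>' i)" "\<And>i. i \<in> I \<Longrightarrow> distr (\<Omega>' i) borel (g i) = \<kappa> i"
      and \<kappa>: "\<And>i. real_distribution (\<kappa> i)" for g :: "'i \<Rightarrow> real \<Rightarrow> real" and \<kappa>
  proof -
    interpret \<kappa>: real_distribution "\<kappa> i" for i by (rule \<kappa>)
    interpret \<kappa>p: product_prob_space \<kappa> I by (rule product_prob_spaceI) (rule \<kappa>.prob_space_axioms)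
    have gm: "(\<lambda>\<omega>. \<lambda>i\<in>I. g i (\<omega> i)) \<in> PiM I \<Omega>' \<rightarrow>\<^sub>M PiM I (\<lambda>_. borel)"
    proof (rule measurable_restrict)
      show "(\<lambda>\<omega>. g i (\<omega> i)) \<in> borel_measurable (PiM I \<Omega>')" if i: "i \<in> I" for i
        using measurable_compose[OF measurable_component_singleton[OF i, of \<Omega>'] g(1)[OF i]] .
    qed
    show ?thesis
    proof (rule \<kappa>p.PiM_eqI[OF I])
      show "sets (distr (PiM I \<Omega>') (PiM I (\<lambda>_. borel)) (\<lambda>\<omega>. \<lambda>i\<in>I. g i (\<omega> i))) = sets (PiM I \<kappa>)"
        by (simp cong: sets_PiM_cong)
      fix A assume "\<And>i. i \<in> I \<Longrightarrow> A i \<in> sets (\<kappa> i)"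
      then have A: "\<And>i. i \<in> I \<Longrightarrow> A i \<in> sets borel" by simp
      have "emeasure (distr (PiM I \<Omega>') (PiM I (\<lambda>_. borel)) (\<lambda>\<omega>. \<lambda>i\<in>I. g i (\<omega> i))) (Pi\<^sub>E I A)
          = emeasure (PiM I \<Omega>') ((\<lambda>\<omega>. \<lambda>i\<in>I. g i (\<omega> i)) -` Pi\<^sub>E I A \<inter> space (PiM I \<Omega>'))"
        using A I by (intro emeasure_distr[OF gm] sets_PiM_I_finite) auto
      also have "(\<lambda>\<omega>. \<lambda>i\<in>I. g i (\<omega> i)) -` Pi\<^sub>E I A \<inter> space (PiM I \<Omega>') = (\<Pi>\<^sub>E i\<in>I. g i -` A i \<inter> space (\<Omega>' i))"
        by (auto simp: space_PiM PiE_iff)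
      also have "emeasure (PiM I \<Omega>') \<dots> = (\<Prod>i\<in>I. emeasure (\<Omega>' i) (g i -` A i \<inter> space (\<Omega>' i)))"
        using A g(1) by (intro \<Omega>'.emeasure_PiM I measurable_sets) auto
      also have "\<dots> = (\<Prod>i\<in>I. emeasure (\<kappa> i) (A i))"
        using A g by (intro prod.cong) (auto simp: g(2)[symmetric] emeasure_distr)
      finally show "emeasure (distr (PiM I \<Omega>') (PiM I (\<lambda>_. borel)) (\<lambda>\<omega>. \<lambda>i\<in>I. g i (\<omega> i))) (Pi\<^sub>E I A)
          = (\<Prod>i\<in>I. emeasure (\<kappa> i) (A i))" .
    qed
  qed
  have expect: "(\<integral>x. f x \<partial>PiM I \<kappa>) = (\<integral>\<omega>. f (\<lambda>i\<in>I. g i (\<omega> i)) \<partial>PiM I \<Omega>')"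
    "(\<lambda>\<omega>. f (\<lambda>i\<in>I. g i (\<omega> i))) \<in> borel_measurable (PiM I \<Omega>')"
    if g: "\<And>i. i \<in> I \<Longrightarrow> g i \<in> borel_measurable (\<Omega>' i)" "\<And>i. i \<in> I \<Longrightarrow> distr (\<Omega>' i) borel (g i) = \<kappa> i"
      and \<kappa>: "\<And>i. real_distribution (\<kappa> i)" for g \<kappa>
  proof -
    have gm: "(\<lambda>\<omega>. \<lambda>i\<in>I. g i (\<omega> i)) \<in> PiM I \<Omega>' \<rightarrow>\<^sub>M PiM I (\<lambda>_. borel)"
    proof (rule measurable_restrict)
      show "(\<lambda>\<omega>. g i (\<omega> i)) \<in> borel_measurable (PiM I \<Omega>')" if i: "i \<in> I" for i
        using measurable_compose[OF measurable_component_singleton[OF i, of \<Omega>'] g(1)[OF i]] .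
    qed
    show "(\<integral>x. f x \<partial>PiM I \<kappa>) = (\<integral>\<omega>. f (\<lambda>i\<in>I. g i (\<omega> i)) \<partial>PiM I \<Omega>')"
      using integral_distr[OF gm f] by (simp only: law[OF g \<kappa>])
    show "(\<lambda>\<omega>. f (\<lambda>i\<in>I. g i (\<omega> i))) \<in> borel_measurable (PiM I \<Omega>')"
      by (rule measurable_compose[OF gm f])
  qed
  have Ys: "\<And>i. i \<in> I \<Longrightarrow> Ys i n \<in> borel_measurable (\<Omega>' i)" "\<And>i. i \<in> I \<Longrightarrow> distr (\<Omega>' i) borel (Ys i n) = \<nu> n i" for n
    using rep0 by (auto simp: \<Omega>'_def)
  have Y: "\<And>i. i \<in> I \<Longrightarrow> Y i \<in> borel_measurable (\<Omega>' i)" "\<And>i. i \<in> I \<Longrightarrow> distr (\<Omega>' i) borel (Y i) = \<nu>' i"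
    using rep0 by (auto simp: \<Omega>'_def)
  have "(\<lambda>n. \<integral>\<omega>. f (\<lambda>i\<in>I. Ys i n (\<omega> i)) \<partial>PiM I \<Omega>') \<longlonglongrightarrow> (\<integral>\<omega>. f (\<lambda>i\<in>I. Y i (\<omega> i)) \<partial>PiM I \<Omega>')"
  proof (rule integral_dominated_convergence[where w="\<lambda>_. B"])
    show "AE \<omega> in PiM I \<Omega>'. (\<lambda>n. f (\<lambda>i\<in>I. Ys i n (\<omega> i))) \<longlonglongrightarrow> f (\<lambda>i\<in>I. Y i (\<omega> i))"
    proof (rule AE_I2, rule cont)
      fix \<omega> i assume \<omega>: "\<omega> \<in> space (PiM I \<Omega>')" and i: "i \<in> I"
      then have "\<omega> i \<in> space (\<Omega> i)" by (auto simp: space_PiM PiE_iff \<Omega>'_def)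
      then show "(\<lambda>n. (\<lambda>i\<in>I. Ys i n (\<omega> i)) i) \<longlonglongrightarrow> (\<lambda>i\<in>I. Y i (\<omega> i)) i"
        using rep0[OF i] i by simp
    qed
    show "(\<lambda>\<omega>. f (\<lambda>i\<in>I. Y i (\<omega> i))) \<in> borel_measurable (PiM I \<Omega>')" by (rule expect(2)[OF Y \<nu>'])
    show "(\<lambda>\<omega>. f (\<lambda>i\<in>I. Ys i n (\<omega> i))) \<in> borel_measurable (PiM I \<Omega>')" for n by (rule expect(2)[OF Ys \<nu>])
    show "integrable (PiM I \<Omega>') (\<lambda>_. B)" by simp
    show "AE \<omega> in PiM I \<Omega>'. norm (f (\<lambda>i\<in>I. Ys i n (\<omega> i))) \<le> B" for n using B by simp
  qed
  then show ?thesis by (simp only: expect(1)[OF Ys \<nu>] expect(1)[OF Y \<nu>'])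
qed

text \<open>Levy's continuity theorem gives weak convergence coordinate by coordinate; independence
  makes both joint laws products of the marginals, and \<open>PiM_weak_convergence\<close> combines
  them.\<close>

lemma indep_vector_convergence:
  fixes A :: "nat \<Rightarrow> 'i \<Rightarrow> 'a \<Rightarrow> real" and A' :: "'i \<Rightarrow> 'w \<Rightarrow> real"
    and f :: "('i \<Rightarrow> real) \<Rightarrow> real"
  assumes I: "finite I" "I \<noteq> {}"
    and M: "\<forall>\<^sub>F n in sequentially. prob_space (M n) \<and> prob_space.indep_vars (M n) (\<lambda>_. borel) (A n) I"
    and W: "prob_space W" "prob_space.indep_vars W (\<lambda>_. borel) A' I"
    and char: "\<And>i u. i \<in> I \<Longrightarrow> (\<lambda>n. char (distr (M n) borel (A n i)) u) \<longlonglongrightarrow> char (distr W borel (A' i)) u"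
    and f: "f \<in> borel_measurable (PiM I (\<lambda>_. borel))" and B: "\<And>x. \<bar>f x\<bar> \<le> B"
    and cont: "\<And>xs x. (\<And>i. i \<in> I \<Longrightarrow> (\<lambda>n. xs n i) \<longlonglongrightarrow> x i) \<Longrightarrow> (\<lambda>n. f (xs n)) \<longlonglongrightarrow> f x"
  shows "(\<lambda>n. \<integral>\<omega>. f (\<lambda>i\<in>I. A n i \<omega>) \<partial>M n) \<longlonglongrightarrow> (\<integral>\<omega>. f (\<lambda>i\<in>I. A' i \<omega>) \<partial>W)"
proof -
  define good where "good n \<longleftrightarrow> prob_space (M n) \<and> prob_space.indep_vars (M n) (\<lambda>_. borel) (A n) I" for n
  \<comment> \<open>Skorohod's theorem asks for a distribution at every \<open>n\<close>; where the
    hypotheses fail, a point mass is substituted, which does not affect the limit.\<close>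
  define \<nu> where "\<nu> n i = (if good n \<and> i \<in> I then distr (M n) borel (A n i) else return borel 0)" for n i
  define \<nu>' where "\<nu>' i = (if i \<in> I then distr W borel (A' i) else return borel 0)" for i
  have rv: "A n i \<in> borel_measurable (M n)" if "good n" "i \<in> I" for n i
  proof -
    interpret prob_space "M n" using that by (simp add: good_def)
    show ?thesis using that by (auto simp: good_def indep_vars_def2)
  qed
  have rv': "A' i \<in> borel_measurable W" if "i \<in> I" for i
  proof -
    interpret prob_space W by fact
    show ?thesis using that W by (auto simp: indep_vars_def2)
  qed
  have ret: "real_distribution (return borel (0::real))"
    by (simp add: real_distribution_def real_distribution_axioms_def prob_space_return)
  have \<nu>: "real_distribution (\<nu> n i)" for n i
    using ret by (auto simp: \<nu>_def rv good_def[of n] intro!: prob_space.real_distribution_distr)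
  have \<nu>': "real_distribution (\<nu>' i)" for i
    using ret W(1) by (auto simp: \<nu>'_def rv' intro!: prob_space.real_distribution_distr)
  have ev: "eventually good sequentially" using M unfolding good_def[abs_def] .
  have weak: "weak_conv_m (\<lambda>n. \<nu> n i) (\<nu>' i)" if i: "i \<in> I" for i
  proof (rule levy_continuity[OF \<nu> \<nu>'])
    fix u
    have "eventually (\<lambda>n. char (distr (M n) borel (A n i)) u = char (\<nu> n i) u) sequentially"
      using ev by eventually_elim (simp add: \<nu>_def i)
    from Lim_transform_eventually[OF char[OF i] this]
    show "(\<lambda>n. char (\<nu> n i) u) \<longlonglongrightarrow> char (\<nu>' i) u" by (simp add: \<nu>'_def i)
  qed
  have eq: "(\<integral>\<omega>. f (\<lambda>i\<in>I. Z i \<omega>) \<partial>N) = (\<integral>x. f x \<partial>PiM I \<kappa>)"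
    if N: "prob_space N" "prob_space.indep_vars N (\<lambda>_. borel) Z I" "\<And>i. i \<in> I \<Longrightarrow> \<kappa> i = distr N borel (Z i)"
    for N :: "'z measure" and Z \<kappa>
  proof -
    interpret N: prob_space N by fact
    have Z: "Z i \<in> borel_measurable N" if "i \<in> I" for i using N(2) that by (auto simp: N.indep_vars_def2)
    then have gm: "(\<lambda>\<omega>. \<lambda>i\<in>I. Z i \<omega>) \<in> N \<rightarrow>\<^sub>M PiM I (\<lambda>_. borel)" by (rule measurable_restrict)
    have "PiM I \<kappa> = PiM I (\<lambda>i. distr N borel (Z i))" using N(3) by (rule PiM_cong[OF refl])
    also have "\<dots> = distr N (PiM I (\<lambda>_. borel)) (\<lambda>\<omega>. \<lambda>i\<in>I. Z i \<omega>)"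
      using N.indep_vars_iff_distr_eq_PiM'[of I Z "\<lambda>_. borel"] I N(2) Z by simp
    finally have "PiM I \<kappa> = distr N (PiM I (\<lambda>_. borel)) (\<lambda>\<omega>. \<lambda>i\<in>I. Z i \<omega>)" .
    moreover have "integral\<^sup>L (distr N (PiM I (\<lambda>_. borel)) (\<lambda>\<omega>. \<lambda>i\<in>I. Z i \<omega>)) f = (\<integral>\<omega>. f (\<lambda>i\<in>I. Z i \<omega>) \<partial>N)"
      by (rule integral_distr[OF gm f])
    ultimately show ?thesis by (simp only:)
  qed
  have limit: "(\<integral>\<omega>. f (\<lambda>i\<in>I. A' i \<omega>) \<partial>W) = (\<integral>x. f x \<partial>PiM I \<nu>')"
    by (rule eq) (use W in \<open>auto simp: \<nu>'_def\<close>)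
  have "eventually (\<lambda>n. (\<integral>x. f x \<partial>PiM I (\<nu> n)) = (\<integral>\<omega>. f (\<lambda>i\<in>I. A n i \<omega>) \<partial>M n)) sequentially"
    using ev
  proof eventually_elim
    case (elim n)
    show ?case by (rule eq[symmetric]) (use elim in \<open>auto simp: \<nu>_def good_def\<close>)
  qed
  with PiM_weak_convergence[OF I(1) \<nu> \<nu>' weak f B cont]
  have "(\<lambda>n. \<integral>\<omega>. f (\<lambda>i\<in>I. A n i \<omega>) \<partial>M n) \<longlonglongrightarrow> (\<integral>x. f x \<partial>PiM I \<nu>')"
    by (rule Lim_transform_eventually)
  then show ?thesis by (simp only: limit)
qed

section \<open>Diffusion limit of the UCB policy\<close>

text \<open>Used with \<open>y = ln n\<close>, where the linear factor bounds the number of dyadic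
  scales, and with \<open>y = k\<close>, where it bounds the number of blocks.\<close>

lemma linear_times_exp_tendsto_0:
  fixes c :: real assumes c: "c > 0"
  shows "((\<lambda>y. (2 * y + 1) * (4 * exp (- (c * y)))) \<longlongrightarrow> 0) at_top"
proof -
  have lin: "filterlim (\<lambda>y. c * y) at_top at_top"
    by (rule filterlim_tendsto_pos_mult_at_top[OF tendsto_const c filterlim_ident])
  have "((\<lambda>y. 8 / c * ((c * y) ^ 1 / exp (c * y)) + 4 * ((c * y) ^ 0 / exp (c * y))) \<longlongrightarrow> 8 / c * 0 + 4 * 0) at_top"
    by (intro tendsto_add tendsto_mult tendsto_const filterlim_compose[OF tendsto_power_div_exp_0 lin])
  moreover have "8 / c * ((c * y) ^ 1 / exp (c * y)) + 4 * ((c * y) ^ 0 / exp (c * y)) = (2 * y + 1) * (4 * exp (- (c * y)))" for y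
    using c by (simp add: exp_minus field_simps)
  ultimately show ?thesis by simp
qed

section \<open>Step paths and the deterministic grid\<close>

lemma step_path_cong: "(\<And>l. l \<le> n \<Longrightarrow> v l = w l) \<Longrightarrow> step_path n v = step_path n w"
  by (auto simp: step_path_def fun_eq_iff step_index_le)

lemma step_path_dist_le:
  fixes v w :: "nat \<Rightarrow> 'b::metric_space"
  assumes "0 \<le> e" "\<And>l. l \<le> n \<Longrightarrow> dist (v l) (w l) \<le> e"
  shows "skorohod_dist (step_path n v) (step_path n w) \<le> e"
  using assms by (intro skorohod_dist_le_sup step_path_cadlag) (auto simp: step_path_def step_index_le)

text \<open>Uniform continuity makes the step paths converge uniformly, so the identity time change
  is enough.\<close>

lemma step_path_converges:
  fixes z :: "real \<Rightarrow> 'b::metric_space"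
  assumes z: "continuous_on {0..1} z"
  shows "(\<lambda>k. skorohod_dist (step_path k (\<lambda>l. z (real l / real k))) (restrict z {0..1})) \<longlonglongrightarrow> 0"
proof (rule LIMSEQ_I)
  fix e :: real assume e: "e > 0"
  have "uniformly_continuous_on {0..1} z" by (rule compact_uniformly_continuous[OF z]) simp
  then obtain \<delta> where \<delta>: "\<delta> > 0" "\<And>s t. s \<in> {0..1} \<Longrightarrow> t \<in> {0..1} \<Longrightarrow> dist s t < \<delta> \<Longrightarrow> dist (z s) (z t) < e / 2"
    using half_gt_zero[OF e] unfolding uniformly_continuous_on_def by metis
  obtain k0 :: nat where k0: "1 / \<delta> < real k0" using reals_Archimedean2 by blast
  interpret Metric_space cadlag01 "skorohod_dist :: (real \<Rightarrow> 'b) \<Rightarrow> _" by (rule Metric_space_skorohod)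
  have "norm (skorohod_dist (step_path k (\<lambda>l. z (real l / real k))) (restrict z {0..1}) - 0) < e" if k: "k \<ge> k0" for k
  proof -
    have "0 < 1 / \<delta>" using \<delta> by simp
    then have k1: "1 / \<delta> < real k" "0 < real k" using k0 k by linarith+
    have "skorohod_dist (step_path k (\<lambda>l. z (real l / real k))) (restrict z {0..1}) \<le> e / 2"
    proof (rule skorohod_dist_le_sup[OF step_path_cadlag continuous_path_cadlag[OF z]])
      fix t :: real assume t: "t \<in> {0..1}"
      define l where "l = nat \<lfloor>real k * t\<rfloor>"
      have "0 \<le> real k * t" using t by simp
      then have l: "real l \<le> real k * t" "real k * t < real l + 1" unfolding l_def by linarith+
      have "real l / real k - t = (real l - real k * t) / real k" using k1 by (simp add: field_simps)
      then have "\<bar>real l / real k - t\<bar> = \<bar>real l - real k * t\<bar> / real k" by (simp add: abs_divide)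
      also have "\<dots> \<le> 1 / real k" using l by (intro divide_right_mono) auto
      also have "\<dots> < \<delta>" using k1 \<delta>(1) by (simp add: field_simps)
      finally have "dist (real l / real k) t < \<delta>" by (simp add: dist_real_def)
      moreover have "real l / real k \<in> {0..1}" using step_index_le[OF t, of k] k1 by (simp add: l_def)
      ultimately have "dist (z (real l / real k)) (z t) < e / 2" using \<delta>(2) t by blast
      then show "dist (step_path k (\<lambda>l. z (real l / real k)) t) (restrict z {0..1} t) \<le> e / 2"
        using t by (simp add: step_path_def l_def)
    qed (use e in simp)
    then show ?thesis using e by simp
  qed
  then show "\<exists>k0. \<forall>k\<ge>k0. norm (skorohod_dist (step_path k (\<lambda>l. z (real l / real k))) (restrict z {0..1}) - 0) < e"
    by blast
qed

lemma dist_Pair_le: "dist (a, b) (c, d) \<le> dist a c + dist b d"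
  by (simp add: dist_Pair_Pair sqrt_sum_squares_le_sum)


text \<open>The pull number that an even split would give one arm by time \<open>n * l / k\<close>,
  rounded down; hence the 2 in the denominator.\<close>

definition grid :: "nat \<Rightarrow> nat \<Rightarrow> nat \<Rightarrow> nat" where
  "grid k n l = (n * l) div (2 * k)"

lemma grid_0 [simp]: "grid k n 0 = 0" by (simp add: grid_def)

lemma grid_mono: "l \<le> l' \<Longrightarrow> grid k n l \<le> grid k n l'"
  by (simp add: grid_def div_le_mono)

lemma grid_bounds:
  assumes "k \<ge> 1"
  shows "real (grid k n l) \<le> real n * real l / (2 * real k)" "real n * real l / (2 * real k) < real (grid k n l) + 1"
proof -
  have "real (grid k n l) = of_int \<lfloor>real n * real l / (2 * real k)\<rfloor>"
    using floor_divide_of_nat_eq[of "n * l" "2 * k", where 'a=real] by (simp add: grid_def)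
  then show "real (grid k n l) \<le> real n * real l / (2 * real k)" "real n * real l / (2 * real k) < real (grid k n l) + 1"
    by linarith+
qed

text \<open>Half of the time step \<open>1 / k\<close>: this is where the factor
  \<open>1 / sqrt 2\<close> of the limit comes from. Rounding costs at most one pull.\<close>

lemma grid_length_tendsto:
  assumes k: "k \<ge> 1"
  shows "(\<lambda>n. real (grid k n (Suc j) - grid k n j) / real n) \<longlonglongrightarrow> 1 / (2 * real k)"
proof (rule LIM_zero_cancel, rule Lim_null_comparison)
  show "\<forall>\<^sub>F n in sequentially. norm (real (grid k n (Suc j) - grid k n j) / real n - 1 / (2 * real k)) \<le> 1 / real n"
    using eventually_gt_at_top[of 0]
  proof eventually_elim
    case (elim n)
    have "real (grid k n (Suc j) - grid k n j) = real (grid k n (Suc j)) - real (grid k n j)"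
      by (rule of_nat_diff) (simp add: grid_mono)
    moreover have "real n * real (Suc j) / (2 * real k) = real n * real j / (2 * real k) + real n / (2 * real k)"
      by (simp add: distrib_left add_divide_distrib)
    ultimately have "\<bar>real (grid k n (Suc j) - grid k n j) - real n / (2 * real k)\<bar> \<le> 1"
      using grid_bounds[OF k, of n j] grid_bounds[OF k, of n "Suc j"] by linarith
    moreover have "real (grid k n (Suc j) - grid k n j) / real n - 1 / (2 * real k)
        = (real (grid k n (Suc j) - grid k n j) - real n / (2 * real k)) / real n"
      using elim by (simp add: field_simps)
    ultimately show ?case using elim by (simp add: divide_right_mono)
  qed
  show "(\<lambda>n. 1 / real n) \<longlonglongrightarrow> 0" by (rule lim_const_over_n)
qed

section \<open>Independence of the increments over the grid\<close>

lemma indep_vars_two_rows: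
  fixes C :: "nat \<Rightarrow> nat \<Rightarrow> 'w \<Rightarrow> real" and H1 H2 :: "'w \<Rightarrow> 'x" and N1 N2 :: "'x measure"
  assumes W: "prob_space W" and k: "k \<ge> 1"
    and H: "prob_space.indep_var W N1 H1 N2 H2"
    and rep1: "\<And>j. j < k \<Longrightarrow> c1 j \<in> borel_measurable N1" "\<And>j \<omega>. j < k \<Longrightarrow> \<omega> \<in> space W \<Longrightarrow> C 1 j \<omega> = c1 j (H1 \<omega>)"
    and rep2: "\<And>j. j < k \<Longrightarrow> c2 j \<in> borel_measurable N2" "\<And>j \<omega>. j < k \<Longrightarrow> \<omega> \<in> space W \<Longrightarrow> C 2 j \<omega> = c2 j (H2 \<omega>)"
    and ind: "prob_space.indep_vars W (\<lambda>_. borel) (C 1) {..<k}" "prob_space.indep_vars W (\<lambda>_. borel) (C 2) {..<k}"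
  shows "prob_space.indep_vars W (\<lambda>_. borel) (\<lambda>(i, j). C i j) ({1, 2} \<times> {..<k})"
proof -
  interpret prob_space W by fact
  have rv: "C i j \<in> borel_measurable W" if "i \<in> {1, 2}" "j < k" for i j
    using ind that by (auto simp: indep_vars_def)
  have "0 \<in> {..<k}" using k by simp
  then have ne: "{..<k} \<noteq> {}" by blast
  show ?thesis
  \<comment> \<open>For finitely many variables it suffices to test products of Borel sets. Their
    probability is factored between the rows by \<open>H\<close> and then within each row by
    \<open>ind\<close>.\<close>
  proof (subst indep_vars_finite[where E="\<lambda>_. sets borel"])
    show "{1, 2} \<times> {..<k} \<noteq> {}" using ne by simp
    show "\<forall>A\<in>{1, 2} \<times> {..<k} \<rightarrow> sets borel.
       prob (\<Inter>p\<in>{1, 2} \<times> {..<k}. (case p of (i, j) \<Rightarrow> C i j) -` A p \<inter> space W) =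
       (\<Prod>p\<in>{1, 2} \<times> {..<k}. prob ((case p of (i, j) \<Rightarrow> C i j) -` A p \<inter> space W))"
    proof
      fix A :: "nat \<times> nat \<Rightarrow> real set" assume A: "A \<in> {1, 2} \<times> {..<k} \<rightarrow> sets borel"
      define E where "E i = (\<Inter>j\<in>{..<k}. C i j -` A (i, j) \<inter> space W)" for i
      \<comment> \<open>Through \<open>c1\<close> and \<open>c2\<close> the event of each row
        becomes a preimage under \<open>H1\<close> or \<open>H2\<close>, the form in which
        \<open>H\<close> can be applied.\<close>
      define F1 where "F1 = {x \<in> space N1. \<forall>j\<in>{..<k}. c1 j x \<in> A (1, j)}"
      define F2 where "F2 = {x \<in> space N2. \<forall>j\<in>{..<k}. c2 j x \<in> A (2, j)}"
      have E: "E i = {\<omega> \<in> space W. \<forall>j\<in>{..<k}. C i j \<omega> \<in> A (i, j)}" for i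
        unfolding E_def using ne by blast
      have "c1 j -` A (1, j) \<inter> space N1 \<in> sets N1" "c2 j -` A (2, j) \<inter> space N2 \<in> sets N2"
        if "j \<in> {..<k}" for j
        using A rep1(1)[of j] rep2(1)[of j] that by (auto intro!: measurable_sets[where A=borel])
      moreover have "c1 j -` A (1, j) \<inter> space N1 = {x \<in> space N1. c1 j x \<in> A (1, j)}"
        "c2 j -` A (2, j) \<inter> space N2 = {x \<in> space N2. c2 j x \<in> A (2, j)}" for j
        by auto
      ultimately have F: "F1 \<in> sets N1" "F2 \<in> sets N2"
        unfolding F1_def F2_def by (intro sets.sets_Collect_finite_All finite_lessThan; simp)+
      have rvH: "H1 \<in> W \<rightarrow>\<^sub>M N1" "H2 \<in> W \<rightarrow>\<^sub>M N2" using H by (auto dest: indep_var_rv1 indep_var_rv2)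
      have E1: "E 1 = H1 -` F1 \<inter> space W"
        using measurable_space[OF rvH(1)] by (auto simp: E F1_def rep1(2) simp del: One_nat_def)
      have E2: "E 2 = H2 -` F2 \<inter> space W"
        using measurable_space[OF rvH(2)] by (auto simp: E F2_def rep2(2))
      have "(\<Inter>p\<in>{1, 2} \<times> {..<k}. (case p of (i, j) \<Rightarrow> C i j) -` A p \<inter> space W) = (\<Inter>i\<in>{1, 2}. E i)"
        unfolding E_def by (intro set_eqI) (simp only: INT_iff split_paired_Ball_Sigma split_conv)
      also have "\<dots> = E 1 \<inter> E 2" by simp
      also have "\<dots> = (\<lambda>\<omega>. (H1 \<omega>, H2 \<omega>)) -` (F1 \<times> F2) \<inter> space W"
        unfolding E1 E2 by auto
      finally have "prob (\<Inter>p\<in>{1, 2} \<times> {..<k}. (case p of (i, j) \<Rightarrow> C i j) -` A p \<inter> space W) = prob (E 1) * prob (E 2)"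
        using indep_varD[OF H F] unfolding E1 E2 by simp
      also have "prob (E 1) = (\<Prod>j<k. prob (C 1 j -` A (1, j) \<inter> space W))"
        unfolding E_def by (rule indep_varsD_finite[OF ind(1) ne finite_lessThan]) (use A in auto)
      also have "prob (E 2) = (\<Prod>j<k. prob (C 2 j -` A (2, j) \<inter> space W))"
        unfolding E_def by (rule indep_varsD_finite[OF ind(2) ne finite_lessThan]) (use A in auto)
      also have "(\<Prod>j<k. prob (C 1 j -` A (1, j) \<inter> space W)) * (\<Prod>j<k. prob (C 2 j -` A (2, j) \<inter> space W))
          = (\<Prod>i\<in>{1, 2}. \<Prod>j<k. prob (C i j -` A (i, j) \<inter> space W))" by simp
      also have "\<dots> = (\<Prod>p\<in>{1, 2} \<times> {..<k}. prob ((case p of (i, j) \<Rightarrow> C i j) -` A p \<inter> space W))"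
        by (subst prod.cartesian_product) (auto intro!: prod.cong)
      finally show "prob (\<Inter>p\<in>{1, 2} \<times> {..<k}. (case p of (i, j) \<Rightarrow> C i j) -` A p \<inter> space W) =
         (\<Prod>p\<in>{1, 2} \<times> {..<k}. prob ((case p of (i, j) \<Rightarrow> C i j) -` A p \<inter> space W))" .
    qed
  qed (auto simp: rv sets.Int_stable sets.space_closed sets.sigma_sets_eq[of borel, simplified])
qed

lemma (in standard_brownian_motion) indep_grid_increments:
  "prob_space.indep_vars W (\<lambda>_. borel) (\<lambda>j \<omega>. c * (B (real (Suc j) / real k) \<omega> - B (real j / real k) \<omega>)) {..<k}"
proof (cases "k = 0")
  case True
  then show ?thesis by (simp add: indep_vars_def indep_sets_def)
next
  case False
  have "indep_vars (\<lambda>_. borel) (\<lambda>j \<omega>. B (real (Suc j) / real k) \<omega> - B (real j / real k) \<omega>) {..<k}"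
    by (rule B_indep_increments) (use False in \<open>auto simp: strict_mono_on_def divide_strict_right_mono\<close>)
  then show ?thesis by (rule indep_vars_compose2) simp
qed

text \<open>The two rows are measurable functions of the whole Brownian paths, which are independent
  of each other.\<close>

lemma independent_brownian_grid_increments:
  fixes B :: "nat \<Rightarrow> real \<Rightarrow> 'w \<Rightarrow> real"
  assumes ibm: "independent_brownian_motions W (B 1) (B 2)" and k: "k \<ge> 1"
  shows "prob_space.indep_vars W (\<lambda>_. borel)
     (\<lambda>(i, j) \<omega>. c i * (B i (real (Suc j) / real k) \<omega> - B i (real j / real k) \<omega>)) ({1, 2} \<times> {..<k})"
proof -
  interpret B1: standard_brownian_motion W "B 1" using ibm by (simp add: independent_brownian_motions_def)
  interpret B2: standard_brownian_motion W "B 2" using ibm by (simp add: independent_brownian_motions_def)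
  let ?N = "PiM {0..} (\<lambda>_. borel) :: (real \<Rightarrow> real) measure"
  have "B1.indep_vars (\<lambda>_. borel)
     (\<lambda>(i, j). \<lambda>\<omega>. c i * (B i (real (Suc j) / real k) \<omega> - B i (real j / real k) \<omega>)) ({1, 2} \<times> {..<k})"
  proof (rule indep_vars_two_rows[OF B1.prob_space_axioms k])
    show "B1.indep_var ?N (\<lambda>\<omega>. \<lambda>t\<in>{0..}. B 1 t \<omega>) ?N (\<lambda>\<omega>. \<lambda>t\<in>{0..}. B 2 t \<omega>)"
      using ibm by (simp add: independent_brownian_motions_def)
    show "(\<lambda>f. c 1 * (f (real (Suc j) / real k) - f (real j / real k))) \<in> borel_measurable ?N"
      "(\<lambda>f. c 2 * (f (real (Suc j) / real k) - f (real j / real k))) \<in> borel_measurable ?N" for j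
      by (intro borel_measurable_times borel_measurable_const borel_measurable_diff measurable_component_singleton; simp)+
    show "B1.indep_vars (\<lambda>_. borel) (\<lambda>j \<omega>. c 1 * (B 1 (real (Suc j) / real k) \<omega> - B 1 (real j / real k) \<omega>)) {..<k}"
      by (rule B1.indep_grid_increments)
    show "B1.indep_vars (\<lambda>_. borel) (\<lambda>j \<omega>. c 2 * (B 2 (real (Suc j) / real k) \<omega> - B 2 (real j / real k) \<omega>)) {..<k}"
      by (rule B2.indep_grid_increments)
  qed auto
  then show ?thesis by simp
qed

text \<open>The blocks are deterministic, so the sums are functions of disjoint sets of rewards and
  the policy does not enter. For blocks cut at random pull counts this independence could not be
  claimed.\<close>

lemma (in canonical_ucb) indep_block_sums:
  "indep_vars (\<lambda>_. borel)
     (\<lambda>(i, j) \<omega>. centered_sum (m i) (\<lambda>l. X i l \<omega>) (grid k n j) (grid k n (Suc j)) / c) ({1, 2} \<times> {..<k})"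
proof -
  define K where "K p = {fst p} \<times> {grid k n (snd p)<..grid k n (Suc (snd p))}" for p :: "nat \<times> nat"
  define Y where "Y p f = centered_sum (m (fst p)) (\<lambda>l. f (fst p, l)) (grid k n (snd p)) (grid k n (Suc (snd p))) / c"
    for p :: "nat \<times> nat" and f :: "nat \<times> nat \<Rightarrow> real"
  have disj: "grid k n (Suc j) \<le> grid k n j'" if "j < j'" for j j' using that by (intro grid_mono) simp
  have "indep_vars (\<lambda>p. PiM (K p) (\<lambda>_. borel)) (\<lambda>p \<omega>. restrict (\<lambda>q. (case q of (i, j) \<Rightarrow> X i j) \<omega>) (K p)) ({1, 2} \<times> {..<k})"
  proof (rule indep_vars_restrict[OF X_indep])
    show "K p \<subseteq> {1, 2} \<times> {1..}" if "p \<in> {1, 2} \<times> {..<k}" for p using that by (auto simp: K_def)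
    show "disjoint_family_on K ({1, 2} \<times> {..<k})"
      unfolding disjoint_family_on_def
    proof (intro ballI impI)
      fix p q :: "nat \<times> nat" assume "p \<noteq> q"
      then show "K p \<inter> K q = {}"
        using disj[of "snd p" "snd q"] disj[of "snd q" "snd p"]
        by (cases p, cases q) (auto simp: K_def linorder_neq_iff)
    qed
  qed
  then have "indep_vars (\<lambda>_. borel) (\<lambda>p \<omega>. Y p (restrict (\<lambda>q. (case q of (i, j) \<Rightarrow> X i j) \<omega>) (K p))) ({1, 2} \<times> {..<k})"
  proof (rule indep_vars_compose2)
    fix p :: "nat \<times> nat"
    show "Y p \<in> borel_measurable (PiM (K p) (\<lambda>_. borel))"
      unfolding Y_def centered_sum_def
      by (intro borel_measurable_divide borel_measurable_sum borel_measurable_diff borel_measurable_const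
          measurable_component_singleton) (auto simp: K_def)
  qed
  moreover have "Y p (restrict (\<lambda>q. (case q of (i, j) \<Rightarrow> X i j) \<omega>) (K p)) =
      (case p of (i, j) \<Rightarrow> \<lambda>\<omega>. centered_sum (m i) (\<lambda>l. X i l \<omega>) (grid k n j) (grid k n (Suc j)) / c) \<omega>" for p \<omega>
    by (auto simp: Y_def K_def split: prod.split intro!: centered_sum_cong arg_cong2[where f="(/)"])
  ultimately show ?thesis by simp
qed

text \<open>The Brownian motions are indexed by arm, so that arguments about one coordinate are made
  once for \<open>i \<in> {1, 2}\<close>.\<close>

locale ucb_diffusion =
  fixes \<rho> \<mu> :: real and \<theta> \<sigma> :: "nat \<Rightarrow> real"
    and M :: "nat \<Rightarrow> 'a measure" and P :: "nat \<Rightarrow> nat \<Rightarrow> real measure"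
    and X :: "nat \<Rightarrow> nat \<Rightarrow> nat \<Rightarrow> 'a \<Rightarrow> real"
    and S :: "nat \<Rightarrow> 'u measure" and U :: "nat \<Rightarrow> 'a \<Rightarrow> 'u"
    and \<pi> :: "nat \<Rightarrow> nat \<Rightarrow> 'a \<Rightarrow> nat"
    and W :: "'w measure" and B :: "nat \<Rightarrow> real \<Rightarrow> 'w \<Rightarrow> real"
  assumes \<rho>: "0 < \<rho>"
    and \<theta>: "\<And>i. i \<in> {1, 2} \<Longrightarrow> 0 \<le> \<theta> i" and \<sigma>: "\<And>i. i \<in> {1, 2} \<Longrightarrow> 0 \<le> \<sigma> i"
    and ucb: "\<forall>\<^sub>F n in sequentially. canonical_ucb (M n) (P n) (X n) \<rho> (S n) (U n) (\<pi> n)"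
    and moments: "\<forall>\<^sub>F n in sequentially. \<forall>i\<in>{1, 2}.
           arm_mean (P n i) = \<mu> + \<theta> i / sqrt (real n) \<and> arm_variance (P n i) = (\<sigma> i)\<^sup>2"
    and ibm: "independent_brownian_motions W (B 1) (B 2)"
begin

definition good :: "nat \<Rightarrow> bool" where
  "good n \<longleftrightarrow> 1 \<le> n \<and> canonical_ucb (M n) (P n) (X n) \<rho> (S n) (U n) (\<pi> n) \<and>
     (\<forall>i\<in>{1, 2}. arm_mean (P n i) = \<mu> + \<theta> i / sqrt (real n) \<and> arm_variance (P n i) = (\<sigma> i)\<^sup>2)"

lemma eventually_good: "\<forall>\<^sub>F n in sequentially. good n"
  using ucb moments eventually_ge_at_top[of 1] by eventually_elim (simp add: good_def)

lemma goodD: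
  assumes "good n"
  shows "1 \<le> n" "canonical_ucb (M n) (P n) (X n) \<rho> (S n) (U n) (\<pi> n)"
    "i \<in> {1, 2} \<Longrightarrow> arm_mean (P n i) = \<mu> + \<theta> i / sqrt (real n)"
    "i \<in> {1, 2} \<Longrightarrow> arm_variance (P n i) = (\<sigma> i)\<^sup>2"
    "prob_space (M n)" "i \<in> {1, 2} \<Longrightarrow> iid_unit_interval (M n) (P n i) (X n i)"
proof -
  show 1: "canonical_ucb (M n) (P n) (X n) \<rho> (S n) (U n) (\<pi> n)" using assms by (simp add: good_def)
  show "prob_space (M n)" using 1 by (simp add: canonical_ucb_def two_armed_bandit_def)
  show "iid_unit_interval (M n) (P n i) (X n i)" if "i \<in> {1, 2}"
    using canonical_ucb.iid_rewards[OF 1 that] .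
qed (use assms in \<open>auto simp: good_def\<close>)

section \<open>Events of high probability: balance and modulus of continuity\<close>

abbreviation T :: "nat \<Rightarrow> nat \<Rightarrow> nat \<Rightarrow> nat \<Rightarrow> 'a \<Rightarrow> real" where
  "T n i a b \<omega> \<equiv> centered_sum (arm_mean (P n i)) (\<lambda>l. X n i l \<omega>) a b"

lemma eventually_ln_ge: "\<forall>\<^sub>F n in sequentially. c \<le> ln (real n)"
  using filterlim_compose[OF ln_at_top filterlim_real_sequentially] unfolding filterlim_at_top by blast

text \<open>At this scaling the gap enters \<open>overplayed_arm\<close> as a constant, which the
  growth of \<open>sqrt (ln n)\<close> overcomes.\<close>

lemma gap_eq:
  assumes "good n" shows "sqrt (real n) * \<bar>arm_mean (P n 1) - arm_mean (P n 2)\<bar> = \<bar>\<theta> 1 - \<theta> 2\<bar>"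
proof -
  have "sqrt (real n) > 0" using goodD(1)[OF assms] by simp
  moreover have "arm_mean (P n 1) - arm_mean (P n 2) = (\<theta> 1 - \<theta> 2) / sqrt (real n)"
    using goodD(3)[OF assms, of 1] goodD(3)[OF assms, of 2] by (simp add: diff_divide_distrib)
  ultimately show ?thesis by simp
qed

text \<open>Deviations up to \<open>K * sqrt s\<close> with
  \<open>K = \<kappa> * sqrt (ln n)\<close> are tolerated. The probability of a larger one is at
  most of order \<open>ln n\<close> times a negative power of \<open>n\<close>, and on the
  complement \<open>balanced_pulls\<close> applies.\<close>

lemma asymptotically_balanced:
  assumes \<epsilon>: "0 < \<epsilon>" and e: "0 < e"
  shows "\<forall>\<^sub>F n in sequentially. \<exists>A\<in>sets (M n). measure (M n) A \<le> e \<and>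
    (\<forall>\<omega>\<in>space (M n) - A. \<forall>i\<in>{1, 2}. \<forall>m\<le>n. \<bar>real (pulls (\<pi> n) i m \<omega>) - real m / 2\<bar> \<le> \<epsilon> * real n)"
proof -
  \<comment> \<open>Chosen so that half of the bonus advantage,
    \<open>\<epsilon> / 2 * sqrt (\<rho> * ln n) / 2\<close>, equals \<open>4 * K\<close>: one
    \<open>2 * K\<close> is spent on the noise, the other dominates the gap.\<close>
  define \<kappa> where "\<kappa> = \<epsilon> * sqrt \<rho> / 16"
  have \<kappa>: "\<kappa> > 0" using \<epsilon> \<rho> by (simp add: \<kappa>_def)
  have "((\<lambda>n. (2 * ln (real n) + 1) * (4 * exp (- (\<kappa>\<^sup>2 / 4 * ln (real n))))) \<longlongrightarrow> 0) sequentially"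
    by (rule filterlim_compose[OF linear_times_exp_tendsto_0
          filterlim_compose[OF ln_at_top filterlim_real_sequentially]]) (use \<kappa> in simp)
  then have small: "\<forall>\<^sub>F n in sequentially. (2 * ln (real n) + 1) * (4 * exp (- (\<kappa>\<^sup>2 / 4 * ln (real n)))) < e / 2"
    by (rule order_tendstoD) (use e in simp)
  have "\<forall>\<^sub>F n in sequentially. 2 / \<epsilon> \<le> real n"
    using filterlim_real_sequentially unfolding filterlim_at_top by blast
  \<comment> \<open>The first threshold on \<open>ln n\<close> makes \<open>2 * K\<close> exceed the
    scaled gap, the second gives \<open>ln (\<epsilon> * n) \<ge> ln n / 4\<close>.\<close>
  with eventually_good small eventually_ln_ge[of "1 + (\<bar>\<theta> 1 - \<theta> 2\<bar> / (2 * \<kappa>))\<^sup>2"] eventually_ln_ge[of "- 4 / 3 * ln \<epsilon>"]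
  show ?thesis
  proof eventually_elim
    case (elim n)
    interpret canonical_ucb "M n" "P n" "X n" \<rho> "S n" "U n" "\<pi> n" using goodD(2)[OF elim(1)] .
    have n1: "1 \<le> n" using goodD(1)[OF elim(1)] .
    have ln1: "ln (real n) > (\<bar>\<theta> 1 - \<theta> 2\<bar> / (2 * \<kappa>))\<^sup>2" using elim(3) by linarith
    then have lnpos: "ln (real n) > 0" using zero_le_power2[of "\<bar>\<theta> 1 - \<theta> 2\<bar> / (2 * \<kappa>)"] by linarith
    define K where "K = \<kappa> * sqrt (ln (real n))"
    have K: "K > 0" using \<kappa> lnpos by (simp add: K_def)
    define A where "A i = {\<omega> \<in> space (M n). \<exists>s\<in>{1..n}. K * sqrt (real s) \<le> \<bar>T n i 0 s \<omega>\<bar>}" for i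
    have prA: "A i \<in> sets (M n) \<and> measure (M n) (A i) \<le> e / 2" if i: "i \<in> {1, 2}" for i
    proof -
      interpret iid_unit_interval "M n" "P n i" "X n i" using goodD(6)[OF elim(1) i] .
      \<comment> \<open>The number \<open>k + 1\<close> of dyadic scales is at most
        \<open>2 * ln n + 1\<close>, as \<open>ln 2 \<ge> 1 / 2\<close>.\<close>
      obtain k where k: "2 ^ k \<le> n" "n < 2 ^ (k + 1)" using ex_power_ivl1[of 2 n] n1 by auto
      have "real k * ln 2 = ln (2 ^ k)" by (simp add: ln_realpow)
      also have "\<dots> \<le> ln (real n)" using k(1) n1 by (subst ln_le_cancel_iff) simp_all
      finally have "real k * ln 2 \<le> ln (real n)" .
      moreover have "real k * (1 / 2) \<le> real k * ln 2" using ln2_ge_two_thirds by (intro mult_left_mono) auto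
      ultimately have k2: "real (k + 1) \<le> 2 * ln (real n) + 1" by simp
      have "measure (M n) (A i) \<le> real (k + 1) * (4 * exp (- (K\<^sup>2) / 4))"
        unfolding A_def by (rule S_normalised_maximum[OF K k(2)])
      also have "\<dots> \<le> (2 * ln (real n) + 1) * (4 * exp (- (K\<^sup>2) / 4))"
        using k2 by (intro mult_right_mono) auto
      also have "- (K\<^sup>2) / 4 = - (\<kappa>\<^sup>2 / 4 * ln (real n))"
        using lnpos by (simp add: K_def power_mult_distrib)
      finally have "measure (M n) (A i) \<le> e / 2" using elim(2) by simp
      moreover have "A i \<in> sets (M n)" unfolding A_def by measurable
      ultimately show ?thesis by simp
    qed
    have large: "sqrt (real n) * \<bar>arm_mean (P n 1) - arm_mean (P n 2)\<bar> + 2 * K < \<epsilon> / 2 * sqrt (\<rho> * ln (\<epsilon> * real n))"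
    proof -
      have "ln (\<epsilon> * real n) = ln \<epsilon> + ln (real n)" using \<epsilon> n1 by (simp add: ln_mult)
      then have "ln (real n) / 4 \<le> ln (\<epsilon> * real n)" using elim(4) by simp
      then have "sqrt (\<rho> * (ln (real n) / 4)) \<le> sqrt (\<rho> * ln (\<epsilon> * real n))"
        using \<rho> by (intro real_sqrt_le_mono mult_left_mono) auto
      moreover have "sqrt (\<rho> * (ln (real n) / 4)) = sqrt \<rho> * sqrt (ln (real n)) / 2"
        by (simp add: real_sqrt_mult real_sqrt_divide)
      ultimately have "sqrt \<rho> * sqrt (ln (real n)) / 2 \<le> sqrt (\<rho> * ln (\<epsilon> * real n))" by (simp only:)
      then have "\<epsilon> / 2 * (sqrt \<rho> * sqrt (ln (real n)) / 2) \<le> \<epsilon> / 2 * sqrt (\<rho> * ln (\<epsilon> * real n))"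
        by (rule mult_left_mono) (use \<epsilon> in simp)
      moreover have "\<epsilon> / 2 * (sqrt \<rho> * sqrt (ln (real n)) / 2) = 4 * K"
        by (simp add: K_def \<kappa>_def)
      moreover have "\<bar>\<theta> 1 - \<theta> 2\<bar> < 2 * K"
      proof -
        have "\<bar>\<theta> 1 - \<theta> 2\<bar> / (2 * \<kappa>) < sqrt (ln (real n))" using ln1 by (rule real_less_rsqrt)
        then show ?thesis using \<kappa> by (simp add: K_def field_simps)
      qed
      ultimately show ?thesis using gap_eq[OF elim(1)] by linarith
    qed
    show ?case
    proof (intro bexI[of _ "A 1 \<union> A 2"] conjI ballI allI impI)
      show "A 1 \<union> A 2 \<in> sets (M n)" using prA[of 1] prA[of 2] by auto
      have "measure (M n) (A 1 \<union> A 2) \<le> measure (M n) (A 1) + measure (M n) (A 2)"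
        by (rule measure_Un_le) (use prA[of 1] prA[of 2] in auto)
      then show "measure (M n) (A 1 \<union> A 2) \<le> e" using prA[of 1] prA[of 2] by simp
      fix \<omega> i m assume \<omega>: "\<omega> \<in> space (M n) - (A 1 \<union> A 2)" and i: "i \<in> {1::nat, 2}" and m: "m \<le> n"
      show "\<bar>real (pulls (\<pi> n) i m \<omega>) - real m / 2\<bar> \<le> \<epsilon> * real n"
      proof (rule balanced_pulls[OF _ i _ \<epsilon> _ _ large m])
        show "2 \<le> \<epsilon> * real n" using elim(5) \<epsilon> by (simp add: field_simps)
        fix i s assume "i \<in> {1::nat, 2}" "s \<in> {1..n}"
        then have s: "\<omega> \<notin> A i" "\<omega> \<in> space (M n)" "s \<in> {1..n}" using \<omega> by auto
        show "\<bar>T n i 0 s \<omega>\<bar> \<le> K * sqrt (real s)"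
        proof (rule ccontr)
          assume "\<not> ?thesis"
          then have "\<omega> \<in> A i" unfolding A_def by (intro CollectI conjI bexI[of _ s] s) simp
          then show False using s by simp
        qed
      qed (use \<omega> \<rho> in auto)
    qed
  qed
qed

text \<open>The bound depends on \<open>k\<close> and \<open>\<delta>\<close> alone: there are at
  most \<open>2 * k + 1\<close> blocks of length \<open>n div k\<close>, and the factor
  \<open>sqrt n\<close> in the level cancels \<open>n\<close> in the exponent. The leading 2 counts
  the arms. The bound vanishes as \<open>k\<close> grows, which dictates the order of the
  limits.\<close>

lemma asymptotic_modulus:
  assumes k: "1 \<le> k" and \<delta>: "0 < \<delta>"
  shows "\<forall>\<^sub>F n in sequentially. \<exists>A\<in>sets (M n).
    measure (M n) A \<le> 2 * ((2 * real k + 1) * (4 * exp (- (\<delta>\<^sup>2 * real k)))) \<and>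
    (\<forall>\<omega>\<in>space (M n) - A. \<forall>i\<in>{1, 2}. \<forall>p\<le>n. \<forall>q\<le>n. p \<le> q \<longrightarrow> q \<le> p + n div k \<longrightarrow> \<bar>T n i p q \<omega>\<bar> < 4 * (\<delta> * sqrt (real n)))"
  using eventually_good eventually_ge_at_top[of "2 * k"]
proof eventually_elim
  case (elim n)
  interpret prob_space "M n" using goodD(5)[OF elim(1)] .
  let ?e = "(2 * real k + 1) * (4 * exp (- (\<delta>\<^sup>2 * real k)))"
  define h where "h = n div k"
  have n1: "1 \<le> n" using goodD(1)[OF elim(1)] .
  have h: "1 \<le> h" "h * k \<le> n" "n < (h + 1) * k"
    using elim(2) k dividend_less_times_div[of k n] by (auto simp: h_def less_eq_div_iff_mult_less_eq mult.commute)
  \<comment> \<open>\<open>n div k\<close> is rounded down; since \<open>h \<ge> 1\<close>, this at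
    most doubles the number of blocks.\<close>
  have "(h + 1) * k \<le> 2 * k * h" using h(1) by (simp add: mult.commute)
  then have "n < 2 * k * h" using h(3) by linarith
  then have nh: "n div h \<le> 2 * k" using less_mult_imp_div_less[of n "2 * k" h] by simp
  define A where "A i = {\<omega> \<in> space (M n). \<exists>p\<le>n. \<exists>q\<le>n. p \<le> q \<and> q \<le> p + h \<and> 4 * (\<delta> * sqrt (real n)) \<le> \<bar>T n i p q \<omega>\<bar>}" for i
  have prA: "A i \<in> sets (M n) \<and> measure (M n) (A i) \<le> ?e" if i: "i \<in> {1, 2}" for i
  proof -
    interpret iid_unit_interval "M n" "P n i" "X n i" using goodD(6)[OF elim(1) i] .
    have "measure (M n) (A i) \<le> real (n div h + 1) * (4 * exp (- ((\<delta> * sqrt (real n))\<^sup>2) / real h))"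
      unfolding A_def by (rule S_modulus[OF h(1)]) (use \<delta> n1 in simp)
    also have "\<dots> \<le> ?e"
    proof (intro mult_mono)
      have "real h * real k \<le> real n" using h(2) by (metis of_nat_le_iff of_nat_mult)
      then have "real k \<le> real n / real h" using h(1) by (simp add: field_simps)
      then have "\<delta>\<^sup>2 * real k \<le> \<delta>\<^sup>2 * (real n / real h)" by (intro mult_left_mono) auto
      then show "exp (- ((\<delta> * sqrt (real n))\<^sup>2) / real h) \<le> exp (- (\<delta>\<^sup>2 * real k))"
        by (simp add: power_mult_distrib)
      have "real (n div h) \<le> 2 * real k" using nh by (metis of_nat_le_iff of_nat_mult of_nat_numeral)
      then show "real (n div h + 1) \<le> 2 * real k + 1" by simp
    qed auto
    finally have "measure (M n) (A i) \<le> ?e" .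
    moreover have "A i \<in> sets (M n)" unfolding A_def by measurable
    ultimately show ?thesis by simp
  qed
  show ?case
  proof (intro bexI[of _ "A 1 \<union> A 2"] conjI ballI allI impI)
    show "A 1 \<union> A 2 \<in> sets (M n)" using prA[of 1] prA[of 2] by auto
    have "measure (M n) (A 1 \<union> A 2) \<le> measure (M n) (A 1) + measure (M n) (A 2)"
      by (rule measure_Un_le) (use prA[of 1] prA[of 2] in auto)
    then show "measure (M n) (A 1 \<union> A 2) \<le> 2 * ?e" using prA[of 1] prA[of 2] by simp
    fix \<omega> i p q assume \<omega>i: "\<omega> \<in> space (M n) - (A 1 \<union> A 2)" "i \<in> {1::nat, 2}"
      and pq: "p \<le> n" "q \<le> n" "p \<le> q" "q \<le> p + n div k"
    from \<omega>i have \<omega>: "\<omega> \<notin> A i" "\<omega> \<in> space (M n)" by auto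
    show "\<bar>T n i p q \<omega>\<bar> < 4 * (\<delta> * sqrt (real n))"
    proof (rule ccontr)
      assume "\<not> ?thesis"
      then have "\<omega> \<in> A i" unfolding A_def h_def
        by (intro CollectI conjI exI[of _ p] exI[of _ q] pq \<omega>) simp
      then show False using \<omega> by simp
    qed
  qed
qed

section \<open>Coarse step paths and their limit for a fixed grid\<close>

definition reward_path :: "nat \<Rightarrow> 'a \<Rightarrow> real \<Rightarrow> real \<times> real" where
  "reward_path n \<omega> = step_path n (\<lambda>m.
     (centered_reward \<mu> (X n) (\<pi> n) 1 m \<omega> / sqrt (real n), centered_reward \<mu> (X n) (\<pi> n) 2 m \<omega> / sqrt (real n)))"

definition limit_value :: "'w \<Rightarrow> real \<Rightarrow> real \<times> real" where
  "limit_value \<omega> t = (\<theta> 1 * t / 2 + \<sigma> 1 / sqrt 2 * B 1 t \<omega>, \<theta> 2 * t / 2 + \<sigma> 2 / sqrt 2 * B 2 t \<omega>)"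

definition limit_path :: "'w \<Rightarrow> real \<Rightarrow> real \<times> real" where
  "limit_path \<omega> = restrict (limit_value \<omega>) {0..1}"

text \<open>Both processes are compared with step paths on a coarse grid, built from independent increments.\<close>

definition coarse_path :: "nat \<Rightarrow> (nat \<times> nat \<Rightarrow> real) \<Rightarrow> real \<Rightarrow> real \<times> real" where
  "coarse_path k x = step_path k (\<lambda>l.
     (\<theta> 1 * (real l / (2 * real k)) + (\<Sum>j<l. x (1, j)), \<theta> 2 * (real l / (2 * real k)) + (\<Sum>j<l. x (2, j))))"

definition reward_increment :: "nat \<Rightarrow> nat \<Rightarrow> nat \<times> nat \<Rightarrow> 'a \<Rightarrow> real" where
  "reward_increment k n = (\<lambda>(i, j) \<omega>. T n i (grid k n j) (grid k n (Suc j)) \<omega> / sqrt (real n))"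

definition limit_increment :: "nat \<Rightarrow> nat \<times> nat \<Rightarrow> 'w \<Rightarrow> real" where
  "limit_increment k = (\<lambda>(i, j) \<omega>. \<sigma> i / sqrt 2 * (B i (real (Suc j) / real k) \<omega> - B i (real j / real k) \<omega>))"

abbreviation indices :: "nat \<Rightarrow> (nat \<times> nat) set" where
  "indices k \<equiv> {1, 2} \<times> {..<k}"

lemma coarse_reward_path:
  "coarse_path k (\<lambda>p\<in>indices k. reward_increment k n p \<omega>) = step_path k (\<lambda>l.
     (\<theta> 1 * (real l / (2 * real k)) + T n 1 0 (grid k n l) \<omega> / sqrt (real n),
      \<theta> 2 * (real l / (2 * real k)) + T n 2 0 (grid k n l) \<omega> / sqrt (real n)))"
proof -
  have "(\<Sum>j<l. (\<lambda>p\<in>indices k. reward_increment k n p \<omega>) (i, j)) = T n i 0 (grid k n l) \<omega> / sqrt (real n)"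
    if "i \<in> {1, 2}" "l \<le> k" for i l
    using that(2)
  proof (induction l)
    case (Suc l)
    have "T n i 0 (grid k n (Suc l)) \<omega> = T n i 0 (grid k n l) \<omega> + T n i (grid k n l) (grid k n (Suc l)) \<omega>"
      by (rule centered_sum_split) (auto intro: grid_mono)
    then show ?case using Suc that(1) by (simp add: reward_increment_def add_divide_distrib)
  qed simp
  then show ?thesis unfolding coarse_path_def by (intro step_path_cong) simp
qed

lemma brownian: "i \<in> {1, 2} \<Longrightarrow> standard_brownian_motion W (B i)"
  using ibm by (auto simp: independent_brownian_motions_def)

lemma coarse_limit_path:
  assumes \<omega>: "\<omega> \<in> space W" and k: "1 \<le> k"
  shows "coarse_path k (\<lambda>p\<in>indices k. limit_increment k p \<omega>) = step_path k (\<lambda>l. limit_value \<omega> (real l / real k))"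
proof -
  have "(\<Sum>j<l. (\<lambda>p\<in>indices k. limit_increment k p \<omega>) (i, j)) = \<sigma> i / sqrt 2 * B i (real l / real k) \<omega>"
    if i: "i \<in> {1, 2}" and "l \<le> k" for i l
    using that(2)
  proof (induction l)
    case 0
    then show ?case using standard_brownian_motion.B_zero[OF brownian[OF i] \<omega>] by simp
  next
    case (Suc l)
    then show ?case using i by (simp add: limit_increment_def right_diff_distrib)
  qed
  then show ?thesis unfolding coarse_path_def limit_value_def by (intro step_path_cong) simp
qed

text \<open>Supplies the continuity in the increments that \<open>indep_vector_convergence\<close>
  asks of the test function.\<close>

lemma coarse_path_dist_le:
  "skorohod_dist (coarse_path k x) (coarse_path k y) \<le> (\<Sum>p\<in>indices k. \<bar>x p - y p\<bar>)"
  unfolding coarse_path_def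
proof (rule step_path_dist_le)
  fix l assume l: "l \<le> k"
  have row: "\<bar>(\<Sum>j<l. x (i, j)) - (\<Sum>j<l. y (i, j))\<bar> \<le> (\<Sum>j<k. \<bar>x (i, j) - y (i, j)\<bar>)" for i
  proof -
    have "\<bar>(\<Sum>j<l. x (i, j)) - (\<Sum>j<l. y (i, j))\<bar> \<le> (\<Sum>j<l. \<bar>x (i, j) - y (i, j)\<bar>)"
      by (simp add: sum_subtractf[symmetric] sum_abs)
    also have "\<dots> \<le> (\<Sum>j<k. \<bar>x (i, j) - y (i, j)\<bar>)" using l by (intro sum_mono2) auto
    finally show ?thesis .
  qed
  have "(\<Sum>p\<in>indices k. \<bar>x p - y p\<bar>) = (\<Sum>i\<in>{1, 2}. \<Sum>j<k. \<bar>x (i, j) - y (i, j)\<bar>)"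
    by (subst sum.cartesian_product) (auto intro!: sum.cong)
  also have "\<dots> = (\<Sum>j<k. \<bar>x (1, j) - y (1, j)\<bar>) + (\<Sum>j<k. \<bar>x (2, j) - y (2, j)\<bar>)" by simp
  finally show "dist (\<theta> 1 * (real l / (2 * real k)) + (\<Sum>j<l. x (1, j)), \<theta> 2 * (real l / (2 * real k)) + (\<Sum>j<l. x (2, j)))
     (\<theta> 1 * (real l / (2 * real k)) + (\<Sum>j<l. y (1, j)), \<theta> 2 * (real l / (2 * real k)) + (\<Sum>j<l. y (2, j)))
     \<le> (\<Sum>p\<in>indices k. \<bar>x p - y p\<bar>)"
    using row[of 1] row[of 2] by (intro order_trans[OF dist_Pair_le]) (simp add: dist_real_def)
qed (simp add: sum_nonneg)

lemma coarse_path_measurable: "coarse_path k \<in> PiM (indices k) (\<lambda>_. borel) \<rightarrow>\<^sub>M borel_of skorohod_topology"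
  unfolding coarse_path_def
proof (rule step_path_measurable)
  fix l assume l: "l \<le> k"
  have "(\<lambda>x. \<Sum>j<l. x (i, j)) \<in> borel_measurable (PiM (indices k) (\<lambda>_. borel :: real measure))" if "i \<in> {1, 2}" for i
    using l that by (intro borel_measurable_sum measurable_component_singleton) auto
  from this[of 1] this[of 2]
  show "(\<lambda>x. (\<theta> 1 * (real l / (2 * real k)) + (\<Sum>j<l. x (1, j)), \<theta> 2 * (real l / (2 * real k)) + (\<Sum>j<l. x (2, j))))
     \<in> borel_measurable (PiM (indices k) (\<lambda>_. borel))"
    by (intro borel_measurable_Pair borel_measurable_add borel_measurable_const) auto
qed

lemma coarse_path_cadlag: "coarse_path k x \<in> cadlag01"
  by (simp add: coarse_path_def step_path_cadlag)

text \<open>For fixed \<open>k\<close> only \<open>2 * k\<close> independent coordinates are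
  involved. The variances match: about \<open>n / (2 * k)\<close> rewards, divided by
  \<open>sqrt n\<close>, against the factor \<open>\<sigma> / sqrt 2\<close> on a Brownian step of
  length \<open>1 / k\<close>.\<close>

lemma coarse_convergence:
  assumes k: "1 \<le> k"
    and B: "\<And>x. x \<in> cadlag01 \<Longrightarrow> \<bar>f x\<bar> \<le> b"
    and L: "\<And>x y. x \<in> cadlag01 \<Longrightarrow> y \<in> cadlag01 \<Longrightarrow> \<bar>f x - f y\<bar> \<le> L * skorohod_dist x y"
  shows "(\<lambda>n. \<integral>\<omega>. f (coarse_path k (\<lambda>p\<in>indices k. reward_increment k n p \<omega>)) \<partial>M n) \<longlonglongrightarrow>
    (\<integral>\<omega>. f (coarse_path k (\<lambda>p\<in>indices k. limit_increment k p \<omega>)) \<partial>W)"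
proof -
  interpret D: Metric_space cadlag01 "skorohod_dist :: (real \<Rightarrow> real \<times> real) \<Rightarrow> _" by (rule Metric_space_skorohod)
  interpret B1: standard_brownian_motion W "B 1" by (rule brownian) simp
  show ?thesis
  proof (rule indep_vector_convergence[where f="\<lambda>x. f (coarse_path k x)"])
    have "(1, 0) \<in> indices k" using k by simp
    then show "indices k \<noteq> {}" by blast
    show "\<forall>\<^sub>F n in sequentially. prob_space (M n) \<and> prob_space.indep_vars (M n) (\<lambda>_. borel) (reward_increment k n) (indices k)"
      using eventually_good
    proof eventually_elim
      case (elim n)
      show ?case using goodD(5)[OF elim] canonical_ucb.indep_block_sums[OF goodD(2)[OF elim], of "\<lambda>i. arm_mean (P n i)" k n "sqrt (real n)"]
        by (simp add: reward_increment_def)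
    qed
    show "prob_space.indep_vars W (\<lambda>_. borel) (limit_increment k) (indices k)"
      using independent_brownian_grid_increments[OF ibm k, of "\<lambda>i. \<sigma> i / sqrt 2"] by (simp add: limit_increment_def)
    show "(\<lambda>n. char (distr (M n) borel (reward_increment k n p)) u) \<longlonglongrightarrow> char (distr W borel (limit_increment k p)) u"
      if p: "p \<in> indices k" for p u
    proof -
      obtain i j where ij: "p = (i, j)" "i \<in> {1, 2}" "j < k" using p by auto
      interpret Bi: standard_brownian_motion W "B i" by (rule brownian) (rule ij)
      have "\<forall>\<^sub>F n in sequentially. iid_unit_interval (M n) (P n i) (X n i) \<and> arm_variance (P n i) = (\<sigma> i)\<^sup>2"
        using eventually_good by eventually_elim (use ij goodD in auto)
      from triangular_char_tendsto[OF this grid_length_tendsto[OF k, of j], of u]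
      have "(\<lambda>n. char (distr (M n) borel (reward_increment k n p)) u) \<longlonglongrightarrow>
          complex_of_real (exp (- (1 / (2 * real k) * (u\<^sup>2 * (\<sigma> i)\<^sup>2 / 2))))"
        by (simp only: reward_increment_def ij split_conv)
      moreover have "char (distr W borel (limit_increment k p)) u =
          complex_of_real (exp (- ((real (Suc j) / real k - real j / real k) * (u\<^sup>2 * (\<sigma> i / sqrt 2)\<^sup>2 / 2))))"
        unfolding limit_increment_def ij split_conv
        by (rule Bi.increment_char) (use k in \<open>auto simp: divide_strict_right_mono\<close>)
      moreover have "real (Suc j) / real k - real j / real k = 1 / real k"
        by (simp add: diff_divide_distrib[symmetric])
      ultimately show ?thesis by (simp add: power_divide mult.commute)
    qed
    show "(\<lambda>x. f (coarse_path k x)) \<in> borel_measurable (PiM (indices k) (\<lambda>_. borel))"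
      using measurable_compose[OF coarse_path_measurable continuous_map_borel_measurable[OF D.Lipschitz_imp_continuous_map[OF L], folded skorohod_topology_def]] .
    show "\<bar>f (coarse_path k x)\<bar> \<le> b" for x by (rule B[OF coarse_path_cadlag])
    fix xs :: "nat \<Rightarrow> nat \<times> nat \<Rightarrow> real" and x
    assume lim: "\<And>p. p \<in> indices k \<Longrightarrow> (\<lambda>n. xs n p) \<longlonglongrightarrow> x p"
    have "(\<lambda>n. \<bar>L\<bar> * (\<Sum>p\<in>indices k. \<bar>xs n p - x p\<bar>)) \<longlonglongrightarrow> \<bar>L\<bar> * (\<Sum>p\<in>indices k. \<bar>x p - x p\<bar>)"
      by (intro tendsto_mult tendsto_sum tendsto_rabs tendsto_diff tendsto_const lim)
    then have "(\<lambda>n. \<bar>L\<bar> * (\<Sum>p\<in>indices k. \<bar>xs n p - x p\<bar>)) \<longlonglongrightarrow> 0" by simp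
    moreover have "norm (f (coarse_path k (xs n)) - f (coarse_path k x)) \<le> \<bar>L\<bar> * (\<Sum>p\<in>indices k. \<bar>xs n p - x p\<bar>)" for n
    proof -
      have "\<bar>f (coarse_path k (xs n)) - f (coarse_path k x)\<bar> \<le> L * skorohod_dist (coarse_path k (xs n)) (coarse_path k x)"
        by (rule L[OF coarse_path_cadlag coarse_path_cadlag])
      also have "\<dots> \<le> \<bar>L\<bar> * (\<Sum>p\<in>indices k. \<bar>xs n p - x p\<bar>)"
        by (intro mult_mono coarse_path_dist_le) auto
      finally show ?thesis by simp
    qed
    ultimately have "(\<lambda>n. f (coarse_path k (xs n)) - f (coarse_path k x)) \<longlonglongrightarrow> 0"
      by (rule Lim_null_comparison[OF always_eventually[OF allI], rotated])
    then show "(\<lambda>n. f (coarse_path k (xs n))) \<longlonglongrightarrow> f (coarse_path k x)" by (rule LIM_zero_cancel)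
  qed (use B1.prob_space_axioms in auto)
qed

text \<open>Here the random count gives way to the grid. The count \<open>N\<close> at time
  \<open>m\<close> and the grid value \<open>g\<close> differ by at most \<open>n div k\<close>, so
  the noise changes by at most the modulus and the drift by at most \<open>\<theta> i / k\<close>.
  The bound holds for each single outcome with properties \<open>bal\<close> and \<open>mod\<close>,
  so the dependence of \<open>N\<close> on the rewards is harmless.\<close>

lemma coordinate_bound:
  assumes n: "good n" "8 * k \<le> n" and k: "1 \<le> k" and \<omega>: "\<omega> \<in> space (M n)" and i: "i \<in> {1, 2}"
    and bal: "\<And>m. m \<le> n \<Longrightarrow> \<bar>real (pulls (\<pi> n) i m \<omega>) - real m / 2\<bar> \<le> 1 / (8 * real k) * real n"
    and mod: "\<And>p q. p \<le> n \<Longrightarrow> q \<le> n \<Longrightarrow> p \<le> q \<Longrightarrow> q \<le> p + n div k \<Longrightarrow> \<bar>T n i p q \<omega>\<bar> < 4 * (\<delta> * sqrt (real n))"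
    and t: "t \<in> {0..1}"
  defines "m \<equiv> nat \<lfloor>real n * t\<rfloor>" and "l \<equiv> nat \<lfloor>real k * t\<rfloor>"
  shows "\<bar>\<theta> i * (real l / (2 * real k)) + T n i 0 (grid k n l) \<omega> / sqrt (real n)
      - centered_reward \<mu> (X n) (\<pi> n) i m \<omega> / sqrt (real n)\<bar> \<le> \<theta> i / real k + 4 * \<delta>"
proof -
  define N where "N = pulls (\<pi> n) i m \<omega>"
  define g where "g = grid k n l"
  define s where "s = sqrt (real n)"
  have n0: "real n > 0" using goodD(1)[OF n(1)] by simp
  then have s: "s > 0" "s * s = real n" by (simp_all add: s_def)
  have k0: "real k > 0" using k by simp
  have "0 \<le> real n * t" "0 \<le> real k * t" using t by auto
  then have m: "real m \<le> real n * t" "real n * t < real m + 1" and l: "real l \<le> real k * t" "real k * t < real l + 1"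
    unfolding m_def l_def by linarith+
  have mn: "m \<le> n" "l \<le> k" unfolding m_def l_def by (rule step_index_le[OF t])+
  define c where "c = real n / real k"
  have "real (8 * k) \<le> real n" using n(2) by (simp only: of_nat_le_iff)
  then have c8: "8 \<le> c" using k0 by (simp add: c_def field_simps)
  have gl: "real g \<le> c * real l / 2" "c * real l / 2 < real g + 1"
    using grid_bounds[OF k, of n l] by (simp_all add: c_def g_def)
  have ct: "c * real l \<le> real n * t" "real n * t < c * real l + c"
  proof -
    have "c * (real k * t) = (c * real k) * t" by (rule mult.assoc[symmetric])
    also have "c * real k = real n" using k0 by (simp add: c_def)
    finally have eq: "c * (real k * t) = real n * t" .
    have "c * real l \<le> c * (real k * t)" "c * (real k * t) < c * (real l + 1)"
      using l c8 by (auto intro: mult_left_mono)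
    then show "c * real l \<le> real n * t" "real n * t < c * real l + c" unfolding eq by (simp_all add: distrib_left)
  qed
  have N: "\<bar>real N - real m / 2\<bar> \<le> c / 8" using bal[OF mn(1)] by (simp add: N_def c_def)
  have Nl: "\<bar>real N - c * real l / 2\<bar> \<le> c" using N ct m c8 unfolding abs_le_iff by linarith
  \<comment> \<open>Imbalance contributes \<open>c / 8\<close>, the position of \<open>t\<close>
    inside its grid cell \<open>c / 2\<close>, the roundings of \<open>m\<close> and of the grid at
    most \<open>1 / 2\<close> and 1. For \<open>c \<ge> 8\<close> the sum is at most
    \<open>c - 1\<close>, which is less than \<open>n div k\<close>.\<close>
  have Ng: "\<bar>real N - real g\<bar> \<le> c - 1" using N ct m c8 gl unfolding abs_le_iff by linarith
  have "c < real (n div k) + 1"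
  proof -
    have "n < (n div k + 1) * k" using dividend_less_times_div[of k n] k by (simp add: algebra_simps)
    then have "real n < real ((n div k + 1) * k)" by (simp only: of_nat_less_iff)
    then show ?thesis using k0 by (simp add: c_def field_simps)
  qed
  then have close: "N \<le> g + n div k" "g \<le> N + n div k" using Ng by linarith+
  have "c * real l \<le> c * real k" using mn(2) c8 by (intro mult_left_mono) auto
  moreover have "0 \<le> c * real k" using c8 by simp
  ultimately have "real g \<le> c * real k" using gl by linarith
  then have "real g \<le> real n" using k0 by (simp add: c_def)
  then have gn: "g \<le> n" by simp
  have Nn: "N \<le> n" unfolding N_def using pulls_le[of "\<pi> n" i m \<omega>] mn by linarith
  have Tb: "\<bar>T n i 0 g \<omega> - T n i 0 N \<omega>\<bar> \<le> 4 * (\<delta> * s)"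
  proof (cases "g \<le> N")
    case True
    have "T n i 0 N \<omega> = T n i 0 g \<omega> + T n i g N \<omega>" by (rule centered_sum_split) (use True in auto)
    then show ?thesis using mod[OF gn Nn True close(1)] by (simp add: s_def)
  next
    case False
    then have Ng': "N \<le> g" by simp
    have "T n i 0 g \<omega> = T n i 0 N \<omega> + T n i N g \<omega>" by (rule centered_sum_split) (use Ng' in auto)
    then show ?thesis using mod[OF Nn gn Ng' close(2)] by (simp add: s_def)
  qed
  define TN where "TN = T n i 0 N \<omega>"
  have "cumulative_reward (X n) (\<pi> n) i m \<omega> = arm_mean (P n i) * real N + TN"
    unfolding N_def TN_def by (rule cumulative_reward_eq)
  moreover have "arm_mean (P n i) = \<mu> + \<theta> i / s" unfolding s_def by (rule goodD(3)[OF n(1) i])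
  ultimately have "centered_reward \<mu> (X n) (\<pi> n) i m \<omega> = \<theta> i / s * real N + TN"
    by (simp add: centered_reward_def distrib_right flip: N_def)
  then have "centered_reward \<mu> (X n) (\<pi> n) i m \<omega> / s = \<theta> i * (real N / real n) + TN / s"
    by (simp add: add_divide_distrib flip: s(2))
  then have "\<theta> i * (real l / (2 * real k)) + T n i 0 g \<omega> / s - centered_reward \<mu> (X n) (\<pi> n) i m \<omega> / s
      = \<theta> i * (real l / (2 * real k) - real N / real n) + (T n i 0 g \<omega> - T n i 0 N \<omega>) / s"
    by (simp only: right_diff_distrib diff_divide_distrib TN_def)
  moreover have "\<bar>\<theta> i * (real l / (2 * real k) - real N / real n)\<bar> \<le> \<theta> i / real k"
  proof -
    have "real l / (2 * real k) - real N / real n = (c * real l / 2 - real N) / real n"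
      using n0 k0 by (simp add: c_def field_simps)
    then have "\<bar>real l / (2 * real k) - real N / real n\<bar> = \<bar>real N - c * real l / 2\<bar> / real n"
      by (simp add: abs_divide abs_minus_commute)
    also have "\<dots> \<le> c / real n" using Nl by (intro divide_right_mono) auto
    also have "\<dots> = 1 / real k" using n0 by (simp add: c_def)
    finally have "\<theta> i * \<bar>real l / (2 * real k) - real N / real n\<bar> \<le> \<theta> i * (1 / real k)"
      using \<theta>[OF i] by (intro mult_left_mono) auto
    then show ?thesis using \<theta>[OF i] by (simp add: abs_mult)
  qed
  moreover have "\<bar>(T n i 0 g \<omega> - T n i 0 N \<omega>) / s\<bar> \<le> 4 * \<delta>"
    using Tb s by (simp add: abs_divide field_simps)
  ultimately show ?thesis unfolding g_def[symmetric] s_def[symmetric] by linarith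
qed

text \<open>\<open>k\<close> is chosen first, to make the modulus bound and the drift error small;
  balance to within \<open>n / (8 * k)\<close> then holds for \<open>n\<close> large depending on
  that \<open>k\<close>.\<close>

lemma coarse_approximation:
  assumes e: "0 < e"
  shows "\<forall>\<^sub>F k in sequentially. \<forall>\<^sub>F n in sequentially. \<exists>A\<in>sets (M n). measure (M n) A \<le> e \<and>
    (\<forall>\<omega>\<in>space (M n) - A. skorohod_dist (coarse_path k (\<lambda>p\<in>indices k. reward_increment k n p \<omega>)) (reward_path n \<omega>) \<le> e)"
proof -
  \<comment> \<open>Each coordinate errs by at most \<open>\<theta> i / k + 4 * \<delta>\<close>,
    and both together by at most \<open>e / 2 + 8 * \<delta> = e\<close>. The probability
    \<open>e\<close> is split evenly between balance and modulus.\<close>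
  define \<delta> where "\<delta> = e / 16"
  have \<delta>: "0 < \<delta>" using e by (simp add: \<delta>_def)
  have "((\<lambda>k. (2 * real k + 1) * (4 * exp (- (\<delta>\<^sup>2 * real k)))) \<longlongrightarrow> 0) sequentially"
    by (rule filterlim_compose[OF linear_times_exp_tendsto_0 filterlim_real_sequentially]) (use \<delta> in simp)
  then have "\<forall>\<^sub>F k in sequentially. (2 * real k + 1) * (4 * exp (- (\<delta>\<^sup>2 * real k))) < e / 4"
    by (rule order_tendstoD) (use e in simp)
  moreover have "\<forall>\<^sub>F k in sequentially. 2 * (\<theta> 1 + \<theta> 2) / e \<le> real k"
    using filterlim_real_sequentially unfolding filterlim_at_top by blast
  ultimately show ?thesis using eventually_ge_at_top[of "1::nat"]
  proof eventually_elim
    case (elim k)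
    have "0 < 1 / (8 * real k)" using elim by simp
    from asymptotically_balanced[OF this half_gt_zero[OF e]] asymptotic_modulus[OF elim(3) \<delta>]
      eventually_good eventually_ge_at_top[of "8 * k"]
    show ?case
    proof eventually_elim
      case (elim n)
      note kk = \<open>2 * (\<theta> 1 + \<theta> 2) / e \<le> real k\<close> \<open>(2 * real k + 1) * (4 * exp (- (\<delta>\<^sup>2 * real k))) < e / 4\<close> \<open>1 \<le> k\<close>
      interpret prob_space "M n" using goodD(5)[OF elim(3)] .
      obtain A1 where A1: "A1 \<in> sets (M n)" "measure (M n) A1 \<le> e / 2"
        "\<And>\<omega> i m. \<omega> \<in> space (M n) - A1 \<Longrightarrow> i \<in> {1, 2} \<Longrightarrow> m \<le> n \<Longrightarrow>
           \<bar>real (pulls (\<pi> n) i m \<omega>) - real m / 2\<bar> \<le> 1 / (8 * real k) * real n"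
        using elim(1) by blast
      from elim(2) obtain A2 where A2: "A2 \<in> sets (M n)"
          "measure (M n) A2 \<le> 2 * ((2 * real k + 1) * (4 * exp (- (\<delta>\<^sup>2 * real k))))"
        and A2_all: "\<forall>\<omega>\<in>space (M n) - A2. \<forall>i\<in>{1, 2}. \<forall>p\<le>n. \<forall>q\<le>n. p \<le> q \<longrightarrow> q \<le> p + n div k \<longrightarrow>
           \<bar>T n i p q \<omega>\<bar> < 4 * (\<delta> * sqrt (real n))"
        by (elim bexE conjE)
      note A2_mod = A2_all[THEN bspec, THEN bspec, THEN spec, THEN mp, THEN spec, THEN mp, THEN mp, THEN mp]
      show ?case
      proof (intro bexI[of _ "A1 \<union> A2"] conjI ballI)
        show "A1 \<union> A2 \<in> sets (M n)" using A1 A2 by auto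
        have "measure (M n) (A1 \<union> A2) \<le> measure (M n) A1 + measure (M n) A2"
          by (rule measure_Un_le) (use A1 A2 in auto)
        then show "measure (M n) (A1 \<union> A2) \<le> e" using A1 A2 kk by linarith
        fix \<omega> assume \<omega>: "\<omega> \<in> space (M n) - (A1 \<union> A2)"
        show "skorohod_dist (coarse_path k (\<lambda>p\<in>indices k. reward_increment k n p \<omega>)) (reward_path n \<omega>) \<le> e"
          unfolding coarse_reward_path reward_path_def
        proof (rule skorohod_dist_le_sup[OF step_path_cadlag step_path_cadlag])
          fix t :: real assume t: "t \<in> {0..1}"
          define l where "l = nat \<lfloor>real k * t\<rfloor>"
          define m where "m = nat \<lfloor>real n * t\<rfloor>"
          have c: "dist (\<theta> i * (real l / (2 * real k)) + T n i 0 (grid k n l) \<omega> / sqrt (real n))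
              (centered_reward \<mu> (X n) (\<pi> n) i m \<omega> / sqrt (real n)) \<le> \<theta> i / real k + 4 * \<delta>" if i: "i \<in> {1, 2}" for i
            unfolding dist_real_def l_def m_def
            by (rule coordinate_bound[OF elim(3,4) kk(3) _ i A1(3) A2_mod t]) (use \<omega> i in auto)
          have "(\<theta> 1 + \<theta> 2) / real k \<le> e / 2" using kk e by (simp add: field_simps)
          then have "\<theta> 1 / real k + \<theta> 2 / real k \<le> e / 2" by (simp only: add_divide_distrib)
          then have "\<theta> 1 / real k + \<theta> 2 / real k + 8 * \<delta> \<le> e" unfolding \<delta>_def by linarith
          then show "dist (step_path k (\<lambda>l. (\<theta> 1 * (real l / (2 * real k)) + T n 1 0 (grid k n l) \<omega> / sqrt (real n),
               \<theta> 2 * (real l / (2 * real k)) + T n 2 0 (grid k n l) \<omega> / sqrt (real n))) t)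
             (step_path n (\<lambda>m. (centered_reward \<mu> (X n) (\<pi> n) 1 m \<omega> / sqrt (real n),
                centered_reward \<mu> (X n) (\<pi> n) 2 m \<omega> / sqrt (real n))) t) \<le> e"
            using t c[of 1] c[of 2] unfolding step_path_def
            by (simp only: restrict_apply' l_def[symmetric] m_def[symmetric])
               (rule order_trans[OF dist_Pair_le], simp)
        qed (use e in simp)
      qed
    qed
  qed
qed

section \<open>Measurability of the paths and convergence of the rewards\<close>

lemma limit_value_continuous:
  assumes \<omega>: "\<omega> \<in> space W" shows "continuous_on {0..1} (limit_value \<omega>)"
proof -
  have "continuous_on {0..1} (\<lambda>t. B i t \<omega>)" if "i \<in> {1, 2}" for i
    using standard_brownian_motion.B_continuous[OF brownian[OF that] \<omega>] by (rule continuous_on_subset) auto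
  from this[of 1] this[of 2] show ?thesis
    unfolding limit_value_def by (intro continuous_intros) auto
qed

lemma limit_path_cadlag: "\<omega> \<in> space W \<Longrightarrow> limit_path \<omega> \<in> cadlag01"
  unfolding limit_path_def by (rule continuous_path_cadlag[OF limit_value_continuous])

lemma coarse_limit_path_measurable:
  "k \<ge> 1 \<Longrightarrow> (\<lambda>\<omega>. coarse_path k (\<lambda>p\<in>indices k. limit_increment k p \<omega>)) \<in> W \<rightarrow>\<^sub>M borel_of skorohod_topology"
proof (rule measurable_compose[OF measurable_restrict coarse_path_measurable])
  fix p assume "p \<in> indices k"
  then obtain i j where p: "p = (i, j)" "i \<in> {1, 2}" by auto
  interpret standard_brownian_motion W "B i" by (rule brownian) (rule p)
  show "limit_increment k p \<in> borel_measurable W"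
    unfolding limit_increment_def p split_conv
    by (intro borel_measurable_times borel_measurable_diff borel_measurable_const measurable_B) auto
qed

lemma coarse_limit_path_tendsto:
  assumes "\<omega> \<in> space W"
  shows "(\<lambda>k. skorohod_dist (coarse_path k (\<lambda>p\<in>indices k. limit_increment k p \<omega>)) (limit_path \<omega>)) \<longlonglongrightarrow> 0"
proof (rule Lim_transform_eventually[OF step_path_converges[OF limit_value_continuous[OF assms]]])
  show "\<forall>\<^sub>F k in sequentially. skorohod_dist (step_path k (\<lambda>l. limit_value \<omega> (real l / real k))) (restrict (limit_value \<omega>) {0..1})
      = skorohod_dist (coarse_path k (\<lambda>p\<in>indices k. limit_increment k p \<omega>)) (limit_path \<omega>)"
    using eventually_ge_at_top[of 1]
    by eventually_elim (simp only: coarse_limit_path[OF assms] limit_path_def)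
qed

text \<open>A pointwise Skorohod limit of step paths built from finitely many Brownian values;
  \<open>Suc k\<close> skips the degenerate grid \<open>k = 0\<close>.\<close>

lemma limit_path_measurable: "limit_path \<in> W \<rightarrow>\<^sub>M borel_of skorohod_topology"
  unfolding skorohod_topology_def
proof (rule Metric_space.measurable_limit[OF Metric_space_skorohod])
  show "(\<lambda>\<omega>. coarse_path (Suc k) (\<lambda>p\<in>indices (Suc k). limit_increment (Suc k) p \<omega>))
      \<in> W \<rightarrow>\<^sub>M borel_of (Metric_space.mtopology cadlag01 skorohod_dist)" for k
    using coarse_limit_path_measurable[of "Suc k"] by (simp add: skorohod_topology_def)
  show "(\<lambda>k. skorohod_dist (coarse_path (Suc k) (\<lambda>p\<in>indices (Suc k). limit_increment (Suc k) p \<omega>)) (limit_path \<omega>)) \<longlonglongrightarrow> 0"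
    if "\<omega> \<in> space W" for \<omega> by (rule LIMSEQ_Suc[OF coarse_limit_path_tendsto[OF that]])
qed (rule limit_path_cadlag)

lemma reward_path_measurable:
  assumes "good n" shows "reward_path n \<in> M n \<rightarrow>\<^sub>M borel_of skorohod_topology"
  unfolding reward_path_def
proof (rule step_path_measurable)
  interpret canonical_ucb "M n" "P n" "X n" \<rho> "S n" "U n" "\<pi> n" using goodD(2)[OF assms] .
  show "(\<lambda>\<omega>. (centered_reward \<mu> (X n) (\<pi> n) 1 m \<omega> / sqrt (real n), centered_reward \<mu> (X n) (\<pi> n) 2 m \<omega> / sqrt (real n)))
      \<in> borel_measurable (M n)" for m
    by (intro borel_measurable_Pair borel_measurable_divide borel_measurable_const centered_reward_measurable) auto
qed

lemma coarse_reward_path_measurable: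
  assumes "good n"
  shows "(\<lambda>\<omega>. coarse_path k (\<lambda>p\<in>indices k. reward_increment k n p \<omega>)) \<in> M n \<rightarrow>\<^sub>M borel_of skorohod_topology"
proof (rule measurable_compose[OF measurable_restrict coarse_path_measurable])
  fix p assume "p \<in> indices k"
  then obtain i j where p: "p = (i, j)" "i \<in> {1, 2}" by auto
  interpret iid_unit_interval "M n" "P n i" "X n i" using goodD(6)[OF assms p(2)] .
  show "reward_increment k n p \<in> borel_measurable (M n)"
    unfolding reward_increment_def p split_conv by measurable
qed

lemma reward_convergence: "converges_weakly skorohod_topology M reward_path W limit_path"
proof (rule Metric_space.converges_weakly_approximation[OF Metric_space_skorohod, folded skorohod_topology_def])
  show "\<forall>\<^sub>F n in sequentially. prob_space (M n) \<and> reward_path n \<in> M n \<rightarrow>\<^sub>M borel_of skorohod_topology"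
    using eventually_good by eventually_elim (simp add: goodD reward_path_measurable)
  interpret B1: standard_brownian_motion W "B 1" by (rule brownian) simp
  show "prob_space W" by (rule B1.prob_space_axioms)
  show "\<forall>\<^sub>F n in sequentially. (\<lambda>\<omega>. coarse_path k (\<lambda>p\<in>indices k. reward_increment k n p \<omega>)) \<in> M n \<rightarrow>\<^sub>M borel_of skorohod_topology" for k
    using eventually_good by eventually_elim (rule coarse_reward_path_measurable)
  show "limit_path \<in> W \<rightarrow>\<^sub>M borel_of skorohod_topology" by (rule limit_path_measurable)
  show "(\<lambda>\<omega>. coarse_path k (\<lambda>p\<in>indices k. limit_increment k p \<omega>)) \<in> W \<rightarrow>\<^sub>M borel_of skorohod_topology"
    if "1 \<le> k" for k by (rule coarse_limit_path_measurable[OF that])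
  show "(\<lambda>k. skorohod_dist (coarse_path k (\<lambda>p\<in>indices k. limit_increment k p \<omega>)) (limit_path \<omega>)) \<longlonglongrightarrow> 0"
    if "\<omega> \<in> space W" for \<omega> by (rule coarse_limit_path_tendsto[OF that])
qed (rule coarse_convergence coarse_approximation; assumption)+

end

section \<open>The regret as a continuous image of the reward pair\<close>

definition drift_minus_sum :: "real \<Rightarrow> (real \<Rightarrow> real \<times> real) \<Rightarrow> real \<Rightarrow> real" where
  "drift_minus_sum c x = (\<lambda>t\<in>{0..1}. c * t - fst (x t) - snd (x t))"

lemma drift_minus_sum_cadlag:
  assumes x: "x \<in> cadlag01" shows "drift_minus_sum c x \<in> cadlag01"
proof -
  have "(drift_minus_sum c x \<longlongrightarrow> drift_minus_sum c x t) (at_right t)" if t: "t \<in> {0..<1}" for t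
  proof -
    have "(x \<longlongrightarrow> x t) (at_right t)" using x t by (auto simp: cadlag01_def)
    then have "((\<lambda>s. c * s - fst (x s) - snd (x s)) \<longlongrightarrow> c * t - fst (x t) - snd (x t)) (at_right t)"
      by (intro tendsto_intros)
    moreover have "eventually (\<lambda>s. c * s - fst (x s) - snd (x s) = drift_minus_sum c x s) (at_right t)"
      using t by (auto simp: eventually_at_right_field drift_minus_sum_def intro!: exI[of _ 1])
    ultimately have "(drift_minus_sum c x \<longlongrightarrow> c * t - fst (x t) - snd (x t)) (at_right t)"
      by (rule Lim_transform_eventually)
    then show ?thesis using t by (simp add: drift_minus_sum_def)
  qed
  moreover have "\<exists>r. (drift_minus_sum c x \<longlongrightarrow> r) (at_left t)" if t: "t \<in> {0<..1}" for t
  proof -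
    obtain l where "(x \<longlongrightarrow> l) (at_left t)" using x t unfolding cadlag01_def by blast
    then have "((\<lambda>s. c * s - fst (x s) - snd (x s)) \<longlongrightarrow> c * t - fst l - snd l) (at_left t)"
      by (intro tendsto_intros)
    moreover have "eventually (\<lambda>s. c * s - fst (x s) - snd (x s) = drift_minus_sum c x s) (at_left t)"
      using t by (auto simp: eventually_at_left_field drift_minus_sum_def intro!: exI[of _ 0])
    ultimately have "(drift_minus_sum c x \<longlongrightarrow> c * t - fst l - snd l) (at_left t)"
      by (rule Lim_transform_eventually)
    then show ?thesis by blast
  qed
  ultimately show ?thesis unfolding cadlag01_def by (auto simp: drift_minus_sum_def)
qed

text \<open>Addition of paths is not continuous when each summand has its own time change. Here one
  time change serves both coordinates of the vector-valued path, so each coordinate contributes 1 to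
  the constant, and the drift, which moves by at most \<open>c * e\<close>, contributes
  \<open>c\<close>.\<close>

lemma drift_minus_sum_Lipschitz:
  assumes c: "0 \<le> c" and x: "x \<in> cadlag01" and y: "y \<in> cadlag01"
  shows "skorohod_dist (drift_minus_sum c x) (drift_minus_sum c y) \<le> (c + 2) * skorohod_dist x y"
proof -
  have close: "skorohod_close (drift_minus_sum c x) (drift_minus_sum c y) ((c + 2) * e)"
    if e: "skorohod_close x y e" for e
  proof -
    obtain \<tau> where \<tau>: "\<tau> \<in> time_changes" "\<And>t. t \<in> {0..1} \<Longrightarrow> \<bar>\<tau> t - t\<bar> \<le> e"
      "\<And>t. t \<in> {0..1} \<Longrightarrow> dist (x t) (y (\<tau> t)) \<le> e" and e0: "0 \<le> e"
      using e unfolding skorohod_close_def by blast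
    have "\<bar>\<tau> t - t\<bar> \<le> (c + 2) * e \<and> dist (drift_minus_sum c x t) (drift_minus_sum c y (\<tau> t)) \<le> (c + 2) * e"
      if t: "t \<in> {0..1}" for t
    proof
      have "e \<le> (c + 2) * e" using mult_right_mono[of 1 "c + 2" e] c e0 by simp
      then show "\<bar>\<tau> t - t\<bar> \<le> (c + 2) * e" using \<tau>(2)[OF t] by linarith
      have "\<bar>c * (t - \<tau> t)\<bar> \<le> c * e"
        using c \<tau>(2)[OF t] by (simp add: abs_mult abs_minus_commute mult_left_mono)
      moreover have "dist (fst (x t)) (fst (y (\<tau> t))) \<le> e" "dist (snd (x t)) (snd (y (\<tau> t))) \<le> e"
        using dist_fst_le[of "x t" "y (\<tau> t)"] dist_snd_le[of "x t" "y (\<tau> t)"] \<tau>(3)[OF t] by linarith+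
      moreover have "drift_minus_sum c x t - drift_minus_sum c y (\<tau> t) =
          c * (t - \<tau> t) - (fst (x t) - fst (y (\<tau> t))) - (snd (x t) - snd (y (\<tau> t)))"
        using t time_changes_range[OF \<tau>(1) t] by (simp add: drift_minus_sum_def right_diff_distrib)
      moreover have "(c + 2) * e = c * e + 2 * e" by (rule distrib_right)
      ultimately show "dist (drift_minus_sum c x t) (drift_minus_sum c y (\<tau> t)) \<le> (c + 2) * e"
        unfolding dist_real_def by linarith
    qed
    then show ?thesis using \<tau>(1) c e0 unfolding skorohod_close_def by (intro conjI bexI[of _ \<tau>] ballI) auto
  qed
  show ?thesis
  proof (rule field_le_epsilon)
    fix r :: real assume r: "0 < r"
    have "skorohod_dist x y < skorohod_dist x y + r / (c + 2)" using r c by simp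
    then obtain e where e: "e < skorohod_dist x y + r / (c + 2)" "skorohod_close x y e"
      using skorohod_dist_lessD[OF x y] by blast
    have "skorohod_dist (drift_minus_sum c x) (drift_minus_sum c y) \<le> (c + 2) * e"
      by (rule skorohod_dist_le[OF drift_minus_sum_cadlag[OF x] drift_minus_sum_cadlag[OF y] close[OF e(2)]])
    also have "\<dots> \<le> (c + 2) * (skorohod_dist x y + r / (c + 2))" using e(1) c by (intro mult_left_mono) auto
    also have "\<dots> = (c + 2) * skorohod_dist x y + r" using c by (simp add: distrib_left)
    finally show "skorohod_dist (drift_minus_sum c x) (drift_minus_sum c y) \<le> (c + 2) * skorohod_dist x y + r" .
  qed
qed

lemma drift_minus_sum_continuous:
  assumes c: "0 \<le> c" shows "continuous_map skorohod_topology skorohod_topology (drift_minus_sum c)"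
proof -
  interpret D1: Metric_space cadlag01 "skorohod_dist :: (real \<Rightarrow> real) \<Rightarrow> _" by (rule Metric_space_skorohod)
  interpret D2: Metric_space cadlag01 "skorohod_dist :: (real \<Rightarrow> real \<times> real) \<Rightarrow> _" by (rule Metric_space_skorohod)
  have "\<exists>\<delta>>0. \<forall>y. y \<in> cadlag01 \<and> skorohod_dist x y < \<delta> \<longrightarrow> skorohod_dist (drift_minus_sum c x) (drift_minus_sum c y) < e"
    if x: "x \<in> cadlag01" and e: "0 < e" for x e
  proof (intro exI[of _ "e / (c + 2)"] conjI allI impI)
    fix y assume y: "y \<in> cadlag01 \<and> skorohod_dist x y < e / (c + 2)"
    have "skorohod_dist (drift_minus_sum c x) (drift_minus_sum c y) \<le> (c + 2) * skorohod_dist x y"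
      using drift_minus_sum_Lipschitz[OF c x] y by blast
    also have "\<dots> < e" using y c by (simp add: field_simps)
    finally show "skorohod_dist (drift_minus_sum c x) (drift_minus_sum c y) < e" .
  qed (use c e in simp)
  then show ?thesis
    unfolding skorohod_topology_def D2.metric_continuous_map[OF D1.Metric_space_axioms]
    using drift_minus_sum_cadlag by blast
qed

context ucb_diffusion
begin

definition regret_path :: "nat \<Rightarrow> 'a \<Rightarrow> real \<Rightarrow> real" where
  "regret_path n \<omega> = step_path n (\<lambda>m. stochastic_regret (P n) (X n) (\<pi> n) m \<omega> / sqrt (real n))"

text \<open>The better mean is \<open>\<mu> + drift / sqrt n\<close>, so this is the slope of the
  rescaled benchmark after centring.\<close>

definition drift :: real where "drift = max (\<theta> 1) (\<theta> 2)"

lemma drift_nonneg: "0 \<le> drift"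
  using \<theta>[of 1] by (simp add: drift_def)

lemma regret_path_measurable:
  assumes "good n" shows "regret_path n \<in> M n \<rightarrow>\<^sub>M borel_of skorohod_topology"
  unfolding regret_path_def
proof (rule step_path_measurable)
  interpret canonical_ucb "M n" "P n" "X n" \<rho> "S n" "U n" "\<pi> n" using goodD(2)[OF assms] .
  show "(\<lambda>\<omega>. stochastic_regret (P n) (X n) (\<pi> n) m \<omega> / sqrt (real n)) \<in> borel_measurable (M n)" for m
    by (intro borel_measurable_divide borel_measurable_const regret_measurable)
qed

text \<open>By \<open>regret_eq\<close> the two paths differ only in the drift term, taken at
  \<open>m / n\<close> with \<open>m\<close> the integer part of \<open>n * t\<close> in one and at
  \<open>t\<close> in the other.\<close>

lemma regret_path_close:
  assumes n: "good n" and \<omega>: "\<omega> \<in> space (M n)"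
  shows "skorohod_dist (regret_path n \<omega>) (drift_minus_sum drift (reward_path n \<omega>)) \<le> drift / real n"
  unfolding regret_path_def
proof (rule skorohod_dist_le_sup)
  interpret canonical_ucb "M n" "P n" "X n" \<rho> "S n" "U n" "\<pi> n" using goodD(2)[OF n] .
  show "drift_minus_sum drift (reward_path n \<omega>) \<in> cadlag01"
    by (rule drift_minus_sum_cadlag) (simp add: reward_path_def step_path_cadlag)
  show "0 \<le> drift / real n" using drift_nonneg by simp
  fix t :: real assume t: "t \<in> {0..1}"
  define m where "m = nat \<lfloor>real n * t\<rfloor>"
  define r where "r i = centered_reward \<mu> (X n) (\<pi> n) i m \<omega>" for i
  have n0: "real n > 0" using goodD(1)[OF n] by simp
  have "0 \<le> real n * t" using t by auto
  then have m: "real m \<le> real n * t" "real n * t < real m + 1" unfolding m_def by linarith+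
  have sn: "0 < sqrt (real n)" "sqrt (real n) * sqrt (real n) = real n" using n0 by simp_all
  have "max (arm_mean (P n 1)) (arm_mean (P n 2)) - \<mu> = drift / sqrt (real n)"
    using sn(1) goodD(3)[OF n, of 1] goodD(3)[OF n, of 2]
    by (auto simp: drift_def max_def divide_right_mono divide_le_cancel)
  then have "stochastic_regret (P n) (X n) (\<pi> n) m \<omega> = real m * (drift / sqrt (real n)) - r 1 - r 2"
    using regret_eq[OF \<omega>, of m \<mu>] by (simp only: r_def)
  then have "stochastic_regret (P n) (X n) (\<pi> n) m \<omega> / sqrt (real n)
      = drift * (real m / real n) - r 1 / sqrt (real n) - r 2 / sqrt (real n)"
    using sn(2) by (simp add: diff_divide_distrib mult.commute)
  moreover have "drift_minus_sum drift (reward_path n \<omega>) t = drift * t - r 1 / sqrt (real n) - r 2 / sqrt (real n)"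
    using t by (simp add: drift_minus_sum_def reward_path_def step_path_def r_def m_def)
  moreover have "step_path n (\<lambda>m. stochastic_regret (P n) (X n) (\<pi> n) m \<omega> / sqrt (real n)) t
      = stochastic_regret (P n) (X n) (\<pi> n) m \<omega> / sqrt (real n)"
    using t by (simp add: step_path_def m_def)
  ultimately have "dist (step_path n (\<lambda>m. stochastic_regret (P n) (X n) (\<pi> n) m \<omega> / sqrt (real n)) t)
      (drift_minus_sum drift (reward_path n \<omega>) t) = \<bar>drift * (real m / real n - t)\<bar>"
    by (simp add: dist_real_def right_diff_distrib)
  also have "\<dots> = drift * \<bar>real m / real n - t\<bar>" using drift_nonneg by (simp add: abs_mult)
  also have "\<bar>real m / real n - t\<bar> \<le> 1 / real n"
  proof -
    have "real m / real n - t = (real m - real n * t) / real n" using n0 by (simp add: field_simps)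
    then have "\<bar>real m / real n - t\<bar> = \<bar>real m - real n * t\<bar> / real n" by (simp add: abs_divide)
    also have "\<dots> \<le> 1 / real n" using m by (intro divide_right_mono) auto
    finally show ?thesis .
  qed
  finally show "dist (step_path n (\<lambda>m. stochastic_regret (P n) (X n) (\<pi> n) m \<omega> / sqrt (real n)) t)
      (drift_minus_sum drift (reward_path n \<omega>) t) \<le> drift / real n"
    using drift_nonneg by (simp add: mult_left_mono)
qed (rule step_path_cadlag)

text \<open>Continuous mapping handles the image of the reward path. The regret path stays within
  the deterministic distance \<open>drift / n\<close> of it, which changes the integral of a
  Lipschitz test function by at most \<open>\<bar>L\<bar> * drift / n\<close>.\<close>

lemma regret_convergence:
  "converges_weakly skorohod_topology M regret_path W (\<lambda>\<omega>. drift_minus_sum drift (limit_path \<omega>))"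
proof (rule Metric_space.converges_weakly_Lipschitz[OF Metric_space_skorohod, folded skorohod_topology_def])
  interpret B1: standard_brownian_motion W "B 1" by (rule brownian) simp
  show "prob_space W" by (rule B1.prob_space_axioms)
  show "\<forall>\<^sub>F n in sequentially. prob_space (M n) \<and> regret_path n \<in> M n \<rightarrow>\<^sub>M borel_of skorohod_topology"
    using eventually_good by eventually_elim (simp add: goodD regret_path_measurable)
  have dm: "drift_minus_sum drift \<in> borel_of skorohod_topology \<rightarrow>\<^sub>M borel_of skorohod_topology"
    by (rule continuous_map_measurable[OF drift_minus_sum_continuous[OF drift_nonneg]])
  show "(\<lambda>\<omega>. drift_minus_sum drift (limit_path \<omega>)) \<in> W \<rightarrow>\<^sub>M borel_of skorohod_topology"
    by (rule measurable_compose[OF limit_path_measurable dm])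
  fix f :: "(real \<Rightarrow> real) \<Rightarrow> real" and b L
  assume b: "\<And>x. x \<in> cadlag01 \<Longrightarrow> \<bar>f x\<bar> \<le> b"
    and L: "\<And>x y. x \<in> cadlag01 \<Longrightarrow> y \<in> cadlag01 \<Longrightarrow> \<bar>f x - f y\<bar> \<le> L * skorohod_dist x y"
  have f: "continuous_map skorohod_topology euclideanreal f"
    using Metric_space.Lipschitz_imp_continuous_map[OF Metric_space_skorohod, OF L] by (simp add: skorohod_topology_def)
  have "continuous_map skorohod_topology euclideanreal (f \<circ> drift_minus_sum drift)"
    by (rule continuous_map_compose[OF drift_minus_sum_continuous[OF drift_nonneg] f])
  moreover have "bounded ((f \<circ> drift_minus_sum drift) ` topspace skorohod_topology)"
    using b drift_minus_sum_cadlag by (auto simp: topspace_skorohod_topology bounded_iff intro!: exI[of _ b])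
  ultimately have "(\<lambda>n. \<integral>\<omega>. (f \<circ> drift_minus_sum drift) (reward_path n \<omega>) \<partial>M n)
      \<longlonglongrightarrow> (\<integral>\<omega>. (f \<circ> drift_minus_sum drift) (limit_path \<omega>) \<partial>W)"
    using reward_convergence unfolding converges_weakly_def by blast
  then have lim: "(\<lambda>n. \<integral>\<omega>. f (drift_minus_sum drift (reward_path n \<omega>)) \<partial>M n)
      \<longlonglongrightarrow> (\<integral>\<omega>. f (drift_minus_sum drift (limit_path \<omega>)) \<partial>W)" by simp
  have "(\<lambda>n. (\<integral>\<omega>. f (regret_path n \<omega>) \<partial>M n) - (\<integral>\<omega>. f (drift_minus_sum drift (reward_path n \<omega>)) \<partial>M n)) \<longlonglongrightarrow> 0"
  proof (rule Lim_null_comparison)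
    show "(\<lambda>n. \<bar>L\<bar> * drift / real n) \<longlonglongrightarrow> 0" by (rule lim_const_over_n)
    show "\<forall>\<^sub>F n in sequentially. norm ((\<integral>\<omega>. f (regret_path n \<omega>) \<partial>M n) - (\<integral>\<omega>. f (drift_minus_sum drift (reward_path n \<omega>)) \<partial>M n))
        \<le> \<bar>L\<bar> * drift / real n"
      using eventually_good
    proof eventually_elim
      case (elim n)
      interpret prob_space "M n" using goodD(5)[OF elim] .
      have int: "integrable (M n) (\<lambda>\<omega>. f (V \<omega>))" if "V \<in> M n \<rightarrow>\<^sub>M borel_of skorohod_topology" for V
        by (rule Metric_space.integrable_continuous_map[OF Metric_space_skorohod prob_space_axioms
              that[unfolded skorohod_topology_def] f[unfolded skorohod_topology_def] b])
      have i1: "integrable (M n) (\<lambda>\<omega>. f (regret_path n \<omega>))" by (rule int[OF regret_path_measurable[OF elim]])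
      have i2: "integrable (M n) (\<lambda>\<omega>. f (drift_minus_sum drift (reward_path n \<omega>)))"
        by (rule int[OF measurable_compose[OF reward_path_measurable[OF elim] dm]])
      have "\<bar>(\<integral>\<omega>. f (regret_path n \<omega>) \<partial>M n) - (\<integral>\<omega>. f (drift_minus_sum drift (reward_path n \<omega>)) \<partial>M n)\<bar>
          = \<bar>\<integral>\<omega>. f (regret_path n \<omega>) - f (drift_minus_sum drift (reward_path n \<omega>)) \<partial>M n\<bar>"
        using i1 i2 by simp
      also have "\<dots> \<le> (\<integral>\<omega>. \<bar>f (regret_path n \<omega>) - f (drift_minus_sum drift (reward_path n \<omega>))\<bar> \<partial>M n)"
        by (rule integral_abs_bound)
      also have "\<dots> \<le> \<bar>L\<bar> * drift / real n"
      proof (rule integral_le_const)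
        show "integrable (M n) (\<lambda>\<omega>. \<bar>f (regret_path n \<omega>) - f (drift_minus_sum drift (reward_path n \<omega>))\<bar>)"
          using i1 i2 by simp
        show "AE \<omega> in M n. \<bar>f (regret_path n \<omega>) - f (drift_minus_sum drift (reward_path n \<omega>))\<bar> \<le> \<bar>L\<bar> * drift / real n"
        proof (rule AE_I2)
          fix \<omega> assume \<omega>: "\<omega> \<in> space (M n)"
          have "\<bar>f (regret_path n \<omega>) - f (drift_minus_sum drift (reward_path n \<omega>))\<bar>
              \<le> L * skorohod_dist (regret_path n \<omega>) (drift_minus_sum drift (reward_path n \<omega>))"
            by (intro L drift_minus_sum_cadlag) (simp_all add: regret_path_def reward_path_def step_path_cadlag)
          also have "\<dots> \<le> \<bar>L\<bar> * (drift / real n)"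
            using regret_path_close[OF elim \<omega>] Metric_space.nonneg[OF Metric_space_skorohod]
            by (intro mult_mono) auto
          finally show "\<bar>f (regret_path n \<omega>) - f (drift_minus_sum drift (reward_path n \<omega>))\<bar> \<le> \<bar>L\<bar> * drift / real n"
            by simp
        qed
      qed
      finally show ?case by simp
    qed
  qed
  from tendsto_add[OF this lim]
  show "(\<lambda>n. \<integral>\<omega>. f (regret_path n \<omega>) \<partial>M n) \<longlonglongrightarrow> (\<integral>\<omega>. f (drift_minus_sum drift (limit_path \<omega>)) \<partial>W)" by simp
qed

text \<open>A pathwise identity: the maximum minus the average of two numbers is half their
  distance, and the normalising square roots cancel.\<close>

lemma drift_minus_sum_limit_path:
  "drift_minus_sum drift (limit_path \<omega>) = (\<lambda>t\<in>{0..1}.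
     let \<Delta>0 = \<bar>\<theta> 1 - \<theta> 2\<bar>;
         B' = - sqrt ((\<sigma> 1)\<^sup>2 / ((\<sigma> 1)\<^sup>2 + (\<sigma> 2)\<^sup>2)) * B 1 t \<omega>
             - sqrt ((\<sigma> 2)\<^sup>2 / ((\<sigma> 1)\<^sup>2 + (\<sigma> 2)\<^sup>2)) * B 2 t \<omega>
     in \<Delta>0 * t / 2 + sqrt (((\<sigma> 1)\<^sup>2 + (\<sigma> 2)\<^sup>2) / 2) * B')"
proof -
  define v where "v = (\<sigma> 1)\<^sup>2 + (\<sigma> 2)\<^sup>2"
  have scale: "sqrt (v / 2) * sqrt ((\<sigma> i)\<^sup>2 / v) = \<sigma> i / sqrt 2" if i: "i \<in> {1, 2}" for i
  proof (cases "v = 0")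
    \<comment> \<open>Both variances vanish; division by 0 yields 0, and the noise term is 0, as the
      claim reads it in this case.\<close>
    case True
    then have "\<sigma> i = 0" using i by (auto simp: v_def sum_power2_eq_zero_iff)
    then show ?thesis using True by simp
  next
    case False
    then have "v > 0" by (simp add: v_def less_le)
    then have "sqrt (v / 2) * sqrt ((\<sigma> i)\<^sup>2 / v) = sqrt ((\<sigma> i)\<^sup>2 / 2)"
      by (simp flip: real_sqrt_mult)
    also have "\<dots> = \<sigma> i / sqrt 2" using \<sigma>[OF i] by (simp add: real_sqrt_divide)
    finally show ?thesis .
  qed
  have "drift * t - (\<theta> 1 * t / 2 + \<sigma> 1 / sqrt 2 * b1) - (\<theta> 2 * t / 2 + \<sigma> 2 / sqrt 2 * b2)
      = \<bar>\<theta> 1 - \<theta> 2\<bar> * t / 2 + sqrt (v / 2) * (- sqrt ((\<sigma> 1)\<^sup>2 / v) * b1 - sqrt ((\<sigma> 2)\<^sup>2 / v) * b2)" for t b1 b2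
  proof -
    have "drift - \<theta> 1 / 2 - \<theta> 2 / 2 = \<bar>\<theta> 1 - \<theta> 2\<bar> / 2" by (simp add: drift_def max_def)
    then have "(drift - \<theta> 1 / 2 - \<theta> 2 / 2) * t = \<bar>\<theta> 1 - \<theta> 2\<bar> / 2 * t" by (simp only:)
    then have "drift * t - \<theta> 1 * t / 2 - \<theta> 2 * t / 2 = \<bar>\<theta> 1 - \<theta> 2\<bar> * t / 2" by (simp add: left_diff_distrib)
    moreover have "sqrt (v / 2) * (- sqrt ((\<sigma> 1)\<^sup>2 / v) * b1 - sqrt ((\<sigma> 2)\<^sup>2 / v) * b2)
        = - (sqrt (v / 2) * sqrt ((\<sigma> 1)\<^sup>2 / v) * b1) - sqrt (v / 2) * sqrt ((\<sigma> 2)\<^sup>2 / v) * b2"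
      by (simp only: right_diff_distrib mult_minus_left mult_minus_right mult.assoc)
    moreover have "sqrt (v / 2) * sqrt ((\<sigma> 1)\<^sup>2 / v) = \<sigma> 1 / sqrt 2" "sqrt (v / 2) * sqrt ((\<sigma> 2)\<^sup>2 / v) = \<sigma> 2 / sqrt 2"
      by (rule scale, simp)+
    ultimately show ?thesis by simp
  qed
  then show ?thesis
    unfolding drift_minus_sum_def limit_path_def limit_value_def Let_def v_def[symmetric]
    by (auto simp: fun_eq_iff)
qed

end

theorem theorem5:
  fixes \<rho> \<mu> :: real and \<theta> \<sigma> :: "nat \<Rightarrow> real"
    and M :: "nat \<Rightarrow> 'a measure" and P :: "nat \<Rightarrow> nat \<Rightarrow> real measure"
    and X :: "nat \<Rightarrow> nat \<Rightarrow> nat \<Rightarrow> 'a \<Rightarrow> real"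
    and S :: "nat \<Rightarrow> 'u measure" and U :: "nat \<Rightarrow> 'a \<Rightarrow> 'u"
    and \<pi> :: "nat \<Rightarrow> nat \<Rightarrow> 'a \<Rightarrow> nat"
    and W :: "'w measure" and B1 B2 :: "real \<Rightarrow> 'w \<Rightarrow> real"
  assumes "\<rho> > 1" and "\<mu> \<ge> 0"
    and "\<And>i. i \<in> {1, 2} \<Longrightarrow> \<theta> i \<ge> 0" and "\<And>i. i \<in> {1, 2} \<Longrightarrow> \<sigma> i \<ge> 0"
    and "\<forall>\<^sub>F n in sequentially. canonical_ucb (M n) (P n) (X n) \<rho> (S n) (U n) (\<pi> n)"
    and "\<forall>\<^sub>F n in sequentially. \<forall>i\<in>{1, 2}.
           arm_mean (P n i) = \<mu> + \<theta> i / sqrt (real n) \<and> arm_variance (P n i) = (\<sigma> i)\<^sup>2"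
    and "independent_brownian_motions W B1 B2"
  shows "converges_weakly skorohod_topology M
           (\<lambda>n \<omega>. \<lambda>t\<in>{0..1}.
              (centered_reward \<mu> (X n) (\<pi> n) 1 (nat \<lfloor>real n * t\<rfloor>) \<omega> / sqrt (real n),
               centered_reward \<mu> (X n) (\<pi> n) 2 (nat \<lfloor>real n * t\<rfloor>) \<omega> / sqrt (real n)))
           W
           (\<lambda>\<omega>. \<lambda>t\<in>{0..1}.
              (\<theta> 1 * t / 2 + \<sigma> 1 / sqrt 2 * B1 t \<omega>,
               \<theta> 2 * t / 2 + \<sigma> 2 / sqrt 2 * B2 t \<omega>))
       \<and> converges_weakly skorohod_topology M
           (\<lambda>n \<omega>. \<lambda>t\<in>{0..1}.
              stochastic_regret (P n) (X n) (\<pi> n) (nat \<lfloor>real n * t\<rfloor>) \<omega> / sqrt (real n))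
           W
           (\<lambda>\<omega>. \<lambda>t\<in>{0..1}.
              let \<Delta>0 = \<bar>\<theta> 1 - \<theta> 2\<bar>;
                  B = - sqrt ((\<sigma> 1)\<^sup>2 / ((\<sigma> 1)\<^sup>2 + (\<sigma> 2)\<^sup>2)) * B1 t \<omega>
                      - sqrt ((\<sigma> 2)\<^sup>2 / ((\<sigma> 1)\<^sup>2 + (\<sigma> 2)\<^sup>2)) * B2 t \<omega>
              in \<Delta>0 * t / 2 + sqrt (((\<sigma> 1)\<^sup>2 + (\<sigma> 2)\<^sup>2) / 2) * B)"
proof -
  define B where "B i = (if i = 1 then B1 else B2)" for i :: nat
  have B: "B 1 = B1" "B 2 = B2" by (simp_all add: B_def)
  interpret ucb_diffusion \<rho> \<mu> \<theta> \<sigma> M P X S U \<pi> W B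
    by unfold_locales (use assms B in auto)
  note reward = reward_convergence[unfolded reward_path_def limit_path_def limit_value_def step_path_def B]
  note regret = regret_convergence[unfolded drift_minus_sum_limit_path regret_path_def step_path_def B]
  show ?thesis by (rule conjI[OF reward regret])
qed

end
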